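(* Let $(p_j)_{j\ge1}\subset(1,\min\{2,\sqrt n\})$ with $p_j\downarrow1$. Assume that the data $(F_p,\phi_p,\beta_p)$ are admissible (see context) at $p=p_j$ for every $j$, with $\ell,\xi_1,\xi_2$ independent of $j$. Assume moreover that there is $F_1\in C^{0,\alpha}_{\mathrm{loc}}([0,\infty)^3)$ with $F_p\to F_1$ locally uniformly in $[0,\infty)^3$ as $p\downarrow1$, and that $\frac{\beta_p}{p-1}\to\mathbf c\in[0,1]$ as $p\downarrow1$. Let $u_{p_j}(x)=v_{p_j}(|x|)$ be the positive radial solutions of $-\Delta_{p}u=F_{p}(|x|,u,|\nabla u|)u^{-\beta_{p}}$ in $\mathbb R^n$ ($p=p_j$) described in the context. Then, after passing to a subsequence (not relabeled), there are $u:\mathbb R^n\to\mathbb R$ and $v:[0,\infty)\to\mathbb R$ with $$u_{p_j}\to u\ \text{ in } C_{\mathrm{loc}}(\mathbb R^n),\qquad \nabla u_{p_j}\stackrel{*}{\rightharpoonup}\nabla u\ \text{ in } L^\infty_{\mathrm{loc}}(\mathbb R^n;\mathbb R^n),$$ $$u(x)=v(|x|),\qquad u\in W^{1,\infty}(\mathbb R^n),\qquad 0\le u\le\xi_1,\qquad \|\nabla u\|_{L^\infty(\mathbb R^n)}\le\xi_2.$$ Moreover, for some radial $w:\mathbb R^n\to(0,1]$, $$u_{p_j}^{p_j-1}\to w\ \text{ a.e. and in } L^q_{\mathrm{loc}}(\mathbb R^n)\ \text{ for every } 1\le q<\infty,$$ $$(\max\{\ell,|x|\})^{-(n-1)}\le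 w(x)\le1\ \text{ a.e.},\qquad w=1\ \text{ a.e. on }\{u>0\}.$$ (i) There exist $\mathtt G\in W^{1,\infty}_{\mathrm{loc}}([0,\infty))$, $\mathtt K\in L^\infty_{\mathrm{loc}}([0,\infty))$ and $\mathbf z\in W^{1,\infty}_{\mathrm{loc}}(\mathbb R^n;\mathbb R^n)$ such that $$\mathtt G_{p_j}\to\mathtt G\ \text{ in } C_{\mathrm{loc}}([0,\infty)),\qquad 0\le\mathtt G\le1,\qquad \mathtt G(0)=0,$$ $$\mathbf z(x)=-\mathtt G(|x|)\frac{x}{|x|}\ (x\ne0),\qquad |\mathbf z|\le1,$$ $$-\operatorname{div}\mathbf z=\mathtt K(|x|),\qquad \mathtt K(r)=\mathtt G'(r)+\frac{n-1}{r}\mathtt G(r)\ \text{ for a.e. } r>0,$$ $$(\mathbf z,Du)=|Du|,\qquad \mathbf z\cdot\nabla u=|\nabla u|\ \text{ a.e. in }\mathbb R^n,$$ $$(1-\mathtt G(r))|v'(r)|=0\ \text{ for a.e. } r>0.$$ (ii) Set $\mathscr C_1:=\{r>0\mid\mathtt G(r)=1\}$ and $\mathscr C_<:=\{r>0\mid\mathtt G(r)<1\}$. Then $$\mathtt K(|x|)=w(x)^{-\mathbf c}F_1(|x|,u(x),0)\quad\text{for a.e. } x\in\mathbb R^n\text{ with }|x|\in\mathscr C_<,$$ and, if $|\mathscr C_1|>0$, $$\mathtt K(|x|)=\frac{n-1}{|x|}\quad\text{for a.e. } x\in\mathbb R^n\text{ with }|x|\in\mathscr C_1.$$ Finally, there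 exist $r_0>0$ and $\delta\in(0,1)$ such that, for all sufficiently large $j$, $$\sup_{|x|\le r_0}|\nabla u_{p_j}(x)|\le\delta^{1/(p_j-1)},$$ and $$\mathtt G(r)\le\delta<1\ \ (0\le r\le r_0),\qquad \nabla u=0\ \text{ a.e. in } B_{r_0}.$$
   Context: **Data and admissibility.** Let $n\ge2$ be an integer, $0<\alpha\le1$, and let $\ell,\xi_1,\xi_2>0$ be constants independent of $p$. For $1<p<\min\{2,\sqrt n\}$ put $\varphi_p(r):=\max\{\ell,r\}^{-\frac{n-p}{p-1}}$, $r\ge0$. For such $p$ let $\beta_p\in\mathbb R$ and functions $F_p:[0,\infty)^3\to\mathbb R$, $\phi_p:[0,\infty)^2\to\mathbb R$ be given (the function $\phi_p$ is not to be confused with $\varphi_p$). The data $(F_p,\phi_p,\beta_p)$ are *admissible at $p$* if all of the following hold: (0) $0\le\beta_p<p-1$ and $\ell^{-(n-p)/(p-1)}\le\xi_1^2$. (1) $F_p\in C^{0,\alpha}_{\mathrm{loc}}([0,\infty)^3)$, $\phi_p\in C^0([0,\infty)^2)$, and $0\le\phi_p(r,u)\le F_p(r,u,\rho)$ for all $r\ge0$, $0<u\le\xi_1$, $0\le\rho\le\xi_2$. (2) For every $r\ge0$, $u\mapsto\phi_p(r,u)$ is nondecreasing on $[0,\xi_1]$, and $(u,\rho)\mapsto F_p(r,u,\rho)$ is nondecreasing in each variable on $[0,\xi_1]\times[0,\xi_2]$. (3) $\xi_1^{p-1-\beta_p}\left(\frac{p-1}{n-p}\right)^{p-1}\int_0^\ell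 t^{n-1}\phi_p(t,\xi_1^{-1}\varphi_p(t))\,dt\ge1$. (4) $\int_0^\infty\left[s^{1-n}\int_0^s t^{n-1}F_p(t,\xi_1,\xi_2)\varphi_p(t)^{-\beta_p}\,dt\right]^{1/(p-1)}ds\le\xi_1^{1-\beta_p/(p-1)}$. (5) For every $s>0$, $s^{1-n}\int_0^s t^{n-1}F_p(t,\xi_1,\xi_2)\varphi_p(t)^{-\beta_p}\,dt\le\xi_2^{p-1}\xi_1^{-\beta_p}$. (6) There is a constant $C>0$, independent of $r$, with $F_p(r,\xi_1,\xi_2)\varphi_p(r)^{-\beta_p}<C$ for all $r\ge0$. (7) $\int_0^\infty t^{n-1}F_p(t,\xi_1,\xi_2)\varphi_p(t)^{-\beta_p}\,dt<\infty$. **The solutions.** $v_p\in C^1([0,\infty))$ denotes a function with $\xi_1^{-1}\varphi_p(r)\le v_p(r)\le\xi_1$ and $|v_p'(r)|\le\xi_2$ for $r\ge0$, with $\int_0^\infty\left[s^{1-n}\int_0^s t^{n-1}v_p(t)\,dt\right]^{1/(p-1)}ds<\infty$, and $$v_p(r)=\int_r^\infty\left[s^{1-n}\int_0^s t^{n-1}F_p(t,v_p(t),|v_p'(t)|)v_p(t)^{-\beta_p}\,dt\right]^{1/(p-1)}ds,\quad r\ge0$$ (such $v_p$ exists when the data are admissible at $p$). Put $u_p(x):=v_p(|x|)$, $$\mathtt K_p(r):=F_p(r,v_p(r),|v_p'(r)|)v_p(r)^{-\beta_p},\quad \mathtt G_p(r):=r^{1-n}\int_0^r s^{n-1}\mathtt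 K_p(s)\,ds\ (r>0),\quad \mathtt G_p(0):=0.$$ **Conventions.** $|E|$ is Lebesgue measure. $f_j\stackrel{*}{\rightharpoonup}f$ in $L^\infty_{\mathrm{loc}}(\Omega;\mathbb R^m)$ means $\int_U f_j\cdot\psi\,dx\to\int_U f\cdot\psi\,dx$ for every open $U\Subset\Omega$ and every $\psi\in L^1(U;\mathbb R^m)$. $W^{1,\infty}_{\mathrm{loc}}([0,\infty))$, $L^\infty_{\mathrm{loc}}([0,\infty))$ mean membership in the corresponding space on $(0,R)$ for every $R>0$. **Anzellotti pairing.** $|Du|$ is the total variation measure of the distributional derivative $Du$. For $\mathbf z\in L^\infty_{\mathrm{loc}}(\mathbb R^n;\mathbb R^n)$ with $\operatorname{div}\mathbf z\in L^\infty_{\mathrm{loc}}(\mathbb R^n)$ and $u\in BV_{\mathrm{loc}}(\mathbb R^n)\cap L^\infty_{\mathrm{loc}}(\mathbb R^n)$, $(\mathbf z,Du)$ is the Radon measure given by $\langle(\mathbf z,Du),\zeta\rangle=-\int u\,\zeta\operatorname{div}\mathbf z\,dx-\int u\,\mathbf z\cdot\nabla\zeta\,dx$ for $\zeta\in C_c^\infty(\mathbb R^n)$; $(\mathbf z,Du)=|Du|$ is equality of measures. *)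

theory Defs
  imports "HOL-Analysis.Analysis" "HOL-Probability.Essential_Supremum"
begin

section \<open>Function spaces and convergence\<close>

definition grad :: "('a::euclidean_space \<Rightarrow> real) \<Rightarrow> 'a \<Rightarrow> 'a" where
  "grad f x = (\<Sum>b\<in>Basis. frechet_derivative f (at x) b *\<^sub>R b)"

primrec C_k :: "nat \<Rightarrow> ('a::euclidean_space \<Rightarrow> real) \<Rightarrow> bool" where
  "C_k 0 f \<longleftrightarrow> continuous_on UNIV f"
| "C_k (Suc k) f \<longleftrightarrow> (\<forall>x. f differentiable (at x)) \<and> (\<forall>b\<in>Basis. C_k k (\<lambda>x. grad f x \<bullet> b))"

definition test_function :: "'a::euclidean_space set \<Rightarrow> ('a \<Rightarrow> real) \<Rightarrow> bool" where
  "test_function \<Omega> \<zeta> \<longleftrightarrow> (\<forall>k. C_k k \<zeta>) \<and>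
     compact (closure {x. \<zeta> x \<noteq> 0}) \<and> closure {x. \<zeta> x \<noteq> 0} \<subseteq> \<Omega>"

definition compactly_inside :: "'a::euclidean_space set \<Rightarrow> 'a set \<Rightarrow> bool" where
  "compactly_inside U \<Omega> \<longleftrightarrow> open U \<and> compact (closure U) \<and> closure U \<subseteq> \<Omega>"

definition L1_loc :: "'a::euclidean_space set \<Rightarrow> ('a \<Rightarrow> 'b::euclidean_space) \<Rightarrow> bool" where
  "L1_loc \<Omega> f \<longleftrightarrow> (\<forall>K. compact K \<and> K \<subseteq> \<Omega> \<longrightarrow> set_integrable lebesgue K f)"

definition Linf_norm :: "'a::euclidean_space set \<Rightarrow> ('a \<Rightarrow> 'b::euclidean_space) \<Rightarrow> ereal" where
  "Linf_norm \<Omega> f = esssup (lebesgue_on \<Omega>) (\<lambda>x. ereal (norm (f x)))"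

definition Linf :: "'a::euclidean_space set \<Rightarrow> ('a \<Rightarrow> 'b::euclidean_space) \<Rightarrow> bool" where
  "Linf \<Omega> f \<longleftrightarrow> f \<in> borel_measurable (lebesgue_on \<Omega>) \<and> Linf_norm \<Omega> f < \<infinity>"

definition Linf_loc :: "'a::euclidean_space set \<Rightarrow> ('a \<Rightarrow> 'b::euclidean_space) \<Rightarrow> bool" where
  "Linf_loc \<Omega> f \<longleftrightarrow> (\<forall>U. compactly_inside U \<Omega> \<longrightarrow> Linf U f)"

text \<open>Weak derivatives are relations; the second function is determined up to a null set.
  For functions on the real line, where \<^term>\<open>Basis = {1}\<close>, the weak gradient is the weak
  derivative.\<close>

definition has_weak_grad ::
    "'a::euclidean_space set \<Rightarrow> ('a \<Rightarrow> real) \<Rightarrow> ('a \<Rightarrow> 'a) \<Rightarrow> bool" where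
  "has_weak_grad \<Omega> u g \<longleftrightarrow> L1_loc \<Omega> u \<and> L1_loc \<Omega> g \<and>
     (\<forall>\<zeta>. test_function \<Omega> \<zeta> \<longrightarrow> (\<forall>b\<in>Basis.
        (LINT x:\<Omega>|lebesgue. u x * (grad \<zeta> x \<bullet> b)) = - (LINT x:\<Omega>|lebesgue. (g x \<bullet> b) * \<zeta> x)))"

definition has_weak_div ::
    "'a::euclidean_space set \<Rightarrow> ('a \<Rightarrow> 'a) \<Rightarrow> ('a \<Rightarrow> real) \<Rightarrow> bool" where
  "has_weak_div \<Omega> z d \<longleftrightarrow> L1_loc \<Omega> z \<and> L1_loc \<Omega> d \<and>
     (\<forall>\<zeta>. test_function \<Omega> \<zeta> \<longrightarrow>
        (LINT x:\<Omega>|lebesgue. z x \<bullet> grad \<zeta> x) = - (LINT x:\<Omega>|lebesgue. d x * \<zeta> x))"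

definition W1inf :: "'a::euclidean_space set \<Rightarrow> ('a \<Rightarrow> real) \<Rightarrow> bool" where
  "W1inf \<Omega> u \<longleftrightarrow> Linf \<Omega> u \<and> (\<exists>g. has_weak_grad \<Omega> u g \<and> Linf \<Omega> g)"

definition W1inf_loc :: "'a::euclidean_space set \<Rightarrow> ('a \<Rightarrow> real) \<Rightarrow> bool" where
  "W1inf_loc \<Omega> u \<longleftrightarrow> (\<forall>U. compactly_inside U \<Omega> \<longrightarrow> W1inf U u)"

definition W1inf_loc_vec :: "'a::euclidean_space set \<Rightarrow> ('a \<Rightarrow> 'b::euclidean_space) \<Rightarrow> bool" where
  "W1inf_loc_vec \<Omega> z \<longleftrightarrow> (\<forall>b\<in>Basis. W1inf_loc \<Omega> (\<lambda>x. z x \<bullet> b))"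

text \<open>On the half line, local means: up to the endpoint \<open>0\<close>.\<close>

definition Linf_loc_halfline :: "(real \<Rightarrow> real) \<Rightarrow> bool" where
  "Linf_loc_halfline f \<longleftrightarrow> (\<forall>R>0. Linf {0<..<R} f)"

definition W1inf_loc_halfline :: "(real \<Rightarrow> real) \<Rightarrow> bool" where
  "W1inf_loc_halfline f \<longleftrightarrow> (\<forall>R>0. W1inf {0<..<R} f)"

definition holder_loc :: "real \<Rightarrow> 'a::metric_space set \<Rightarrow> ('a \<Rightarrow> real) \<Rightarrow> bool" where
  "holder_loc \<alpha> S f \<longleftrightarrow> (\<forall>K. compact K \<and> K \<subseteq> S \<longrightarrow>
     (\<exists>C. \<forall>x\<in>K. \<forall>y\<in>K. dist (f x) (f y) \<le> C * dist x y powr \<alpha>))"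

definition loc_uniform_limit ::
    "'a::metric_space set \<Rightarrow> ('i \<Rightarrow> 'a \<Rightarrow> real) \<Rightarrow> ('a \<Rightarrow> real) \<Rightarrow> 'i filter \<Rightarrow> bool" where
  "loc_uniform_limit S f g \<F> \<longleftrightarrow> (\<forall>K. compact K \<and> K \<subseteq> S \<longrightarrow> uniform_limit K f g \<F>)"

definition weak_star_Linf_loc ::
    "'a::euclidean_space set \<Rightarrow> (nat \<Rightarrow> 'a \<Rightarrow> 'b::euclidean_space) \<Rightarrow> ('a \<Rightarrow> 'b) \<Rightarrow> bool" where
  "weak_star_Linf_loc \<Omega> f g \<longleftrightarrow> (\<forall>j. Linf_loc \<Omega> (f j)) \<and> Linf_loc \<Omega> g \<and>
     (\<forall>U \<psi>. compactly_inside U \<Omega> \<and> set_integrable lebesgue U \<psi> \<longrightarrow>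
        (\<lambda>j. LINT x:U|lebesgue. f j x \<bullet> \<psi> x) \<longlonglongrightarrow> (LINT x:U|lebesgue. g x \<bullet> \<psi> x))"

definition Lq_loc :: "real \<Rightarrow> ('a::euclidean_space \<Rightarrow> real) \<Rightarrow> bool" where
  "Lq_loc q f \<longleftrightarrow> f \<in> borel_measurable lebesgue \<and>
     (\<forall>K. compact K \<longrightarrow> (\<integral>\<^sup>+x\<in>K. ennreal (\<bar>f x\<bar> powr q) \<partial>lebesgue) < \<infinity>)"

definition Lq_loc_limit ::
    "real \<Rightarrow> (nat \<Rightarrow> 'a::euclidean_space \<Rightarrow> real) \<Rightarrow> ('a \<Rightarrow> real) \<Rightarrow> bool" where
  "Lq_loc_limit q f g \<longleftrightarrow> (\<forall>j. Lq_loc q (f j)) \<and> Lq_loc q g \<and>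
     (\<forall>K. compact K \<longrightarrow>
        (\<lambda>j. \<integral>\<^sup>+x\<in>K. ennreal (\<bar>f j x - g x\<bar> powr q) \<partial>lebesgue) \<longlonglongrightarrow> 0)"

definition radial :: "('a::real_normed_vector \<Rightarrow> 'b) \<Rightarrow> bool" where
  "radial f \<longleftrightarrow> (\<forall>x y. norm x = norm y \<longrightarrow> f x = f y)"


section \<open>Radon measures, total variation and the Anzellotti pairing\<close>

definition radon :: "'a::euclidean_space measure \<Rightarrow> bool" where
  "radon \<mu> \<longleftrightarrow> sets \<mu> = sets borel \<and> (\<forall>K. compact K \<longrightarrow> emeasure \<mu> K < \<infinity>)"

text \<open>A signed Radon measure is given by a pair of positive ones standing for their difference.
  The pair is not unique; only the values on bounded Borel sets and the
  integrals of compactly supported functions matter.\<close>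

type_synonym 'a signed_radon = "'a measure \<times> 'a measure"

definition signed_radon :: "'a::euclidean_space signed_radon \<Rightarrow> bool" where
  "signed_radon \<nu> \<longleftrightarrow> radon (fst \<nu>) \<and> radon (snd \<nu>)"

definition signed_value :: "'a::euclidean_space signed_radon \<Rightarrow> 'a set \<Rightarrow> real" where
  "signed_value \<nu> A = measure (fst \<nu>) A - measure (snd \<nu>) A"

definition signed_integral :: "'a::euclidean_space signed_radon \<Rightarrow> ('a \<Rightarrow> real) \<Rightarrow> real" where
  "signed_integral \<nu> f = integral\<^sup>L (fst \<nu>) f - integral\<^sup>L (snd \<nu>) f"

text \<open>\<open>D b\<close>, for \<open>b \<in> Basis\<close>, is the \<open>b\<close>-component of the vector measure \<open>Du\<close>.\<close>

definition has_measure_derivative ::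
    "('a::euclidean_space \<Rightarrow> real) \<Rightarrow> ('a \<Rightarrow> 'a signed_radon) \<Rightarrow> bool" where
  "has_measure_derivative u D \<longleftrightarrow> (\<forall>b\<in>Basis. signed_radon (D b)) \<and>
     (\<forall>\<zeta>. test_function UNIV \<zeta> \<longrightarrow> (\<forall>b\<in>Basis.
        (LINT x|lebesgue. u x * (grad \<zeta> x \<bullet> b)) = - signed_integral (D b) \<zeta>))"

definition BV_loc :: "('a::euclidean_space \<Rightarrow> real) \<Rightarrow> bool" where
  "BV_loc u \<longleftrightarrow> L1_loc UNIV u \<and> (\<exists>D. has_measure_derivative u D)"

definition vector_value :: "('a::euclidean_space \<Rightarrow> 'a signed_radon) \<Rightarrow> 'a set \<Rightarrow> 'a" where
  "vector_value D A = (\<Sum>b\<in>Basis. signed_value (D b) A *\<^sub>R b)"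

text \<open>The pieces of the partitions are bounded because a vector-valued Radon measure need not be
  defined on unbounded sets.\<close>

definition is_total_variation ::
    "('a::euclidean_space \<Rightarrow> 'a signed_radon) \<Rightarrow> 'a measure \<Rightarrow> bool" where
  "is_total_variation D \<mu> \<longleftrightarrow> sets \<mu> = sets borel \<and>
     (\<forall>A\<in>sets borel. emeasure \<mu> A =
        (SUP E\<in>{E :: nat \<Rightarrow> 'a set. disjoint_family E \<and> (\<Union>i. E i) = A \<and>
                   (\<forall>i. E i \<in> sets borel \<and> bounded (E i))}.
           \<Sum>i. ennreal (norm (vector_value D (E i)))))"

definition is_anzellotti_pairing ::
    "('a::euclidean_space \<Rightarrow> 'a) \<Rightarrow> ('a \<Rightarrow> real) \<Rightarrow> 'a signed_radon \<Rightarrow> bool" where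
  "is_anzellotti_pairing z u \<nu> \<longleftrightarrow>
     Linf_loc UNIV z \<and> BV_loc u \<and> Linf_loc UNIV u \<and> signed_radon \<nu> \<and>
     (\<exists>d. Linf_loc UNIV d \<and> has_weak_div UNIV z d \<and>
        (\<forall>\<zeta>. test_function UNIV \<zeta> \<longrightarrow>
           signed_integral \<nu> \<zeta> =
             - (LINT x|lebesgue. u x * \<zeta> x * d x) - (LINT x|lebesgue. u x * (z x \<bullet> grad \<zeta> x))))"

text \<open>\<open>(z, Du) = |Du|\<close>: all three measures are unique, so the existential quantifiers only
  name them.\<close>

definition pairing_eq_total_variation ::
    "('a::euclidean_space \<Rightarrow> 'a) \<Rightarrow> ('a \<Rightarrow> real) \<Rightarrow> bool" where
  "pairing_eq_total_variation z u \<longleftrightarrow>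
     (\<exists>\<nu> D \<mu>. is_anzellotti_pairing z u \<nu> \<and>
        has_measure_derivative u D \<and> is_total_variation D \<mu> \<and>
        (\<forall>A\<in>sets borel. bounded A \<longrightarrow> signed_value \<nu> A = measure \<mu> A))"


section \<open>The radial problem\<close>

text \<open>Functions on \<open>[0,\<infinity>)\<close> are functions on the reals whose values at negative arguments are
  irrelevant; \<open>half_deriv\<close> is the derivative on \<open>[0,\<infinity>)\<close>, one-sided at \<open>0\<close>.\<close>

definition half_deriv :: "(real \<Rightarrow> real) \<Rightarrow> real \<Rightarrow> real" where
  "half_deriv f r = vector_derivative f (at r within {0..})"

definition C1_halfline :: "(real \<Rightarrow> real) \<Rightarrow> bool" where
  "C1_halfline f \<longleftrightarrow>
     (\<forall>r\<ge>0. f differentiable (at r within {0..})) \<and> continuous_on {0..} (half_deriv f)"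

definition barrier :: "nat \<Rightarrow> real \<Rightarrow> real \<Rightarrow> real \<Rightarrow> real" where
  "barrier n l p r = max l r powr (- ((real n - p) / (p - 1)))"

definition flux :: "nat \<Rightarrow> (real \<Rightarrow> real) \<Rightarrow> real \<Rightarrow> real" where
  "flux n k s = (if s = 0 then 0
     else s powr (1 - real n) * (LBINT t:{0..s}. t ^ (n - 1) * k t))"

text \<open>Possibly divergent integrals of nonnegative functions are taken in \<^typ>\<open>ennreal\<close>, so that
  the bounds include convergence.\<close>

definition admissible ::
    "nat \<Rightarrow> real \<Rightarrow> real \<Rightarrow> real \<Rightarrow> real \<Rightarrow> real \<Rightarrow>
     (real \<times> real \<times> real \<Rightarrow> real) \<Rightarrow> (real \<times> real \<Rightarrow> real) \<Rightarrow> real \<Rightarrow> bool" where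
  "admissible n \<alpha> l \<xi>1 \<xi>2 p F \<phi> \<beta> \<longleftrightarrow>
     0 \<le> \<beta> \<and> \<beta> < p - 1 \<and> l powr (- ((real n - p) / (p - 1))) \<le> \<xi>1\<^sup>2 \<and>
     holder_loc \<alpha> ({0..} \<times> {0..} \<times> {0..}) F \<and>
     continuous_on ({0..} \<times> {0..}) \<phi> \<and>
     (\<forall>r u \<rho>. 0 \<le> r \<and> 0 < u \<and> u \<le> \<xi>1 \<and> 0 \<le> \<rho> \<and> \<rho> \<le> \<xi>2 \<longrightarrow>
        0 \<le> \<phi> (r, u) \<and> \<phi> (r, u) \<le> F (r, u, \<rho>)) \<and>
     (\<forall>r\<ge>0. mono_on {0..\<xi>1} (\<lambda>u. \<phi> (r, u)) \<and>
        (\<forall>\<rho>\<in>{0..\<xi>2}. mono_on {0..\<xi>1} (\<lambda>u. F (r, u, \<rho>))) \<and>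
        (\<forall>u\<in>{0..\<xi>1}. mono_on {0..\<xi>2} (\<lambda>\<rho>. F (r, u, \<rho>)))) \<and>
     \<xi>1 powr (p - 1 - \<beta>) * ((p - 1) / (real n - p)) powr (p - 1) *
        (LBINT t:{0..l}. t ^ (n - 1) * \<phi> (t, inverse \<xi>1 * barrier n l p t)) \<ge> 1 \<and>
     (\<integral>\<^sup>+s\<in>{0..}. ennreal
          (flux n (\<lambda>t. F (t, \<xi>1, \<xi>2) * barrier n l p t powr (- \<beta>)) s powr (1 / (p - 1))) \<partial>lborel)
        \<le> ennreal (\<xi>1 powr (1 - \<beta> / (p - 1))) \<and>
     (\<forall>s>0. flux n (\<lambda>t. F (t, \<xi>1, \<xi>2) * barrier n l p t powr (- \<beta>)) s
        \<le> \<xi>2 powr (p - 1) * \<xi>1 powr (- \<beta>)) \<and>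
     (\<exists>C>0. \<forall>r\<ge>0. F (r, \<xi>1, \<xi>2) * barrier n l p r powr (- \<beta>) < C) \<and>
     (\<integral>\<^sup>+t\<in>{0..}. ennreal
          (t ^ (n - 1) * (F (t, \<xi>1, \<xi>2) * barrier n l p t powr (- \<beta>))) \<partial>lborel) < \<infinity>"

definition source ::
    "(real \<times> real \<times> real \<Rightarrow> real) \<Rightarrow> real \<Rightarrow> (real \<Rightarrow> real) \<Rightarrow> real \<Rightarrow> real" where
  "source F \<beta> v r = F (r, v r, \<bar>half_deriv v r\<bar>) * v r powr (- \<beta>)"

text \<open>In the integral equation \<open>v\<close> is positive, so it cannot hold with the
  default value \<open>0\<close> of a divergent integral.\<close>

definition radial_solution ::
    "nat \<Rightarrow> real \<Rightarrow> real \<Rightarrow> real \<Rightarrow> real \<Rightarrow>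
     (real \<times> real \<times> real \<Rightarrow> real) \<Rightarrow> real \<Rightarrow> (real \<Rightarrow> real) \<Rightarrow> bool" where
  "radial_solution n l \<xi>1 \<xi>2 p F \<beta> v \<longleftrightarrow>
     C1_halfline v \<and>
     (\<forall>r\<ge>0. inverse \<xi>1 * barrier n l p r \<le> v r \<and> v r \<le> \<xi>1 \<and> \<bar>half_deriv v r\<bar> \<le> \<xi>2) \<and>
     (\<integral>\<^sup>+s\<in>{0..}. ennreal (flux n v s powr (1 / (p - 1))) \<partial>lborel) < \<infinity> \<and>
     (\<forall>r\<ge>0. v r = (LBINT s:{r..}. flux n (source F \<beta> v) s powr (1 / (p - 1))))"

end

theory Submission
  imports Defs "HOL-Probability.Helly_Selection" "HOL-Complex_Analysis.Great_Picard"
begin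

text \<open>Write \<open>v\<^sub>j\<close>, \<open>G\<^sub>j\<close>, \<open>K\<^sub>j\<close> for the profile, flux and source at \<open>p = p\<^sub>j\<close>. The integral
  equation says \<open>v\<^sub>j' = - G\<^sub>j powr (1 / (p\<^sub>j - 1))\<close>, so \<open>\<bar>v\<^sub>j'\<bar> \<le> \<xi>2\<close> bounds \<open>G\<^sub>j\<close> by
  \<open>\<xi>2 powr (p\<^sub>j - 1)\<close>, which tends to \<open>1\<close>, and the barrier bounds \<open>K\<^sub>j\<close> locally uniformly. Hence \<open>v\<^sub>j\<close>
  and \<open>G\<^sub>j\<close> are locally equi-Lipschitz, and the monotone functions \<open>v\<^sub>j powr (p\<^sub>j - 1)\<close> converge off a
  countable set of radii by Helly's theorem. Where the limit \<open>G\<close> is below \<open>1\<close>, \<open>v\<^sub>j'\<close> tends to \<open>0\<close> and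
  \<open>K\<^sub>j\<close> converges pointwise to \<open>w powr (- c) * F1 (r, v, 0)\<close>; on \<open>{G = 1}\<close> the weak derivative of \<open>G\<close>
  vanishes, so there \<open>K = (n - 1) / r\<close>. The weak derivatives of radial functions and fields are
  obtained as weak limits: the derivatives of the profiles converge weakly in dimension one, and
  pushing a test function forward under the norm carries this to \<open>n\<close> dimensions. The pairing
  \<open>(z, Du)\<close> is read off the divergence of the radial field with profile \<open>v * G\<close>.\<close>

section \<open>Radial functions and weak convergence\<close>

text \<open>The first obstacle is that \<open>v\<close> may tend to \<open>0\<close>, so
  \<open>v powr (- \<beta>)\<close> is controlled only through \<open>v powr (p - 1)\<close>. The
  exponent of the barrier has denominator \<open>p - 1\<close>, which this power cancels, and
  \<open>\<beta> < p - 1\<close> makes \<open>v powr (- \<beta>)\<close> a power of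
  \<open>v powr (p - 1)\<close> with exponent in \<open>(-1, 0]\<close>. That keeps the sources
  bounded as \<open>p\<close> tends to \<open>1\<close> and is the origin of the factor
  \<open>w powr (- c)\<close>. The condition on \<open>l\<close>, raised to the power
  \<open>p - 1\<close>, forces \<open>l \<ge> 1\<close> in the limit; this is why the lower bound
  for \<open>w\<close> does not exceed \<open>1\<close>. The second obstacle is that weak limits fix
  functions only up to null sets. The representatives of \<open>w\<close>, of \<open>K\<close> and
  of the weak derivatives of \<open>v\<close> and \<open>G\<close> are therefore chosen so that
  their bounds and relations, such as \<open>v' * G = v'\<close>, hold at every radius; the
  convergence to \<open>w\<close> and \<open>w = 1\<close> on \<open>{u > 0}\<close> remain almost
  everywhere statements. The Lipschitz limits themselves are never differentiated pointwise.\<close>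

lemma distr_norm_lborel:
  "distr lborel borel (norm :: 'a::euclidean_space \<Rightarrow> real) =
   density lborel (\<lambda>r. ennreal (real DIM('a) * unit_ball_vol (real DIM('a)) * r ^ (DIM('a) - 1)) * indicator {0..} r)"
    (is "?L = density lborel ?f")
proof (rule measure_eqI_generator_eq[where E="range atMost" and \<Omega>=UNIV and A="\<lambda>i. {..real i}"])
  \<comment> \<open>The rays \<open>{..r}\<close> generate the Borel sets and are stable under
    intersection. The mass of a ray is the volume of a ball on the left and the increment of an
    explicit antiderivative on the right; both vanish for negative \<open>r\<close>.\<close>
  have vol: "emeasure ?L {..r} = ennreal (unit_ball_vol (real DIM('a)) * r ^ DIM('a))" if "0 \<le> r" for r
  proof -
    have "emeasure ?L {..r} = emeasure lborel (cball (0::'a) r)"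
      by (subst emeasure_distr) (auto simp: cball_def vimage_def intro!: arg_cong[where f="emeasure lborel"])
    also have "\<dots> = ennreal (measure lborel (cball (0::'a) r))"
      using emeasure_bounded_finite[of "cball (0::'a) r"]
      by (intro emeasure_eq_ennreal_measure) auto
    also have "measure lborel (cball (0::'a) r) = unit_ball_vol (real DIM('a)) * r ^ DIM('a)"
      using content_cball[OF that, of "0::'a"] by simp
    finally show ?thesis .
  qed
  have neg: "emeasure ?L {..r} = 0" if "r < 0" for r
  proof -
    have "{x::'a. norm x \<le> r} = {}" using that by (auto simp: not_le intro: less_le_trans)
    then show ?thesis by (subst emeasure_distr) (auto simp: vimage_def)
  qed
  show "emeasure ?L X = emeasure (density lborel ?f) X" if "X \<in> range atMost" for X
  proof -
    from that obtain r where X: "X = {..r}" by auto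
    have "emeasure (density lborel ?f) X = (\<integral>\<^sup>+x. ?f x * indicator {..r} x \<partial>lborel)"
      unfolding X by (subst emeasure_density) auto
    also have "\<dots> = (\<integral>\<^sup>+x. ennreal (real DIM('a) * unit_ball_vol (real DIM('a)) * x ^ (DIM('a) - 1)) * indicator {0..r} x \<partial>lborel)"
      by (intro nn_integral_cong) (auto split: split_indicator)
    also have "\<dots> = emeasure ?L X"
    proof (cases "0 \<le> r")
      case True
      have "(\<integral>\<^sup>+x. ennreal (real DIM('a) * unit_ball_vol (real DIM('a)) * x ^ (DIM('a) - 1)) * indicator {0..r} x \<partial>lborel)
         = ennreal (unit_ball_vol (real DIM('a)) * r ^ DIM('a) - unit_ball_vol (real DIM('a)) * 0 ^ DIM('a))"
        by (rule nn_integral_FTC_Icc) (use True in \<open>auto intro!: derivative_eq_intros\<close>)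
      then show ?thesis using vol[OF True] X by (simp add: power_0_left)
    next
      case False
      then show ?thesis using neg[of r] X by simp
    qed
    finally show ?thesis ..
  qed
  show "Int_stable (range (atMost :: real \<Rightarrow> _))"
    by (auto simp: Int_stable_def Int_atMost)
  show "sets ?L = sigma_sets UNIV (range atMost)"
    by (simp add: borel_eq_atMost)
  show "sets (density lborel ?f) = sigma_sets UNIV (range atMost)"
    by (simp add: borel_eq_atMost)
  show "(\<Union>i. {..real i}) = UNIV" by (auto intro: real_arch_simple)
  show "emeasure ?L {..real i} \<noteq> \<infinity>" for i by (simp add: vol)
qed auto

text \<open>The law of the norm has a density, hence is absolutely continuous. This turns almost
  everywhere statements about radii into such statements about points.\<close>

lemma null_sets_norm_vimage:
  assumes "A \<in> null_sets lborel"
  shows "(norm :: 'a::euclidean_space \<Rightarrow> real) -` A \<in> null_sets lborel"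
proof -
  have A: "A \<in> sets borel" using assms by auto
  have meas: "(\<lambda>r. ennreal (real DIM('a) * unit_ball_vol (real DIM('a)) * r ^ (DIM('a) - 1)) * indicator {0..} r)
      \<in> borel_measurable lborel" by measurable
  have "emeasure lborel ((norm :: 'a \<Rightarrow> real) -` A) = emeasure (distr lborel borel (norm :: 'a \<Rightarrow> real)) A"
    using A by (subst emeasure_distr) auto
  also have "\<dots> = 0"
    unfolding distr_norm_lborel
    using absolutely_continuousI_density[OF meas] assms
    unfolding absolutely_continuous_def by (blast dest: null_setsD1)
  finally have "emeasure lborel ((norm :: 'a \<Rightarrow> real) -` A) = 0" .
  moreover have "(norm :: 'a \<Rightarrow> real) -` A \<in> sets borel"
    using measurable_sets_borel[OF borel_measurable_norm A] by simp
  ultimately show ?thesis by (auto simp: null_sets_def)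
qed

lemma AE_lebesgue_norm:
  assumes "AE r in lebesgue. 0 < r \<longrightarrow> P r"
  shows "AE x :: 'a::euclidean_space in lebesgue. x \<noteq> 0 \<longrightarrow> P (norm x)"
proof -
  obtain N where N: "N \<in> null_sets lebesgue" "{r. \<not> (0 < r \<longrightarrow> P r)} \<subseteq> N"
    using assms unfolding eventually_ae_filter by auto
  \<comment> \<open>The preimage under \<open>norm\<close> is known to be null for Borel null sets,
    so the Lebesgue null set is first enlarged to one.\<close>
  then obtain A where A: "A \<in> null_sets lborel" "{r. \<not> (0 < r \<longrightarrow> P r)} \<subseteq> A"
    unfolding null_sets_completion_iff2 by blast
  show ?thesis
    by (rule AE_completion, rule AE_I'[OF null_sets_norm_vimage[OF A(1)]]) (use A(2) in \<open>auto simp: subset_iff\<close>)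
qed

text \<open>The three-epsilon argument as a rule: the approximating sequence and its limit may
  depend on the error. It passes a limit through a density argument.\<close>

lemma tendsto_real_approx:
  fixes x :: "nat \<Rightarrow> real"
  assumes "\<And>e. 0 < e \<Longrightarrow> \<exists>a L. a \<longlonglongrightarrow> L \<and> (\<forall>\<^sub>F j in sequentially. \<bar>x j - a j\<bar> \<le> e) \<and> \<bar>y - L\<bar> \<le> e"
  shows "x \<longlonglongrightarrow> y"
proof (rule LIMSEQ_I)
  fix e :: real assume "0 < e"
  then obtain a L where a: "a \<longlonglongrightarrow> L" "\<forall>\<^sub>F j in sequentially. \<bar>x j - a j\<bar> \<le> e / 4" "\<bar>y - L\<bar> \<le> e / 4"
    using assms[of "e / 4"] by auto
  from a(1) \<open>0 < e\<close> have "\<forall>\<^sub>F j in sequentially. \<bar>a j - L\<bar> < e / 4"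
    by (auto dest!: tendstoD[where e="e / 4"] simp: dist_real_def)
  with a(2) have "\<forall>\<^sub>F j in sequentially. norm (x j - y) < e"
    by eventually_elim (use a(3) \<open>0 < e\<close> in \<open>unfold real_norm_def, arith\<close>)
  then show "\<exists>N. \<forall>n\<ge>N. norm (x n - y) < e"
    by (simp add: eventually_sequentially)
qed

text \<open>The sets on which the integrals converge form a Dynkin system: complements use the
  convergence of the total integrals, and for disjoint unions the common majorant \<open>b\<close>
  gives a summable bound uniform in \<open>j\<close>, so that Tannery's theorem exchanges limit and
  series. No pointwise convergence of \<open>f j\<close> enters.\<close>

lemma tendsto_set_integral_borel:
  fixes f :: "nat \<Rightarrow> real \<Rightarrow> real"
  assumes f: "\<And>j. f j \<in> borel_measurable borel" "integrable lborel f0" "integrable lborel b"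
    and le: "\<And>j x. \<bar>f j x\<bar> \<le> b x"
    and lim: "(\<lambda>j. integral\<^sup>L lborel (f j)) \<longlonglongrightarrow> integral\<^sup>L lborel f0"
    and lim_atMost: "\<And>r. (\<lambda>j. LBINT x:{..r}. f j x) \<longlonglongrightarrow> (LBINT x:{..r}. f0 x)"
    and A: "A \<in> sets borel"
  shows "(\<lambda>j. LBINT x:A. f j x) \<longlonglongrightarrow> (LBINT x:A. f0 x)"
proof -
  have fi: "integrable lborel (f j)" for j
    by (rule Bochner_Integration.integrable_bound[OF f(3)]) (use f le in \<open>auto intro: order_trans[OF le abs_ge_self]\<close>)
  have si: "set_integrable lborel B g" if "B \<in> sets borel" "integrable lborel g" for B and g :: "real \<Rightarrow> real"
    using that unfolding set_integrable_def by (intro integrable_mult_indicator) auto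
  have "Int_stable (range (atMost :: real \<Rightarrow> _))"
    by (auto simp: Int_stable_def Int_atMost)
  moreover have "range (atMost :: real \<Rightarrow> _) \<subseteq> Pow UNIV" by simp
  moreover have "A \<in> sigma_sets UNIV (range (atMost :: real \<Rightarrow> _))"
    using A unfolding borel_eq_atMost by simp
  ultimately show ?thesis
  proof (induction rule: sigma_sets_induct_disjoint)
    case (basic A)
    then show ?case using lim_atMost by auto
  next
    case empty
    then show ?case by (simp add: set_lebesgue_integral_def)
  next
    case (compl A)
    then have "A \<in> sets borel" unfolding borel_eq_atMost by simp
    have *: "(LBINT x:UNIV - A. g x) = integral\<^sup>L lborel g - (LBINT x:A. g x)"
      if "integrable lborel g" for g :: "real \<Rightarrow> real"
    proof -
      have "(LBINT x:UNIV - A. g x) = (LINT x|lborel. g x - indicator A x *\<^sub>R g x)"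
        unfolding set_lebesgue_integral_def by (intro Bochner_Integration.integral_cong) (auto split: split_indicator)
      also have "\<dots> = integral\<^sup>L lborel g - (LBINT x:A. g x)"
        unfolding set_lebesgue_integral_def
        by (rule Bochner_Integration.integral_diff)
           (use that si[OF \<open>A \<in> sets borel\<close> that] in \<open>auto simp: set_integrable_def\<close>)
      finally show ?thesis .
    qed
    show ?case unfolding *[OF fi] *[OF f(2)] by (intro tendsto_intros lim compl.IH)
  next
    case (union A)
    then have A: "A i \<in> sets borel" for i unfolding borel_eq_atMost by auto
    have UN: "(LBINT x:(\<Union>i. A i). g x) = (\<Sum>i. LBINT x:A i. g x)"
      if "integrable lborel g" for g :: "real \<Rightarrow> real"
      by (rule lebesgue_integral_countable_add)
         (use A union.hyps that in \<open>auto intro!: si simp: disjoint_family_on_def\<close>)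
    have bd: "\<bar>LBINT x:A i. f j x\<bar> \<le> (LBINT x:A i. b x)" for i j
    proof -
      have "\<bar>LBINT x:A i. f j x\<bar> \<le> (LBINT x:A i. \<bar>f j x\<bar>)"
        using set_integral_norm_bound[OF si[OF A fi]] by simp
      also have "\<dots> \<le> (LBINT x:A i. b x)"
        by (rule set_integral_mono) (use A fi f le in \<open>auto intro!: si\<close>)
      finally show ?thesis .
    qed
    have b0: "0 \<le> b x" for x using le[of 0 x] by (rule order_trans[OF abs_ge_zero])
    have sum: "summable (\<lambda>i. LBINT x:A i. b x)"
    proof (rule bounded_imp_summable)
      show "0 \<le> (LBINT x:A i. b x)" for i
        unfolding set_lebesgue_integral_def using b0 by simp
      show "(\<Sum>i\<le>n. LBINT x:A i. b x) \<le> integral\<^sup>L lborel b" for n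
      proof -
        have i: "integrable lborel (\<lambda>x. indicator (A i) x * b x)" for i
          using si[OF A f(3)] by (simp add: set_integrable_def)
        have "(\<Sum>i\<le>n. LBINT x:A i. b x) = (LBINT x. (\<Sum>i\<le>n. indicator (A i) x * b x))"
          unfolding set_lebesgue_integral_def using i by (subst Bochner_Integration.integral_sum) auto
        also have "\<dots> \<le> integral\<^sup>L lborel b"
        proof (rule integral_mono)
          show "integrable lborel (\<lambda>x. \<Sum>i\<le>n. indicator (A i) x * b x)"
            by (rule Bochner_Integration.integrable_sum) (rule i)
          fix x
          have "(\<Sum>i\<le>n. indicator (A i) x * b x) = indicator (\<Union>i\<le>n. A i) x * b x"
            using disjoint_family_on_mono[OF subset_UNIV union.hyps(1)]
            by (subst indicator_UN_disjoint) (auto simp: sum_distrib_right)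
          also have "\<dots> \<le> b x" using b0 by (auto split: split_indicator)
          finally show "(\<Sum>i\<le>n. indicator (A i) x * b x) \<le> b x" .
        qed fact
        finally show ?thesis .
      qed
    qed
    have "((\<lambda>j. \<Sum>i. LBINT x:A i. f j x) \<longlongrightarrow> (\<Sum>i. LBINT x:A i. f0 x)) sequentially"
      by (rule tannerys_theorem[where M="\<lambda>i. LBINT x:A i. b x", THEN conjunct2, THEN conjunct2])
         (use union.IH bd sum in \<open>auto intro!: always_eventually\<close>)
    then show ?case unfolding UN[OF fi] UN[OF f(2)] .
  qed
qed

text \<open>Convergence on sets of finite measure extends to integrable weights because simple
  functions are dense in \<open>L^1\<close> and the functionals given by \<open>f j\<close> are
  bounded by \<open>C\<close> uniformly in \<open>j\<close>.\<close>

lemma tendsto_integral_mult_weak: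
  fixes f :: "nat \<Rightarrow> real \<Rightarrow> real"
  assumes f: "\<And>j. f j \<in> borel_measurable borel" "f0 \<in> borel_measurable borel"
    and le: "\<And>j x. \<bar>f j x\<bar> \<le> C" "\<And>x. \<bar>f0 x\<bar> \<le> C"
    and lim: "\<And>A. A \<in> sets borel \<Longrightarrow> emeasure lborel A < \<infinity> \<Longrightarrow>
      (\<lambda>j. LBINT x:A. f j x) \<longlonglongrightarrow> (LBINT x:A. f0 x)"
    and \<gamma>: "integrable lborel \<gamma>"
  shows "(\<lambda>j. \<integral>x. f j x * \<gamma> x \<partial>lborel) \<longlonglongrightarrow> (LBINT x. f0 x * \<gamma> x)"
proof -
  have C0: "0 \<le> C" using le(2)[of 0] by simp
  have int: "integrable lborel (\<lambda>x. h x * g x)"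
    if "h \<in> borel_measurable borel" "\<And>x. \<bar>h x\<bar> \<le> C" "integrable lborel g" for h g :: "real \<Rightarrow> real"
  proof (rule Bochner_Integration.integrable_bound[of _ "\<lambda>x. C * g x"])
    show "integrable lborel (\<lambda>x. C * g x)" using that by simp
    show "(\<lambda>x. h x * g x) \<in> borel_measurable lborel" using that by measurable
    show "AE x in lborel. norm (h x * g x) \<le> norm (C * g x)"
      using that(2) C0 by (auto simp: abs_mult intro!: mult_right_mono)
  qed
  show ?thesis using \<gamma>
  proof (induction rule: integrable_induct)
    case (base A c)
    have *: "(LBINT x. h x * (indicator A x *\<^sub>R c)) = c * (LBINT x:A. h x)" for h :: "real \<Rightarrow> real"
      unfolding set_lebesgue_integral_def by (subst integral_mult_right_zero[symmetric]) (simp add: ac_simps)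
    show ?case unfolding * by (intro tendsto_intros lim) (use base in auto)
  next
    case (add g h)
    have *: "(LBINT x. k x * (g x + h x)) = (LBINT x. k x * g x) + (LBINT x. k x * h x)"
      if "k \<in> borel_measurable borel" "\<And>x. \<bar>k x\<bar> \<le> C" for k :: "real \<Rightarrow> real"
      unfolding distrib_left by (rule Bochner_Integration.integral_add) (use that add int in auto)
    show ?case using f le by (subst (1 2) *) (auto intro!: tendsto_add add)
  next
    case (lim g s)
    \<comment> \<open>The simple functions of the induction satisfy
      \<open>\<bar>s i x\<bar> \<le> 2 * \<bar>g x\<bar>\<close>, hence the factor \<open>3\<close>
      in the majorant.\<close>
    have "(\<lambda>i. \<integral>x. \<bar>s i x - g x\<bar> \<partial>lborel) \<longlonglongrightarrow> integral\<^sup>L lborel (\<lambda>x::real. 0)"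
    proof (rule Bochner_Integration.integral_dominated_convergence[where w="\<lambda>x. 3 * \<bar>g x\<bar>"])
      show "AE x in lborel. (\<lambda>i. \<bar>s i x - g x\<bar>) \<longlonglongrightarrow> 0"
      proof (rule AE_I2)
        fix x
        have "(\<lambda>i. \<bar>s i x - g x\<bar>) \<longlonglongrightarrow> \<bar>g x - g x\<bar>"
          using lim.hyps(2)[of x] by (intro tendsto_intros) auto
        then show "(\<lambda>i. \<bar>s i x - g x\<bar>) \<longlonglongrightarrow> 0" by simp
      qed
      show "AE x in lborel. norm \<bar>s i x - g x\<bar> \<le> 3 * \<bar>g x\<bar>" for i
      proof (rule AE_I2)
        fix x show "norm \<bar>s i x - g x\<bar> \<le> 3 * \<bar>g x\<bar>"
          using lim.hyps(3)[of x i] by auto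
      qed
    qed (use lim.hyps in auto)
    then have L: "(\<lambda>i. C * (LBINT x. \<bar>s i x - g x\<bar>)) \<longlonglongrightarrow> 0"
      by (auto intro: tendsto_mult_right_zero)
    have close: "\<bar>(LBINT x. k x * g x) - (LBINT x. k x * s i x)\<bar> \<le> C * (LBINT x. \<bar>s i x - g x\<bar>)"
      if k: "k \<in> borel_measurable borel" "\<And>x. \<bar>k x\<bar> \<le> C" for k i
    proof -
      have "(LBINT x. k x * g x) - (LBINT x. k x * s i x) = (LBINT x. k x * (g x - s i x))"
        unfolding right_diff_distrib
        by (rule Bochner_Integration.integral_diff[symmetric]) (use k lim.hyps int in auto)
      also have "\<bar>\<dots>\<bar> \<le> (LBINT x. \<bar>k x * (g x - s i x)\<bar>)"
        by (rule integral_abs_bound)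
      also have "\<dots> \<le> (LBINT x. C * \<bar>s i x - g x\<bar>)"
      proof (rule integral_mono)
        show "integrable lborel (\<lambda>x. \<bar>k x * (g x - s i x)\<bar>)"
          using int[OF k, of "\<lambda>x. g x - s i x"] lim.hyps by auto
        show "integrable lborel (\<lambda>x. C * \<bar>s i x - g x\<bar>)" using lim.hyps by auto
        show "\<bar>k x * (g x - s i x)\<bar> \<le> C * \<bar>s i x - g x\<bar>" for x
          using k(2)[of x] by (auto simp: abs_mult abs_minus_commute intro!: mult_right_mono)
      qed
      also have "\<dots> = C * (LBINT x. \<bar>s i x - g x\<bar>)" by simp
      finally show ?thesis .
    qed
    show ?case
    proof (rule tendsto_real_approx)
      fix e :: real assume "0 < e"
      then obtain i where i: "C * (LBINT x. \<bar>s i x - g x\<bar>) \<le> e"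
        using eventually_happens[OF order_tendstoD(2)[OF L \<open>0 < e\<close>]] by (auto intro: less_imp_le)
      then show "\<exists>a L. a \<longlonglongrightarrow> L \<and> (\<forall>\<^sub>F j in sequentially. \<bar>(LBINT x. f j x * g x) - a j\<bar> \<le> e) \<and>
          \<bar>(LBINT x. f0 x * g x) - L\<bar> \<le> e"
        using lim.IH[of i] close[OF f(1) le(1), where i=i] close[OF f(2) le(2), where i=i]
        by (intro exI[of _ "\<lambda>j. \<integral>x. f j x * s i x \<partial>lborel"] exI[of _ "\<integral>x. f0 x * s i x \<partial>lborel"])
           (auto intro!: always_eventually intro: order_trans[OF _ i])
    qed
  qed
qed


text \<open>The image of \<open>\<psi> dx\<close> under the norm is absolutely continuous, so integrals of radial functions
  over the space reduce to one-dimensional integrals without polar coordinates.\<close>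

lemma integral_radial_density_nonneg:
  fixes \<psi> :: "'a::euclidean_space \<Rightarrow> real"
  assumes \<psi>: "integrable lborel \<psi>" "\<And>x. 0 \<le> \<psi> x"
  obtains \<gamma> where "integrable lborel \<gamma>"
    "\<And>h. h \<in> borel_measurable borel \<Longrightarrow> (LBINT x. h (norm x) * \<psi> x) = (LBINT r. h r * \<gamma> r)"
proof -
  have [measurable]: "\<psi> \<in> borel_measurable borel" using \<psi> by auto
  define N where "N = distr (density lborel (\<lambda>x. ennreal (\<psi> x))) borel (norm :: 'a \<Rightarrow> real)"
  have N: "emeasure N A = (\<integral>\<^sup>+x. ennreal (\<psi> x) * indicator (norm -` A) x \<partial>lborel)" if [measurable]: "A \<in> sets borel" for A
  proof -
    have [measurable]: "(norm :: 'a \<Rightarrow> real) -` A \<in> sets borel"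
      using measurable_sets_borel[OF borel_measurable_norm that] by simp
    show ?thesis
      unfolding N_def by (subst emeasure_distr) (auto simp: emeasure_density)
  qed
  have "absolutely_continuous lborel N"
    unfolding absolutely_continuous_def
  proof
    fix A :: "real set" assume A: "A \<in> null_sets lborel"
    then have "AE x in lborel. (x::'a) \<notin> norm -` A"
      by (rule AE_not_in[OF null_sets_norm_vimage])
    then have "AE x::'a in lborel. ennreal (\<psi> x) * indicator (norm -` A) x = 0"
      by eventually_elim auto
    then have "(\<integral>\<^sup>+x. ennreal (\<psi> x) * indicator (norm -` A) x \<partial>lborel) = integral\<^sup>N lborel (\<lambda>x::'a. 0)"
      by (rule nn_integral_cong_AE)
    with A have "emeasure N A = 0" by (subst N) auto
    then show "A \<in> null_sets N" using A by (auto simp: null_sets_def N_def)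
  qed
  then obtain f where f[measurable]: "f \<in> borel_measurable lborel" and fN: "density lborel f = N"
    using sigma_finite_measure.Radon_Nikodym[OF sigma_finite_lborel, of N] by (auto simp: N_def)
  have "(\<integral>\<^sup>+r. f r \<partial>lborel) = emeasure N UNIV"
    unfolding fN[symmetric] by (subst emeasure_density) auto
  also have "\<dots> = (\<integral>\<^sup>+x. ennreal (\<psi> x) \<partial>lborel)" by (subst N) auto
  also have "\<dots> < \<infinity>"
    using \<psi> by (simp add: nn_integral_eq_integral)
  finally have fin: "(\<integral>\<^sup>+r. f r \<partial>lborel) < \<infinity>" .
  then have "AE r in lborel. f r \<noteq> \<infinity>" by (intro nn_integral_PInf_AE) auto
  then have f_eq: "AE r in lborel. ennreal (enn2real (f r)) = f r"
    by eventually_elim (auto simp: less_top)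
  have dens: "density lborel (\<lambda>r. ennreal (enn2real (f r))) = N"
    unfolding fN[symmetric] by (rule density_cong) (use f_eq in auto)
  have "(\<integral>\<^sup>+r. ennreal (enn2real (f r)) \<partial>lborel) = (\<integral>\<^sup>+r. f r \<partial>lborel)"
    by (rule nn_integral_cong_AE[OF f_eq])
  then have int: "integrable lborel (\<lambda>r. enn2real (f r))"
    using fin by (intro integrableI_nonneg) auto
  show thesis
  proof
    show "integrable lborel (\<lambda>r. enn2real (f r))" by fact
    fix h :: "real \<Rightarrow> real" assume [measurable]: "h \<in> borel_measurable borel"
    have "(LBINT x. h (norm x) * \<psi> x) = (\<integral>x. h (norm x) \<partial>density lborel (\<lambda>x. ennreal (\<psi> x)))"
      by (subst integral_density) (use \<psi> in \<open>auto simp: mult.commute\<close>)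
    also have "\<dots> = integral\<^sup>L N h" unfolding N_def by (subst integral_distr) auto
    also have "\<dots> = (LBINT r. h r * enn2real (f r))"
      unfolding dens[symmetric] by (subst integral_density) (auto simp: mult.commute)
    finally show "(LBINT x. h (norm x) * \<psi> x) = (LBINT r. h r * enn2real (f r))" .
  qed
qed

lemma integrable_bounded_mult:
  fixes h \<psi> :: "'a \<Rightarrow> real"
  assumes "h \<in> borel_measurable M" "\<And>x. \<bar>h x\<bar> \<le> C" "integrable M \<psi>"
  shows "integrable M (\<lambda>x. h x * \<psi> x)"
proof (rule Bochner_Integration.integrable_bound[of _ "\<lambda>x. \<bar>C\<bar> * \<psi> x"])
  show "AE x in M. norm (h x * \<psi> x) \<le> norm (\<bar>C\<bar> * \<psi> x)"
    using order_trans[OF assms(2) abs_ge_self] by (auto simp: abs_mult intro!: AE_I2 mult_right_mono)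
qed (use assms in auto)

text \<open>Boundedness of \<open>h\<close> makes the integrals against the positive and the
  negative part of \<open>\<psi>\<close> finite separately, so that they may be subtracted.\<close>

lemma integral_radial_density:
  fixes \<psi> :: "'a::euclidean_space \<Rightarrow> real"
  assumes \<psi>: "integrable lborel \<psi>"
  obtains \<gamma> where "integrable lborel \<gamma>"
    "\<And>h C. h \<in> borel_measurable borel \<Longrightarrow> (\<And>r. \<bar>h r\<bar> \<le> C) \<Longrightarrow>
       (LBINT x. h (norm x) * \<psi> x) = (LBINT r. h r * \<gamma> r)"
proof -
  have p: "integrable lborel (\<lambda>x. max 0 (\<psi> x))" "integrable lborel (\<lambda>x. max 0 (- \<psi> x))"
    using \<psi> by auto
  obtain \<gamma>1 where \<gamma>1: "integrable lborel \<gamma>1"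
    "\<And>h. h \<in> borel_measurable borel \<Longrightarrow> (LBINT x. h (norm x) * max 0 (\<psi> x)) = (LBINT r. h r * \<gamma>1 r)"
    by (rule integral_radial_density_nonneg[OF p(1)]) auto
  obtain \<gamma>2 where \<gamma>2: "integrable lborel \<gamma>2"
    "\<And>h. h \<in> borel_measurable borel \<Longrightarrow> (LBINT x. h (norm x) * max 0 (- \<psi> x)) = (LBINT r. h r * \<gamma>2 r)"
    by (rule integral_radial_density_nonneg[OF p(2)]) auto
  show thesis
  proof
    show "integrable lborel (\<lambda>r. \<gamma>1 r - \<gamma>2 r)" using \<gamma>1 \<gamma>2 by auto
    fix h :: "real \<Rightarrow> real" and C assume h[measurable]: "h \<in> borel_measurable borel" and C: "\<And>r. \<bar>h r\<bar> \<le> C"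
    have "(LBINT x. h (norm x) * \<psi> x) = (LBINT x. h (norm x) * max 0 (\<psi> x) - h (norm x) * max 0 (- \<psi> x))"
      by (intro Bochner_Integration.integral_cong) (auto simp: max_def)
    also have "\<dots> = (LBINT x. h (norm x) * max 0 (\<psi> x)) - (LBINT x. h (norm x) * max 0 (- \<psi> x))"
      by (intro Bochner_Integration.integral_diff integrable_bounded_mult[where C=C] p C) measurable
    also have "\<dots> = (LBINT r. h r * \<gamma>1 r) - (LBINT r. h r * \<gamma>2 r)"
      using \<gamma>1 \<gamma>2 h by simp
    also have "\<dots> = (LBINT r. h r * \<gamma>1 r - h r * \<gamma>2 r)"
      by (intro Bochner_Integration.integral_diff[symmetric] integrable_bounded_mult[where C=C] C \<gamma>1 \<gamma>2) measurable
    finally show "(LBINT x. h (norm x) * \<psi> x) = (LBINT r. h r * (\<gamma>1 r - \<gamma>2 r))"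
      by (simp add: right_diff_distrib)
  qed
qed

text \<open>The bridge from dimension one to the space. Only the primitives are assumed to converge,
  which for derivatives of profiles is the convergence of the profiles. This gives convergence on
  rays, then on Borel sets, then against the density \<open>\<gamma>\<close> of the image of
  \<open>\<psi>\<close>.\<close>

lemma tendsto_integral_radial:
  fixes f :: "nat \<Rightarrow> real \<Rightarrow> real" and \<psi> :: "'a::euclidean_space \<Rightarrow> real"
  assumes f: "\<And>j. f j \<in> borel_measurable borel" "f0 \<in> borel_measurable borel"
    and le: "\<And>j r. 0 \<le> r \<Longrightarrow> r \<le> R \<Longrightarrow> \<bar>f j r\<bar> \<le> C" "\<And>r. 0 \<le> r \<Longrightarrow> r \<le> R \<Longrightarrow> \<bar>f0 r\<bar> \<le> C"
    and lim: "\<And>r. 0 \<le> r \<Longrightarrow> r \<le> R \<Longrightarrow> (\<lambda>j. LBINT t:{0..r}. f j t) \<longlonglongrightarrow> (LBINT t:{0..r}. f0 t)"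
    and \<psi>: "integrable lebesgue \<psi>" "\<And>x. R < norm x \<Longrightarrow> \<psi> x = 0" and R: "0 \<le> R"
  shows "(\<lambda>j. \<integral>x. f j (norm x) * \<psi> x \<partial>lebesgue) \<longlonglongrightarrow> (LINT x|lebesgue. f0 (norm x) * \<psi> x)"
proof -
  note f[measurable]
  have C0: "0 \<le> C" using le(2)[of 0] R by simp
  obtain \<psi>1 where \<psi>1[measurable]: "\<psi>1 \<in> borel_measurable lborel" and eq: "AE x in lborel. \<psi> x = \<psi>1 x"
    using completion_ex_borel_measurable_real[of \<psi> lborel] \<psi> by auto
  \<comment> \<open>The Borel representative of \<open>\<psi>\<close> is cut off at radius
    \<open>R\<close>, and \<open>k\<close> below cuts off the profiles, because the bound
    \<open>C\<close> holds on \<open>[0,R]\<close> only.\<close>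
  define \<psi>2 where "\<psi>2 x = indicator (cball 0 R) x * \<psi>1 x" for x :: 'a
  have [measurable]: "\<psi>2 \<in> borel_measurable borel" 
  proof -
    have "\<psi>1 \<in> borel_measurable borel" using \<psi>1 by simp
    then show ?thesis unfolding \<psi>2_def by (intro borel_measurable_times borel_measurable_indicator) auto
  qed
  have eq2: "AE x in lborel. \<psi> x = \<psi>2 x"
    using eq by eventually_elim (use \<psi>(2) in \<open>auto simp: \<psi>2_def indicator_def not_le\<close>)
  have "integrable lebesgue \<psi>2"
    by (rule Bochner_Integration.integrable_cong_AE_imp[OF \<psi>(1)]) (use AE_completion[OF eq2] in \<open>auto intro!: measurable_completion\<close>)
  then have \<psi>2: "integrable lborel \<psi>2" by (simp add: integrable_completion)
  define k where "k h r = indicator {0..R} r * h r" for h :: "real \<Rightarrow> real" and r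
  have km[measurable]: "k h \<in> borel_measurable borel" if [measurable]: "h \<in> borel_measurable borel" for h
    unfolding k_def by measurable
  have eq3: "(LINT x|lebesgue. h (norm x) * \<psi> x) = (LBINT x. k h (norm x) * \<psi>2 x)"
    if [measurable]: "h \<in> borel_measurable borel" for h
  proof -
    have "(LINT x|lebesgue. h (norm x) * \<psi> x) = (LINT x|lebesgue. k h (norm x) * \<psi>2 x)"
    proof (rule integral_cong_AE)
      show "(\<lambda>x. h (norm x) * \<psi> x) \<in> borel_measurable lebesgue"
        by (rule borel_measurable_times[OF measurable_completion borel_measurable_integrable[OF \<psi>(1)]]) simp
      show "AE x in lebesgue. h (norm x) * \<psi> x = k h (norm x) * \<psi>2 x"
        using AE_completion[OF eq2] by eventually_elim (auto simp: k_def \<psi>2_def indicator_def)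
      show "(\<lambda>x. k h (norm x) * \<psi>2 x) \<in> borel_measurable lebesgue"
        by (rule measurable_completion) measurable
    qed
    also have "\<dots> = (LBINT x. k h (norm x) * \<psi>2 x)" by (rule integral_completion) measurable
    finally show ?thesis .
  qed
  have kb: "\<bar>k (f j) r\<bar> \<le> C" "\<bar>k f0 r\<bar> \<le> C" for j r
    using le(1)[of r j] le(2)[of r] C0 by (auto simp: k_def indicator_def)
  obtain \<gamma> where \<gamma>: "integrable lborel \<gamma>"
    "\<And>h C. h \<in> borel_measurable borel \<Longrightarrow> (\<And>r. \<bar>h r\<bar> \<le> C) \<Longrightarrow>
       (LBINT x. h (norm x) * \<psi>2 x) = (LBINT r. h r * \<gamma> r)"
    using integral_radial_density[OF \<psi>2] by blast
  have bi: "integrable lborel (\<lambda>r. C * indicator {0..R} r)"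
    by (intro integrable_mult_right integrable_real_indicator) (auto simp: emeasure_lborel_Icc_eq)
  have kint: "integrable lborel (k h)" if [measurable]: "h \<in> borel_measurable borel" and "\<And>r. 0 \<le> r \<Longrightarrow> r \<le> R \<Longrightarrow> \<bar>h r\<bar> \<le> C" for h
    by (rule Bochner_Integration.integrable_bound[OF bi]) (use that C0 in \<open>auto simp: k_def indicator_def\<close>)
  have full: "(\<lambda>j. LBINT t:{..r}. k (f j) t) \<longlonglongrightarrow> (LBINT t:{..r}. k f0 t)" for r
  proof (cases "0 \<le> r")
    case True
    have "(LBINT t:{..r}. k h t) = (LBINT t:{0..min r R}. h t)" for h
      unfolding set_lebesgue_integral_def k_def
      by (intro Bochner_Integration.integral_cong) (auto simp: indicator_def)
    then show ?thesis using lim[of "min r R"] True R by simp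
  next
    case False
    have "(LBINT t:{..r}. k h t) = 0" for h
      unfolding set_lebesgue_integral_def k_def using False
      by (intro integral_eq_zero_AE) (auto simp: indicator_def)
    then show ?thesis by simp
  qed
  have tot: "(\<lambda>j. integral\<^sup>L lborel (k (f j))) \<longlonglongrightarrow> integral\<^sup>L lborel (k f0)"
  proof -
    have "(LBINT t:{..R}. k h t) = integral\<^sup>L lborel (k h)" for h
      unfolding set_lebesgue_integral_def k_def
      by (intro Bochner_Integration.integral_cong) (auto simp: indicator_def)
    then show ?thesis using full[of R] by simp
  qed
  have "(\<lambda>j. \<integral>r. k (f j) r * \<gamma> r \<partial>lborel) \<longlonglongrightarrow> (LBINT r. k f0 r * \<gamma> r)"
  proof (rule tendsto_integral_mult_weak[OF _ _ kb _ \<gamma>(1)])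
    fix A :: "real set" assume A: "A \<in> sets borel"
    show "(\<lambda>j. LBINT x:A. k (f j) x) \<longlonglongrightarrow> (LBINT x:A. k f0 x)"
    proof (rule tendsto_set_integral_borel[OF _ kint bi _ tot full A])
      show "\<bar>k (f j) x\<bar> \<le> C * indicator {0..R} x" for j x
        using kb(1)[of j x] le(1)[of x j] by (auto simp: k_def indicator_def)
    qed (use le in auto)
  qed measurable
  then show ?thesis
    unfolding eq3[OF f(1)] eq3[OF f(2)] using \<gamma>(2)[OF km[OF f(1)] kb(1)] \<gamma>(2)[OF km[OF f(2)] kb(2)] by simp
qed

section \<open>Test functions and integration by parts\<close>

lemma lborel_integral_translation:
  fixes f :: "'a::euclidean_space \<Rightarrow> real"
  assumes [measurable]: "f \<in> borel_measurable borel"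
  shows "(LBINT x. f (x + a)) = (LBINT x. f x)"
proof -
  have "(LBINT x. f x) = (\<integral>x. f x \<partial>distr lborel borel ((+) a))" by (simp add: lborel_distr_plus)
  also have "\<dots> = (LBINT x. f (a + x))" by (subst integral_distr) auto
  finally show ?thesis by (simp add: add.commute)
qed

lemma integrable_bounded_support:
  fixes f :: "'a::euclidean_space \<Rightarrow> 'b::euclidean_space"
  assumes "f \<in> borel_measurable borel" "\<And>x. norm (f x) \<le> C" "\<And>x. R < norm x \<Longrightarrow> f x = 0"
  shows "integrable lborel f"
proof (rule Bochner_Integration.integrable_bound[of _ "\<lambda>x. indicator (cball 0 R) x * C"])
  show "integrable lborel (\<lambda>x::'a. indicator (cball 0 R) x * C)"
    using emeasure_bounded_finite[of "cball (0::'a) R"] by simp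
  show "AE x in lborel. norm (f x) \<le> norm (indicator (cball 0 R) x * C)"
    using assms(2,3) by (auto simp: indicator_def not_le intro!: AE_I2 intro: order_trans[OF _ abs_ge_self])
qed (use assms in auto)

lemma has_derivative_grad:
  assumes "f differentiable (at x)"
  shows "(f has_derivative (\<lambda>h. grad f x \<bullet> h)) (at x)"
proof -
  have "(f has_derivative frechet_derivative f (at x)) (at x)"
    using assms frechet_derivative_works by blast
  moreover have "frechet_derivative f (at x) = (\<lambda>h. grad f x \<bullet> h)"
  proof
    fix h
    have "frechet_derivative f (at x) h = frechet_derivative f (at x) (\<Sum>b\<in>Basis. (h \<bullet> b) *\<^sub>R b)"
      by (simp add: euclidean_representation)
    also have "\<dots> = (\<Sum>b\<in>Basis. (h \<bullet> b) *\<^sub>R frechet_derivative f (at x) b)"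
      using linear_frechet_derivative[OF assms] by (simp add: linear_sum linear_scale)
    also have "\<dots> = grad f x \<bullet> h" unfolding grad_def inner_sum_left
      by (intro sum.cong) (auto simp: inner_commute mult.commute)
    finally show "frechet_derivative f (at x) h = grad f x \<bullet> h" .
  qed
  ultimately show ?thesis by (rule has_derivative_eq_rhs)
qed

lemma grad_eqI:
  assumes "(f has_derivative (\<lambda>h. g \<bullet> h)) (at x)"
  shows "grad f x = g"
proof -
  have "frechet_derivative f (at x) = (\<lambda>h. g \<bullet> h)" using assms frechet_derivative_at by metis
  then show ?thesis unfolding grad_def by (simp add: euclidean_representation)
qed

lemma test_functionE:
  assumes "test_function \<Omega> \<zeta>"
  obtains R M where "0 < R" "0 < M"
    "\<And>x. (\<zeta> has_derivative (\<lambda>h. grad \<zeta> x \<bullet> h)) (at x)"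
    "continuous_on UNIV \<zeta>" "\<And>b. b \<in> Basis \<Longrightarrow> continuous_on UNIV (\<lambda>x. grad \<zeta> x \<bullet> b)"
    "\<And>x. R < norm x \<Longrightarrow> \<zeta> x = 0" "\<And>x. R < norm x \<Longrightarrow> grad \<zeta> x = 0"
    "\<And>x. x \<notin> \<Omega> \<Longrightarrow> \<zeta> x = 0" "\<And>x. x \<notin> \<Omega> \<Longrightarrow> grad \<zeta> x = 0"
    "\<And>x. \<bar>\<zeta> x\<bar> \<le> M" "\<And>x b. b \<in> Basis \<Longrightarrow> \<bar>grad \<zeta> x \<bullet> b\<bar> \<le> M"
proof -
  define K where "K = closure {x. \<zeta> x \<noteq> 0}"
  have K: "compact K" "K \<subseteq> \<Omega>" using assms by (auto simp: test_function_def K_def)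
  have "C_k (Suc 0) \<zeta>" "C_k 0 \<zeta>" using assms unfolding test_function_def by blast+
  then have d: "\<zeta> differentiable (at x)" and c: "continuous_on UNIV \<zeta>"
      and cg: "b \<in> Basis \<Longrightarrow> continuous_on UNIV (\<lambda>x. grad \<zeta> x \<bullet> b)" for x b by auto
  have D: "(\<zeta> has_derivative (\<lambda>h. grad \<zeta> x \<bullet> h)) (at x)" for x
    by (rule has_derivative_grad[OF d])
  have z: "\<zeta> x = 0" if "x \<notin> K" for x
    using that closure_subset[of "{x. \<zeta> x \<noteq> 0}"] by (auto simp: K_def)
  have gz: "grad \<zeta> x = 0" if x: "x \<notin> K" for x
  proof (rule grad_eqI)
    have "((\<lambda>_. 0::real) has_derivative (\<lambda>h. 0 \<bullet> h)) (at x)" by simp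
    then show "(\<zeta> has_derivative (\<lambda>h. 0 \<bullet> h)) (at x)"
      by (rule has_derivative_transform_within_open[of _ _ _ _ "- K"])
         (use x z K in \<open>auto simp: compact_imp_closed open_Compl\<close>)
  qed
  obtain R where R: "0 < R" "\<And>x. x \<in> K \<Longrightarrow> norm x \<le> R"
    using compact_imp_bounded[OF K(1)] by (auto simp: bounded_pos)
  have bd: "\<exists>M. \<forall>x. \<bar>h x\<bar> \<le> M" if "continuous_on UNIV h" "\<And>x. x \<notin> K \<Longrightarrow> h x = 0" for h :: "'a \<Rightarrow> real"
  proof -
    have "compact (h ` K)" using K(1) that(1) by (intro compact_continuous_image) (auto intro: continuous_on_subset)
    then obtain M where "\<forall>y\<in>h ` K. norm y \<le> M" using compact_imp_bounded bounded_iff by metis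
    then have M: "\<bar>h x\<bar> \<le> M" if "x \<in> K" for x using that by auto
    show ?thesis
    proof (intro exI allI)
      fix x show "\<bar>h x\<bar> \<le> max M 0" using M[of x] that(2)[of x] by (cases "x \<in> K") auto
    qed
  qed
  obtain M0 where M0: "\<And>x. \<bar>\<zeta> x\<bar> \<le> M0" using bd[OF c z] by blast
  have "\<forall>b\<in>Basis. \<exists>M. \<forall>x. \<bar>grad \<zeta> x \<bullet> b\<bar> \<le> M"
    using bd[OF cg] gz by simp
  then obtain Mb where Mb: "\<And>b x. b \<in> Basis \<Longrightarrow> \<bar>grad \<zeta> x \<bullet> b\<bar> \<le> Mb b" by metis
  have Mb0: "0 \<le> Mb b" if "b \<in> Basis" for b using Mb[OF that, of 0] by linarith
  define M where "M = 1 + \<bar>M0\<bar> + (\<Sum>b\<in>Basis. Mb b)"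
  have "0 \<le> (\<Sum>b\<in>Basis. Mb b)" by (rule sum_nonneg) (use Mb0 in auto)
  moreover have "Mb b \<le> (\<Sum>b\<in>Basis. Mb b)" if "b \<in> Basis" for b
    by (rule member_le_sum[OF that]) (use Mb0 in auto)
  ultimately have "M0 \<le> M" "0 < M" "b \<in> Basis \<Longrightarrow> Mb b \<le> M" for b unfolding M_def by (auto simp: add_increasing)
  moreover have "x \<notin> K" if "R < norm x \<or> x \<notin> \<Omega>" for x using that R(2)[of x] K(2) by auto
  ultimately show thesis
    by (intro that[of R M] R(1) D c cg z gz) (use z gz in \<open>auto simp: not_le[symmetric] intro: order_trans[OF M0] order_trans[OF Mb]\<close>)
qed

text \<open>What a test function and the components of its gradient have in common, so that one
  integrability criterion serves both sides of an integration by parts.\<close>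

definition bounded_supp :: "('a::euclidean_space \<Rightarrow> real) \<Rightarrow> bool" where
  "bounded_supp k \<longleftrightarrow> continuous_on UNIV k \<and> (\<exists>R>0. \<exists>M. \<forall>x. \<bar>k x\<bar> \<le> M \<and> (R < norm x \<longrightarrow> k x = 0))"

lemma bounded_supp_test:
  assumes "test_function \<Omega> \<zeta>"
  shows "bounded_supp \<zeta>" "b \<in> Basis \<Longrightarrow> bounded_supp (\<lambda>x. grad \<zeta> x \<bullet> b)"
proof -
  obtain R M where RM: "0 < R" "0 < M"
    "\<And>x. (\<zeta> has_derivative (\<lambda>h. grad \<zeta> x \<bullet> h)) (at x)"
    "continuous_on UNIV \<zeta>" "\<And>b. b \<in> Basis \<Longrightarrow> continuous_on UNIV (\<lambda>x. grad \<zeta> x \<bullet> b)"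
    "\<And>x. R < norm x \<Longrightarrow> \<zeta> x = 0" "\<And>x. R < norm x \<Longrightarrow> grad \<zeta> x = 0"
    "\<And>x. x \<notin> \<Omega> \<Longrightarrow> \<zeta> x = 0" "\<And>x. x \<notin> \<Omega> \<Longrightarrow> grad \<zeta> x = 0"
    "\<And>x. \<bar>\<zeta> x\<bar> \<le> M" "\<And>x b. b \<in> Basis \<Longrightarrow> \<bar>grad \<zeta> x \<bullet> b\<bar> \<le> M"
    by (rule test_functionE[OF assms]) (rule that)
  have *: "bounded_supp k" if "continuous_on UNIV k" "\<And>x. \<bar>k x\<bar> \<le> M" "\<And>x. R < norm x \<Longrightarrow> k x = 0" for k
    unfolding bounded_supp_def using that RM(1) by blast
  show "bounded_supp \<zeta>" "b \<in> Basis \<Longrightarrow> bounded_supp (\<lambda>x. grad \<zeta> x \<bullet> b)"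
    by (rule *; use RM in simp)+
qed

lemma bounded_supp_borel: "bounded_supp k \<Longrightarrow> k \<in> borel_measurable borel"
  unfolding bounded_supp_def by (auto intro: borel_measurable_continuous_onI)

text \<open>Dominated convergence, which also yields the integrability of the limit; applied to a
  constant sequence it becomes an integrability criterion.\<close>

lemma bounded_supp_tendsto:
  fixes f :: "nat \<Rightarrow> 'a::euclidean_space \<Rightarrow> real"
  assumes k: "bounded_supp k" and f: "\<And>j. f j \<in> borel_measurable borel" "f0 \<in> borel_measurable borel"
    and bd: "\<And>R. 0 < R \<Longrightarrow> \<exists>C. \<forall>j x. norm x \<le> R \<longrightarrow> \<bar>f j x\<bar> \<le> C" and lim: "\<And>x. (\<lambda>j. f j x) \<longlonglongrightarrow> f0 x"
  shows "(\<lambda>j. LBINT x. f j x * k x) \<longlonglongrightarrow> (LBINT x. f0 x * k x)"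
    "integrable lborel (\<lambda>x. f0 x * k x)" "integrable lborel (\<lambda>x. f j x * k x)"
proof -
  obtain R M where R: "0 < R" and k': "\<And>x. \<bar>k x\<bar> \<le> M" "\<And>x. R < norm x \<Longrightarrow> k x = 0"
    using k unfolding bounded_supp_def by blast
  obtain C where C: "\<And>j x. norm x \<le> R \<Longrightarrow> \<bar>f j x\<bar> \<le> C" using bd[OF R] by blast
  have m: "(\<lambda>x. f0 x * k x) \<in> borel_measurable lborel" "(\<lambda>x. f j x * k x) \<in> borel_measurable lborel" for j
    using f bounded_supp_borel[OF k] by auto
  have i: "integrable lborel (\<lambda>x::'a. indicator (cball 0 R) x * (C * M))"
    using emeasure_bounded_finite[of "cball (0::'a) R"] by simp
  have l: "AE x in lborel. (\<lambda>j. f j x * k x) \<longlonglongrightarrow> f0 x * k x"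
    by (intro AE_I2 tendsto_intros lim)
  have b: "AE x in lborel. norm (f j x * k x) \<le> indicator (cball 0 R) x * (C * M)" for j
  proof (rule AE_I2)
    fix x
    show "norm (f j x * k x) \<le> indicator (cball 0 R) x * (C * M)"
    proof (cases "norm x \<le> R")
      case True
      then show ?thesis using C[OF True, of j] k'(1)[of x] by (auto simp: abs_mult intro!: mult_mono)
    qed (simp add: k'(2))
  qed
  show "(\<lambda>j. LBINT x. f j x * k x) \<longlonglongrightarrow> (LBINT x. f0 x * k x)"
    by (rule integral_dominated_convergence[OF m i l b])
  show "integrable lborel (\<lambda>x. f0 x * k x)" by (rule integrable_dominated_convergence[OF m i l b])
  show "integrable lborel (\<lambda>x. f j x * k x)" by (rule integrable_dominated_convergence2[OF m i l b])
qed

lemma bounded_supp_integrable: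
  fixes f :: "'a::euclidean_space \<Rightarrow> real"
  assumes "bounded_supp k" "f \<in> borel_measurable borel" "\<And>R. 0 < R \<Longrightarrow> \<exists>C. \<forall>x. norm x \<le> R \<longrightarrow> \<bar>f x\<bar> \<le> C"
  shows "integrable lborel (\<lambda>x. f x * k x)"
  by (rule bounded_supp_tendsto(2)[of k "\<lambda>_. f"]) (use assms in auto)

text \<open>Integrating the difference quotients of \<open>f \<zeta>\<close>, whose integrals vanish by translation
  invariance, replaces Fubini's theorem.\<close>

lemma integral_by_parts_lipschitz:
  fixes f D \<zeta> :: "'a::euclidean_space \<Rightarrow> real"
  assumes \<zeta>: "test_function UNIV \<zeta>" and b: "b \<in> Basis"
    and f: "\<And>R. \<exists>L. \<forall>x y. norm x \<le> R \<longrightarrow> norm y \<le> R \<longrightarrow> \<bar>f x - f y\<bar> \<le> L * norm (x - y)"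
    and [measurable]: "f \<in> borel_measurable borel" "D \<in> borel_measurable borel"
    and DB: "\<And>R. \<exists>C. \<forall>x. norm x \<le> R \<longrightarrow> \<bar>D x\<bar> \<le> C"
    and D: "AE x in lborel. ((\<lambda>t. f (x + t *\<^sub>R b)) has_real_derivative D x) (at 0)"
  shows "(LBINT x. f x * (grad \<zeta> x \<bullet> b)) = - (LBINT x. D x * \<zeta> x)"
proof -
  obtain R M where RM: "0 < R" "0 < M"
    "\<And>x. (\<zeta> has_derivative (\<lambda>h. grad \<zeta> x \<bullet> h)) (at x)"
    "continuous_on UNIV \<zeta>" "\<And>b. b \<in> Basis \<Longrightarrow> continuous_on UNIV (\<lambda>x. grad \<zeta> x \<bullet> b)"
    "\<And>x. R < norm x \<Longrightarrow> \<zeta> x = 0" "\<And>x. R < norm x \<Longrightarrow> grad \<zeta> x = 0"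
    "\<And>x. \<bar>\<zeta> x\<bar> \<le> M" and RMb: "\<And>x b. b \<in> Basis \<Longrightarrow> \<bar>grad \<zeta> x \<bullet> b\<bar> \<le> M"
    by (rule test_functionE[OF \<zeta>]) (rule that)
  note RM9 = RMb[OF b]
  have nb: "norm b = 1" using b by simp
  have [measurable]: "\<zeta> \<in> borel_measurable borel" "(\<lambda>x. grad \<zeta> x \<bullet> b) \<in> borel_measurable borel"
    using RM(4) RM(5)[OF b] by (auto intro: borel_measurable_continuous_onI)
  \<comment> \<open>\<open>\<zeta>\<close> lives in the ball of radius \<open>R\<close> and the
    shifts have length at most \<open>1\<close>: the quotients vanish off radius
    \<open>R + 1\<close> and evaluate \<open>f\<close> within radius \<open>R + 2\<close>.\<close>
  obtain L where L: "\<And>x y. norm x \<le> R + 2 \<Longrightarrow> norm y \<le> R + 2 \<Longrightarrow> \<bar>f x - f y\<bar> \<le> L * norm (x - y)"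
    using f[of "R + 2"] by blast
  have L0: "0 \<le> L" 
  proof -
    have "0 \<le> L * norm (b - 0)" using L[of b 0] nb RM(1) by (intro order_trans[OF abs_ge_zero]) auto
    then show ?thesis using nb by simp
  qed
  define Bf where "Bf = \<bar>f 0\<bar> + L * (R + 2)"
  have Bf: "\<bar>f x\<bar> \<le> Bf" if "norm x \<le> R + 2" for x
  proof -
    have "\<bar>f x - f 0\<bar> \<le> L * norm (x - 0)" using that RM(1) by (intro L) auto
    also have "\<dots> \<le> L * (R + 2)" using that L0 by (intro mult_left_mono) auto
    finally show ?thesis unfolding Bf_def by linarith
  qed
  have line: "((\<lambda>t. \<zeta> (x + t *\<^sub>R b)) has_real_derivative (grad \<zeta> (x + t *\<^sub>R b) \<bullet> b)) (at t)" for x t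
  proof -
    have "((\<lambda>t. \<zeta> (x + t *\<^sub>R b)) has_derivative (\<lambda>h. grad \<zeta> (x + t *\<^sub>R b) \<bullet> (0 + h *\<^sub>R b))) (at t)"
      by (rule has_derivative_compose[OF _ RM(3)])
         (auto intro!: derivative_eq_intros)
    then show ?thesis unfolding has_field_derivative_def
      by (rule has_derivative_eq_rhs) (auto simp: fun_eq_iff mult.commute)
  qed
  have \<zeta>lip: "\<bar>\<zeta> (x + t *\<^sub>R b) - \<zeta> x\<bar> \<le> M * t" if "0 < t" for x t
  proof -
    have "\<exists>s>0. s < t \<and> \<zeta> (x + t *\<^sub>R b) - \<zeta> (x + 0 *\<^sub>R b) = (t - 0) * (grad \<zeta> (x + s *\<^sub>R b) \<bullet> b)"
      by (rule MVT2[OF that line])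
    then obtain s where "\<zeta> (x + t *\<^sub>R b) - \<zeta> (x + 0 *\<^sub>R b) = (t - 0) * (grad \<zeta> (x + s *\<^sub>R b) \<bullet> b)"
      by blast
    then show ?thesis using RM9[of "x + s *\<^sub>R b"] that by (auto simp: abs_mult mult.commute)
  qed
  define k where "k x = f x * \<zeta> x" for x
  define \<epsilon> where "\<epsilon> i = inverse (real (Suc i))" for i
  have \<epsilon>: "0 < \<epsilon> i" "\<epsilon> i \<le> 1" for i by (auto simp: \<epsilon>_def divide_simps)
  have \<epsilon>lim: "\<epsilon> \<longlonglongrightarrow> 0" unfolding \<epsilon>_def by (rule LIMSEQ_inverse_real_of_nat)
  define q where "q i x = (k (x + \<epsilon> i *\<^sub>R b) - k x) / \<epsilon> i" for i x
  have [measurable]: "k \<in> borel_measurable borel" unfolding k_def by measurable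
  have [measurable]: "q i \<in> borel_measurable borel" for i unfolding q_def by measurable
  define W where "W = (Bf + L) * M"
  have qb: "\<bar>q i x\<bar> \<le> indicator (cball 0 (R + 1)) x * W" for i x
  proof (cases "norm x \<le> R + 1")
    case True
    have n: "norm (x + \<epsilon> i *\<^sub>R b) \<le> R + 2"
      using norm_triangle_ineq[of x "\<epsilon> i *\<^sub>R b"] True \<epsilon>[of i] nb by simp
    \<comment> \<open>Discrete product rule: one increment falls on \<open>\<zeta>\<close>, the
      other on \<open>f\<close>, and each is at most a constant times the step
      \<open>\<epsilon> i\<close>.\<close>
    have "\<bar>k (x + \<epsilon> i *\<^sub>R b) - k x\<bar> =
        \<bar>f (x + \<epsilon> i *\<^sub>R b) * (\<zeta> (x + \<epsilon> i *\<^sub>R b) - \<zeta> x) + (f (x + \<epsilon> i *\<^sub>R b) - f x) * \<zeta> x\<bar>"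
      unfolding k_def by (simp add: algebra_simps)
    also have "\<dots> \<le> Bf * (M * \<epsilon> i) + (L * \<epsilon> i) * M"
    proof (rule order_trans[OF abs_triangle_ineq], rule add_mono)
      show "\<bar>f (x + \<epsilon> i *\<^sub>R b) * (\<zeta> (x + \<epsilon> i *\<^sub>R b) - \<zeta> x)\<bar> \<le> Bf * (M * \<epsilon> i)"
        unfolding abs_mult using \<zeta>lip[OF \<epsilon>(1)] Bf[OF n] by (intro mult_mono) (auto intro: order_trans[OF abs_ge_zero])
      have "\<bar>f (x + \<epsilon> i *\<^sub>R b) - f x\<bar> \<le> L * norm (x + \<epsilon> i *\<^sub>R b - x)"
        using n True by (intro L) auto
      then have "\<bar>f (x + \<epsilon> i *\<^sub>R b) - f x\<bar> \<le> L * \<epsilon> i" using nb \<epsilon>[of i] by simp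
      then show "\<bar>(f (x + \<epsilon> i *\<^sub>R b) - f x) * \<zeta> x\<bar> \<le> (L * \<epsilon> i) * M"
        unfolding abs_mult using RM(8) L0 \<epsilon>[of i] by (intro mult_mono) auto
    qed
    also have "\<dots> = W * \<epsilon> i" by (simp add: W_def algebra_simps)
    finally show ?thesis using True \<epsilon>[of i] by (simp add: q_def abs_div pos_divide_le_eq)
  next
    case False
    have "norm x \<le> norm (x + \<epsilon> i *\<^sub>R b) + norm (\<epsilon> i *\<^sub>R b)"
      using norm_triangle_ineq4[of "x + \<epsilon> i *\<^sub>R b" "\<epsilon> i *\<^sub>R b"] by simp
    with False have "R < norm (x + \<epsilon> i *\<^sub>R b)" using nb \<epsilon>[of i] by simp
    then show ?thesis using False RM(6) by (simp add: q_def k_def)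
  qed
  have fb: "\<exists>C. \<forall>x. norm x \<le> R \<longrightarrow> \<bar>f x\<bar> \<le> C" if "0 < R" for R
  proof -
    obtain L where "\<And>x y. norm x \<le> R \<Longrightarrow> norm y \<le> R \<Longrightarrow> \<bar>f x - f y\<bar> \<le> L * norm (x - y)"
      using f[of R] by blast
    then have L: "\<bar>f x - f 0\<bar> \<le> L * norm (x - 0)" if "norm x \<le> R" for x
      using that \<open>0 < R\<close> by (metis less_imp_le norm_zero)
    have "\<bar>f x\<bar> \<le> \<bar>f 0\<bar> + \<bar>L\<bar> * R" if "norm x \<le> R" for x
    proof -
      have "L * norm x \<le> \<bar>L\<bar> * R" using that by (intro mult_mono) auto
      then show ?thesis using L[OF that] by simp
    qed
    then show ?thesis by blast
  qed
  have kint: "integrable lborel k"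
    unfolding k_def[abs_def] by (rule bounded_supp_integrable[OF bounded_supp_test(1)[OF \<zeta>] _ fb]) measurable
  have int0: "(LBINT x. q i x) = 0" for i
  proof -
    have s: "(LBINT x. k (x + \<epsilon> i *\<^sub>R b)) = (LBINT x. k x)"
      by (rule lborel_integral_translation) measurable
    have ki: "integrable lborel (\<lambda>x. k (x + \<epsilon> i *\<^sub>R b))"
    proof -
      have "integrable (distr lborel borel ((+) (\<epsilon> i *\<^sub>R b))) k" using kint by (simp add: lborel_distr_plus)
      then show ?thesis by (subst (asm) integrable_distr_eq) (auto simp: add.commute)
    qed
    have "(LBINT x. q i x) = (LBINT x. k (x + \<epsilon> i *\<^sub>R b) - k x) / \<epsilon> i"
      unfolding q_def by simp
    also have "\<dots> = 0" using ki kint s by simp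
    finally show ?thesis .
  qed
  have "(\<lambda>i. \<integral>x. q i x \<partial>lborel) \<longlonglongrightarrow> (LBINT x. D x * \<zeta> x + f x * (grad \<zeta> x \<bullet> b))"
  proof (rule integral_dominated_convergence[where w="\<lambda>x. indicator (cball 0 (R + 1)) x * W"])
    show "integrable lborel (\<lambda>x::'a. indicator (cball 0 (R + 1)) x * W)"
      using emeasure_bounded_finite[of "cball (0::'a) (R+1)"] by simp
    show "AE x in lborel. (\<lambda>i. q i x) \<longlonglongrightarrow> D x * \<zeta> x + f x * (grad \<zeta> x \<bullet> b)"
      using D
    proof eventually_elim
      case (elim x)
      have "((\<lambda>t. f (x + t *\<^sub>R b) * \<zeta> (x + t *\<^sub>R b)) has_real_derivative D x * \<zeta> x + f x * (grad \<zeta> x \<bullet> b)) (at 0)"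
        using DERIV_mult[OF elim line[of x 0]] by (simp add: algebra_simps)
      then have "((\<lambda>h. (k (x + h *\<^sub>R b) - k x) / h) \<longlongrightarrow> D x * \<zeta> x + f x * (grad \<zeta> x \<bullet> b)) (at 0)"
        by (simp add: DERIV_def k_def)
      moreover have "filterlim \<epsilon> (at 0) sequentially"
        using \<epsilon>lim less_imp_neq[OF \<epsilon>(1), symmetric] by (simp add: filterlim_at)
      ultimately show ?case unfolding q_def by (rule filterlim_compose)
    qed
    show "AE x in lborel. norm (q i x) \<le> indicator (cball 0 (R + 1)) x * W" for i
      using qb by simp
  qed measurable
  then have "(\<lambda>i. 0) \<longlonglongrightarrow> (LBINT x. D x * \<zeta> x + f x * (grad \<zeta> x \<bullet> b))" unfolding int0 .
  then have "(LBINT x. D x * \<zeta> x + f x * (grad \<zeta> x \<bullet> b)) = 0" by (simp add: LIMSEQ_const_iff)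
  moreover have "integrable lborel (\<lambda>x. D x * \<zeta> x)"
    using DB by (intro bounded_supp_integrable bounded_supp_test(1)[OF \<zeta>]) auto
  moreover have "integrable lborel (\<lambda>x. f x * (grad \<zeta> x \<bullet> b))"
    by (rule bounded_supp_integrable[OF bounded_supp_test(2)[OF \<zeta> b] _ fb]) measurable
  ultimately show ?thesis by simp
qed

section \<open>Lipschitz functions, local spaces and total variation\<close>

text \<open>With \<open>T r = (L + 1) r + f r\<close>, the measure of an interval \<open>[a,b]\<close> under the image of Lebesgue
  measure by the inverse of \<open>T\<close> is \<open>T b - T a\<close>; it is absolutely continuous because \<open>T\<close> maps null sets
  to null sets. This avoids the almost everywhere differentiability of Lipschitz functions.\<close>

lemma lipschitz_indefinite_integral:
  fixes f :: "real \<Rightarrow> real"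
  assumes f: "\<And>x y. \<bar>f x - f y\<bar> \<le> L * \<bar>x - y\<bar>"
  obtains h where "h \<in> borel_measurable borel" "\<And>a b. a \<le> b \<Longrightarrow> set_integrable lborel {a..b} h"
    "\<And>a b. a \<le> b \<Longrightarrow> f b - f a = (LBINT t:{a..b}. h t)"
proof -
  have L0: "0 \<le> L" using f[of 1 0] by simp
  \<comment> \<open>The slope \<open>L + 1\<close> exceeds any descent of \<open>f\<close>, so
    \<open>T\<close> expands distances. It is thus a bijection with monotone, hence Borel, inverse;
    the linear part is subtracted again from the density at the end.\<close>
  define T where "T x = (L + 1) * x + f x" for x
  have T_ge: "b - a \<le> T b - T a" if "a \<le> b" for a b
  proof -
    have "\<bar>a - b\<bar> = b - a" using that by simp
    then show ?thesis using f[of a b] abs_ge_self[of "f a - f b"] by (simp add: T_def algebra_simps)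
  qed
  have T_lip: "\<bar>T x - T y\<bar> \<le> (2 * L + 1) * \<bar>x - y\<bar>" for x y
  proof -
    have "\<bar>T x - T y\<bar> = \<bar>(L + 1) * (x - y) + (f x - f y)\<bar>" by (simp add: T_def algebra_simps)
    also have "\<dots> \<le> \<bar>(L + 1) * (x - y)\<bar> + \<bar>f x - f y\<bar>" by (rule abs_triangle_ineq)
    also have "\<dots> \<le> (L + 1) * \<bar>x - y\<bar> + L * \<bar>x - y\<bar>" using f[of x y] L0 by (simp add: abs_mult)
    finally show ?thesis by (simp add: algebra_simps)
  qed
  have T_mono: "strict_mono T"
  proof (rule strict_monoI)
    fix x y :: real assume "x < y"
    then show "T x < T y" using T_ge[of x y] by linarith
  qed
  have T_cont: "continuous_on UNIV T"
  proof -
    have "(2 * L + 1)-lipschitz_on UNIV T"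
      using T_lip L0 by (auto intro!: lipschitz_onI simp: dist_real_def)
    then show ?thesis by (rule lipschitz_on_continuous_on)
  qed
  have "surj T"
  proof (rule surjI)
    fix y
    have a: "T (- \<bar>y - T 0\<bar>) \<le> y" using T_ge[of "- \<bar>y - T 0\<bar>" 0] by linarith
    have b: "y \<le> T \<bar>y - T 0\<bar>" using T_ge[of 0 "\<bar>y - T 0\<bar>"] by linarith
    have "\<exists>x\<ge>- \<bar>y - T 0\<bar>. x \<le> \<bar>y - T 0\<bar> \<and> T x = y"
      using a b T_cont by (intro IVT') (auto intro: continuous_on_subset)
    then show "T (inv T y) = y" by (auto intro: f_inv_into_f)
  qed
  then have bij: "bij T" using T_mono by (simp add: bij_def strict_mono_imp_inj_on)
  define S where "S = inv T"
  have TS: "T (S y) = y" and ST: "S (T x) = x" for x y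
    using bij by (auto simp: S_def bij_is_surj surj_f_inv_f bij_is_inj)
  have "mono S"
  proof (rule monoI)
    fix x y :: real assume "x \<le> y"
    then show "S x \<le> S y"
      using strict_mono_less_eq[OF T_mono, of "S x" "S y"] by (simp add: TS)
  qed
  then have S[measurable]: "S \<in> borel_measurable borel" by (rule borel_measurable_mono)
  define N where "N = distr lborel borel S"
  have vim: "S -` A = T ` A" for A using TS ST by (auto simp: image_iff) metis+
  have N: "emeasure N A = emeasure lborel (T ` A)" if "A \<in> sets borel" for A
    unfolding N_def using that by (subst emeasure_distr) (auto simp: vim)
  have N_Icc: "emeasure N {a..b} = ennreal (T b - T a)" if "a \<le> b" for a b
  proof -
    have "T ` {a..b} = {T a..T b}"
    proof safe
      fix y assume "y \<in> {T a..T b}"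
      then have "S y \<in> {a..b}" using monoD[OF \<open>mono S\<close>, of "T a" y] monoD[OF \<open>mono S\<close>, of y "T b"] by (simp add: ST)
      then show "y \<in> T ` {a..b}" using TS[of y] by (metis imageI)
    qed (use strict_mono_less_eq[OF T_mono] in auto)
    then show ?thesis using that strict_mono_less_eq[OF T_mono] by (simp add: N)
  qed
  have "absolutely_continuous lborel N"
    unfolding absolutely_continuous_def
  proof
    fix A :: "real set" assume A: "A \<in> null_sets lborel"
    then have "negligible A" by (auto simp: negligible_iff_null_sets intro: null_sets_completionI)
    then have "negligible (T ` A)"
    proof (rule negligible_locally_Lipschitz_image[rotated])
      show "\<exists>U B. open U \<and> x \<in> U \<and> (\<forall>y\<in>A \<inter> U. norm (T y - T x) \<le> B * norm (y - x))" for x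
        using T_lip by (intro exI[of _ UNIV] exI[of _ "2 * L + 1"]) auto
    qed simp
    moreover have "T ` A \<in> sets lborel" using measurable_sets_borel[OF S, of A] null_setsD2[OF A] by (simp add: vim[symmetric])
    ultimately show "A \<in> null_sets N" using A
      by (auto simp: negligible_iff_null_sets null_sets_completion_iff N null_sets_def N_def[symmetric])
         (auto simp: N_def)
  qed
  then obtain k where k[measurable]: "k \<in> borel_measurable lborel" and kN: "density lborel k = N"
    using sigma_finite_measure.Radon_Nikodym[OF sigma_finite_lborel, of N] by (auto simp: N_def)
  have k_int: "(\<integral>\<^sup>+x. k x * indicator {a..b} x \<partial>lborel) = ennreal (T b - T a)" if "a \<le> b" for a b
    unfolding N_Icc[OF that, symmetric] kN[symmetric] by (subst emeasure_density) auto
  \<comment> \<open>A Radon-Nikodym density may take the value infinity. Its integral over each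
    bounded interval is finite, so countably many intervals confine this to a null set.\<close>
  have "AE x in lborel. \<forall>i::nat. k x * indicator {- real i..real i} x \<noteq> \<infinity>"
    unfolding AE_all_countable
  proof
    fix i :: nat
    show "AE x in lborel. k x * indicator {- real i..real i} x \<noteq> \<infinity>"
      using k_int[of "- real i" "real i"] by (intro nn_integral_PInf_AE) auto
  qed
  then have k_fin: "AE x in lborel. ennreal (enn2real (k x)) = k x"
  proof eventually_elim
    case (elim x)
    obtain i :: nat where "\<bar>x\<bar> \<le> real i" using real_arch_simple by blast
    then have "x \<in> {- real i..real i}" by auto
    with elim[rule_format, of i] show ?case by (auto simp: less_top)
  qed
  define h where "h x = enn2real (k x)" for x
  have h[measurable]: "h \<in> borel_measurable borel" unfolding h_def using k by measurable
  have hb: "has_bochner_integral lborel (\<lambda>x. indicator {a..b} x *\<^sub>R h x) (T b - T a)" if "a \<le> b" for a b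
  proof (rule has_bochner_integral_nn_integral)
    have "(\<integral>\<^sup>+x. ennreal (indicator {a..b} x *\<^sub>R h x) \<partial>lborel) = (\<integral>\<^sup>+x. k x * indicator {a..b} x \<partial>lborel)"
      by (rule nn_integral_cong_AE) (use k_fin in eventually_elim, auto simp: h_def indicator_def)
    then show "(\<integral>\<^sup>+x. ennreal (indicator {a..b} x *\<^sub>R h x) \<partial>lborel) = ennreal (T b - T a)"
      using k_int[OF that] by simp
  qed (use that T_ge[OF that] in \<open>auto simp: h_def\<close>)
  show thesis
  proof
    show "(\<lambda>x. h x - (L + 1)) \<in> borel_measurable borel" by measurable
    fix a b :: real assume ab: "a \<le> b"
    have hi: "set_integrable lborel {a..b} h" and he: "(LBINT t:{a..b}. h t) = T b - T a"
      using hb[OF ab] unfolding set_integrable_def set_lebesgue_integral_def has_bochner_integral_iff by blast+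
    have ci: "set_integrable lborel {a..b} (\<lambda>_. L + 1)"
      using ab by (auto simp: set_integrable_def)
    show "set_integrable lborel {a..b} (\<lambda>x. h x - (L + 1))" by (intro set_integral_diff hi ci)
    have "(LBINT t:{a..b}. L + 1) = (L + 1) * (b - a)"
      using ab by (simp add: set_lebesgue_integral_def)
    then have "(LBINT t:{a..b}. h t - (L + 1)) = (T b - T a) - (L + 1) * (b - a)"
      using set_integral_diff(2)[OF hi ci] he by simp
    then show "f b - f a = (LBINT t:{a..b}. h t - (L + 1))" by (simp add: T_def algebra_simps)
  qed
qed

section \<open>Membership in the local spaces, and the total variation of a density\<close>

lemma set_integrable_bounded:
  fixes f :: "'a::euclidean_space \<Rightarrow> 'b::euclidean_space"
  assumes E: "E \<in> sets borel" "bounded E" and f: "f \<in> borel_measurable borel" "\<And>x. norm (f x) \<le> C"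
  shows "set_integrable lborel E f"
proof -
  obtain R where R: "\<And>x. x \<in> E \<Longrightarrow> norm x \<le> R" using E(2) bounded_iff by metis
  have "0 \<le> C" using f(2)[of 0] norm_ge_zero order_trans by blast
  show ?thesis unfolding set_integrable_def
  proof (rule integrable_bounded_support[where C=C and R=R])
    show "(\<lambda>x. indicator E x *\<^sub>R f x) \<in> borel_measurable borel"
      using E f by (intro borel_measurable_scaleR borel_measurable_indicator) auto
    show "norm (indicator E x *\<^sub>R f x) \<le> C" for x
      using f(2)[of x] \<open>0 \<le> C\<close> by (cases "x \<in> E") auto
    show "indicator E x *\<^sub>R f x = 0" if "R < norm x" for x
      using R[of x] that by (cases "x \<in> E") auto
  qed
qed

lemma L1_loc_bounded:
  fixes f :: "'a::euclidean_space \<Rightarrow> 'b::euclidean_space"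
  assumes f: "f \<in> borel_measurable borel" "\<And>R. \<exists>C. \<forall>x. norm x \<le> R \<longrightarrow> norm (f x) \<le> C"
  shows "L1_loc \<Omega> f"
  unfolding L1_loc_def
proof (intro allI impI)
  fix K :: "'a set" assume K: "compact K \<and> K \<subseteq> \<Omega>"
  then obtain R where R: "\<And>x. x \<in> K \<Longrightarrow> norm x \<le> R" using compact_imp_bounded bounded_iff by metis
  obtain C where C: "\<And>x. norm x \<le> R \<Longrightarrow> norm (f x) \<le> C" using f(2) by blast
  have Kb: "K \<in> sets borel" using K by (simp add: compact_imp_closed borel_closed)
  have m: "(\<lambda>x. indicator K x *\<^sub>R f x) \<in> borel_measurable borel"
    using f(1) Kb by (intro borel_measurable_scaleR borel_measurable_indicator) auto
  have "integrable lborel (\<lambda>x. indicator K x *\<^sub>R f x)"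
  proof (rule integrable_bounded_support[OF m, where C="max C 0" and R=R])
    show "norm (indicator K x *\<^sub>R f x) \<le> max C 0" for x
      using R[of x] C[of x] by (cases "x \<in> K") auto
    show "indicator K x *\<^sub>R f x = 0" if "R < norm x" for x
      using R[of x] that by (cases "x \<in> K") auto
  qed
  then show "set_integrable lebesgue K f" unfolding set_integrable_def
    using m by (simp add: integrable_completion)
qed

lemma Linf_bounded:
  fixes f :: "'a::euclidean_space \<Rightarrow> 'b::euclidean_space"
  assumes f: "f \<in> borel_measurable borel" "\<And>x. x \<in> S \<Longrightarrow> norm (f x) \<le> C"
  shows "Linf S f" "Linf_norm S f \<le> ereal C"
proof -
  have m: "f \<in> borel_measurable (lebesgue_on S)"
    using f(1) by (intro measurable_restrict_space1 measurable_completion) simp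
  show *: "Linf_norm S f \<le> ereal C"
    unfolding Linf_norm_def
  proof (rule esssup_I)
    show "(\<lambda>x. ereal (norm (f x))) \<in> borel_measurable (lebesgue_on S)" using m by measurable
    show "AE x in lebesgue_on S. ereal (norm (f x)) \<le> ereal C"
      by (rule AE_I2) (use f(2) in auto)
  qed
  then show "Linf S f" using m unfolding Linf_def by (auto intro: order.strict_trans1)
qed

lemma Linf_loc_bounded:
  fixes f :: "'a::euclidean_space \<Rightarrow> 'b::euclidean_space"
  assumes f: "f \<in> borel_measurable borel" "\<And>R. \<exists>C. \<forall>x. norm x \<le> R \<longrightarrow> norm (f x) \<le> C"
  shows "Linf_loc \<Omega> f"
  unfolding Linf_loc_def
proof (intro allI impI)
  fix U assume "compactly_inside U \<Omega>"
  then have "bounded U" unfolding compactly_inside_def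
    by (meson bounded_subset closure_subset compact_imp_bounded)
  then obtain R where R: "\<And>x. x \<in> U \<Longrightarrow> norm x \<le> R" using bounded_iff by metis
  obtain C where C: "\<And>x. norm x \<le> R \<Longrightarrow> norm (f x) \<le> C" using f(2) by blast
  show "Linf U f" by (rule Linf_bounded(1)[OF f(1)]) (use R C in blast)
qed

text \<open>A test function supported in \<open>\<Omega>\<close> is also one on the whole space, and
  it vanishes with its gradient off \<open>\<Omega>\<close>. Values off \<open>\<Omega>\<close> are
  therefore free, which makes the extension of half-line functions to negative arguments
  harmless.\<close>

lemma has_weak_grad_subset:
  fixes u u' :: "'a::euclidean_space \<Rightarrow> real"
  assumes w: "has_weak_grad UNIV u g" and eq: "\<And>x. x \<in> \<Omega> \<Longrightarrow> u x = u' x" "\<And>x. x \<in> \<Omega> \<Longrightarrow> g x = g' x"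
  shows "has_weak_grad \<Omega> u' g'"
  unfolding has_weak_grad_def
proof (intro conjI allI impI ballI)
  show "L1_loc \<Omega> u'" "L1_loc \<Omega> g'"
    unfolding L1_loc_def
  proof (safe)
    fix K assume K: "compact K" "K \<subseteq> \<Omega>"
    have "set_integrable lebesgue K u" "set_integrable lebesgue K g"
      using w K unfolding has_weak_grad_def L1_loc_def by auto
    moreover have "(\<lambda>x. indicator K x *\<^sub>R u x) = (\<lambda>x. indicator K x *\<^sub>R u' x)"
       "(\<lambda>x. indicator K x *\<^sub>R g x) = (\<lambda>x. indicator K x *\<^sub>R g' x)"
      using K eq by (auto simp: fun_eq_iff indicator_def)
    ultimately show "set_integrable lebesgue K u'" "set_integrable lebesgue K g'"
      unfolding set_integrable_def by simp_all
  qed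
  fix \<zeta> and b :: 'a assume \<zeta>: "test_function \<Omega> \<zeta>" and b: "b \<in> Basis"
  have out: "\<zeta> x = 0" "grad \<zeta> x = 0" if "x \<notin> \<Omega>" for x
    by (rule test_functionE[OF \<zeta>]; use that in blast)+
  have "test_function UNIV \<zeta>" using \<zeta> by (simp add: test_function_def)
  then have *: "(LINT x:UNIV|lebesgue. u x * (grad \<zeta> x \<bullet> b)) = - (LINT x:UNIV|lebesgue. (g x \<bullet> b) * \<zeta> x)"
    using w b unfolding has_weak_grad_def by blast
  have "(LINT x:UNIV|lebesgue. u x * (grad \<zeta> x \<bullet> b)) = (LINT x:\<Omega>|lebesgue. u' x * (grad \<zeta> x \<bullet> b))"
    unfolding set_lebesgue_integral_def
    by (rule Bochner_Integration.integral_cong) (use eq out in \<open>auto simp: indicator_def\<close>)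
  moreover have "(LINT x:UNIV|lebesgue. (g x \<bullet> b) * \<zeta> x) = (LINT x:\<Omega>|lebesgue. (g' x \<bullet> b) * \<zeta> x)"
    unfolding set_lebesgue_integral_def
    by (rule Bochner_Integration.integral_cong) (use eq out in \<open>auto simp: indicator_def\<close>)
  ultimately show "(LINT x:\<Omega>|lebesgue. u' x * (grad \<zeta> x \<bullet> b)) = - (LINT x:\<Omega>|lebesgue. (g' x \<bullet> b) * \<zeta> x)"
    using * by simp
qed

text \<open>\<open>ennreal\<close> maps negative reals to \<open>0\<close>, so each pair consists of
  the positive and the negative part of \<open>g \<bullet> b\<close>. One inequality is the triangle
  inequality on every piece; the other needs pieces on which \<open>g\<close> is nearly constant, so
  that the norm almost commutes with the integral.\<close>

lemma is_total_variation_density: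
  fixes g :: "'a::euclidean_space \<Rightarrow> 'a"
  assumes [measurable]: "g \<in> borel_measurable borel" and gB: "\<And>x. norm (g x) \<le> B"
  shows "is_total_variation (\<lambda>b. (density lborel (\<lambda>x. ennreal (g x \<bullet> b)), density lborel (\<lambda>x. ennreal (- (g x \<bullet> b)))))
           (density lborel (\<lambda>x. ennreal (norm (g x))))" (is "is_total_variation ?D ?\<mu>")
proof -
  have B0: "0 \<le> B" using gB[of 0] norm_ge_zero order_trans by blast
  note si = set_integrable_bounded
  have em: "emeasure ?\<mu> E = ennreal (LBINT x:E. norm (g x))" if E: "E \<in> sets borel" "bounded E" for E
  proof -
    have i: "set_integrable lborel E (\<lambda>x. norm (g x))" using E gB by (intro si[where C=B]) auto
    have "emeasure ?\<mu> E = (\<integral>\<^sup>+x. ennreal (norm (g x)) * indicator E x \<partial>lborel)"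
      by (rule emeasure_density) (use E in auto)
    also have "\<dots> = (\<integral>\<^sup>+x. ennreal (indicator E x *\<^sub>R norm (g x)) \<partial>lborel)"
      by (rule nn_integral_cong) (simp split: split_indicator)
    also have "\<dots> = ennreal (LBINT x:E. norm (g x))"
      using i unfolding set_integrable_def set_lebesgue_integral_def by (intro nn_integral_eq_integral) auto
    finally show ?thesis .
  qed
  have val: "vector_value ?D E = (LBINT x:E. g x)" if E: "E \<in> sets borel" "bounded E" for E
  proof -
    have gi: "set_integrable lborel E g" using E gB by (intro si[where C=B]) auto
    have sv: "signed_value (?D b) E = (LBINT x:E. g x) \<bullet> b" if b: "b \<in> Basis" for b
    proof -
      have bd: "\<bar>g x \<bullet> b\<bar> \<le> B" for x using Basis_le_norm[OF b, of "g x"] gB[of x] by linarith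
      have m: "measure (density lborel (\<lambda>x. ennreal (k x))) E = (LBINT x:E. max 0 (k x))"
        if [measurable]: "k \<in> borel_measurable borel" and kB: "\<And>x. \<bar>k x\<bar> \<le> B" for k :: "'a \<Rightarrow> real"
      proof -
        have i: "set_integrable lborel E (\<lambda>x. max 0 (k x))"
          using E kB B0 by (intro si[where C=B]) (auto simp: max_def intro: order_trans[OF abs_ge_self])
        have "emeasure (density lborel (\<lambda>x. ennreal (k x))) E = (\<integral>\<^sup>+x. ennreal (indicator E x *\<^sub>R max 0 (k x)) \<partial>lborel)"
        proof -
          have "emeasure (density lborel (\<lambda>x. ennreal (k x))) E = (\<integral>\<^sup>+x. ennreal (k x) * indicator E x \<partial>lborel)"
            by (rule emeasure_density) (use E in auto)
          also have "\<dots> = (\<integral>\<^sup>+x. ennreal (indicator E x *\<^sub>R max 0 (k x)) \<partial>lborel)"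
            by (rule nn_integral_cong) (simp add: max_def ennreal_neg split: split_indicator)
          finally show ?thesis .
        qed
        also have "\<dots> = ennreal (LBINT x:E. max 0 (k x))"
          using i unfolding set_integrable_def set_lebesgue_integral_def by (intro nn_integral_eq_integral) auto
        finally show ?thesis unfolding measure_def
          by (simp add: set_lebesgue_integral_def integral_nonneg_AE)
      qed
      have "signed_value (?D b) E = (LBINT x:E. max 0 (g x \<bullet> b)) - (LBINT x:E. max 0 (- (g x \<bullet> b)))"
        unfolding signed_value_def using bd by (simp add: m)
      also have "\<dots> = (LBINT x:E. max 0 (g x \<bullet> b) - max 0 (- (g x \<bullet> b)))"
        using E bd B0 by (intro set_integral_diff(2)[symmetric] si[where C=B])
           (auto simp: max_def intro: order_trans[OF abs_ge_self] order_trans[OF abs_ge_minus_self])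
      also have "\<dots> = (LBINT x:E. g x \<bullet> b)"
        unfolding set_lebesgue_integral_def by (intro Bochner_Integration.integral_cong) (auto simp: max_def)
      also have "\<dots> = (LBINT x:E. g x) \<bullet> b"
        using gi unfolding set_lebesgue_integral_def set_integrable_def by (subst integral_inner_left[symmetric]) auto
      finally show ?thesis .
    qed
    then show ?thesis unfolding vector_value_def by (simp add: euclidean_representation)
  qed
  have nv: "norm (LBINT x:E. g x) \<le> (LBINT x:E. norm (g x))" if E: "E \<in> sets borel" "bounded E" for E
    by (rule set_integral_norm_bound) (use E gB in \<open>auto intro!: si[where C=B]\<close>)
  show ?thesis unfolding is_total_variation_def
  proof (intro conjI ballI)
    show "sets ?\<mu> = sets borel" by simp
    fix A :: "'a set" assume A[measurable]: "A \<in> sets borel"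
    let ?P = "{E :: nat \<Rightarrow> 'a set. disjoint_family E \<and> (\<Union>i. E i) = A \<and> (\<forall>i. E i \<in> sets borel \<and> bounded (E i))}"
    let ?S = "SUP E\<in>?P. \<Sum>i. ennreal (norm (vector_value ?D (E i)))"
    have le1: "?S \<le> emeasure ?\<mu> A"
    proof (rule SUP_least)
      fix E assume E: "E \<in> ?P"
      have "(\<Sum>i. ennreal (norm (vector_value ?D (E i)))) \<le> (\<Sum>i. emeasure ?\<mu> (E i))"
      proof (rule suminf_le)
        fix i
        show "ennreal (norm (vector_value ?D (E i))) \<le> emeasure ?\<mu> (E i)"
          using E nv[of "E i"] by (simp add: val em ennreal_leI)
      qed auto
      also have "\<dots> = emeasure ?\<mu> A"
        using E by (subst suminf_emeasure) auto
      finally show "(\<Sum>i. ennreal (norm (vector_value ?D (E i)))) \<le> emeasure ?\<mu> A" .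
    qed
    obtain d :: "nat \<Rightarrow> 'a" where d: "\<And>U. open U \<Longrightarrow> U \<noteq> {} \<Longrightarrow> \<exists>i. d i \<in> U"
    proof -
      obtain D :: "'a set" where D: "countable D" "\<And>X. open X \<Longrightarrow> X \<noteq> {} \<Longrightarrow> \<exists>d\<in>D. d \<in> X"
        by (rule countable_dense_setE, rule that)
      have "D \<noteq> {}" using D(2)[of UNIV] by auto
      then have "range (from_nat_into D) = D" using D(1) by (rule range_from_nat_into)
      then show thesis using D(2) by (intro that[of "from_nat_into D"]) (metis rangeE)
    qed
    text \<open>Cutting \<open>A\<close> into pieces on which \<open>g\<close> stays within \<open>e * h\<close> of a constant, where \<open>h > 0\<close> is
      integrable, loses at most \<open>2 * e * \<integral>h\<close>, even if \<open>A\<close> has infinite measure.\<close>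
    have le: "emeasure ?\<mu> A \<le> ?S + ennreal e" if e: "0 < e" for e
    proof -
      obtain h0 :: "'a \<Rightarrow> ennreal" where h0: "h0 \<in> borel_measurable lborel" "integral\<^sup>N lborel h0 \<noteq> \<infinity>"
          "\<And>x. 0 < h0 x" "\<And>x. h0 x < \<infinity>"
        using sigma_finite_measure.Ex_finite_integrable_function[OF sigma_finite_lborel] by auto
      define m where "m = enn2real (integral\<^sup>N lborel h0)"
      have m: "0 \<le> m" "integral\<^sup>N lborel h0 = ennreal m" using h0(2) by (auto simp: m_def less_top)
      \<comment> \<open>Scaled so that the integral of \<open>2 * h\<close> is at most
        \<open>e\<close>; the \<open>+ 1\<close> spares a proof that \<open>m\<close> is
        positive.\<close>
      define h where "h x = e / (2 * (m + 1)) * enn2real (h0 x)" for x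
      have h_pos: "0 < h x" for x using e m h0(3,4)[of x] by (auto simp: h_def enn2real_positive_iff)
      have [measurable]: "h \<in> borel_measurable borel" using h0(1) unfolding h_def by measurable
      have h_int: "(\<integral>\<^sup>+x. ennreal (2 * h x) \<partial>lborel) \<le> ennreal e"
      proof -
        have "(\<integral>\<^sup>+x. ennreal (2 * h x) \<partial>lborel) = (\<integral>\<^sup>+x. ennreal (e / (m + 1)) * h0 x \<partial>lborel)"
        proof (rule nn_integral_cong)
          fix x
          have "h0 x = ennreal (enn2real (h0 x))" using h0(4)[of x] by (simp add: less_top)
          moreover have "ennreal (2 * h x) = ennreal (e / (m + 1)) * ennreal (enn2real (h0 x))"
            using e m by (subst ennreal_mult[symmetric]) (auto simp: h_def field_simps)
          ultimately show "ennreal (2 * h x) = ennreal (e / (m + 1)) * h0 x" by simp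
        qed
        also have "\<dots> = ennreal (e / (m + 1) * m)" using h0(1) e m by (simp add: nn_integral_cmult ennreal_mult[symmetric])
        also have "\<dots> \<le> ennreal e" using e m by (intro ennreal_leI) (simp add: field_simps)
        finally show ?thesis .
      qed
      \<comment> \<open>The index codes a point of a dense sequence and a radius: \<open>g\<close>
        is \<open>h\<close>-close to the point, and the ball makes the piece bounded, as the
        definition of the total variation demands. Both properties survive making the pieces
        disjoint.\<close>
      define U where "U n = {x \<in> A. norm (g x - d (fst (prod_decode n))) < h x} \<inter> cball 0 (real (snd (prod_decode n)))" for n
      define E where "E = disjointed U"
      have Um: "U n \<in> sets borel" for n unfolding U_def by measurable
      have Em: "E n \<in> sets borel" for n using Um sets.range_disjointed_sets[of U borel] by (auto simp: E_def)
      have EU: "E n \<subseteq> U n" for n unfolding E_def by (rule disjointed_subset)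
      have Eb: "bounded (E n)" for n
        using EU[of n] bounded_subset[OF bounded_cball] by (auto simp: U_def)
      have E_UN: "(\<Union>n. E n) = A"
      proof -
        have "x \<in> (\<Union>n. U n)" if "x \<in> A" for x
        proof -
          obtain i where "d i \<in> ball (g x) (h x)" using d[of "ball (g x) (h x)"] h_pos[of x] by auto
          moreover obtain k where "norm x \<le> real k" using real_arch_simple by blast
          ultimately have "x \<in> U (prod_encode (i, k))" using that by (auto simp: U_def dist_norm)
          then show ?thesis by blast
        qed
        then show ?thesis unfolding E_def UN_disjointed_eq by (auto simp: U_def)
      qed
      have E_disj: "disjoint_family E" unfolding E_def by (rule disjoint_family_disjointed)
      have piece: "emeasure ?\<mu> (E n) \<le> ennreal (norm (vector_value ?D (E n))) + emeasure (density lborel (\<lambda>x. ennreal (2 * h x))) (E n)" for n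
      proof -
        let ?d = "d (fst (prod_decode n))"
        have close: "norm (g x - ?d) \<le> h x" if "x \<in> E n" for x using that EU[of n] by (auto simp: U_def)
        have gi: "set_integrable lborel (E n) g" "set_integrable lborel (E n) (\<lambda>x. norm (g x))"
          using Em Eb gB by (auto intro!: si[where C=B])
        have ci: "set_integrable lborel (E n) (\<lambda>_. ?d)" "set_integrable lborel (E n) (\<lambda>_. norm ?d)"
          using Em Eb by (auto intro!: si[where C="norm ?d"])
        have hi: "set_integrable lborel (E n) h"
        proof -
          have "integrable lborel (\<lambda>x. 2 * h x)"
            using h_int h_pos by (intro integrableI_nonneg) (auto simp: less_imp_le intro: order.strict_trans1)
          then have "integrable lborel h" by simp
          then show ?thesis unfolding set_integrable_def using Em by (intro integrable_mult_indicator) auto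
        qed
        have "(LBINT x:E n. norm (g x)) \<le> (LBINT x:E n. norm ?d + h x)"
          by (rule set_integral_mono[OF gi(2) set_integral_add(1)[OF ci(2) hi]])
             (use close norm_triangle_sub[of "g _" ?d] in \<open>fastforce intro: order_trans\<close>)
        also have "\<dots> = (LBINT x:E n. norm ?d) + (LBINT x:E n. h x)" by (rule set_integral_add(2)[OF ci(2) hi])
        also have "(LBINT x:E n. norm ?d) = norm (LBINT x:E n. ?d)"
          using emeasure_bounded_finite[OF Eb] Em by (simp add: set_lebesgue_integral_def)
        finally have 1: "(LBINT x:E n. norm (g x)) \<le> norm (LBINT x:E n. ?d) + (LBINT x:E n. h x)" .
        have "norm (LBINT x:E n. g x - ?d) \<le> (LBINT x:E n. norm (g x - ?d))"
          by (rule set_integral_norm_bound) (intro set_integral_diff gi ci)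
        also have "\<dots> \<le> (LBINT x:E n. h x)"
          by (rule set_integral_mono[OF _ hi]) (use close in \<open>auto intro!: set_integrable_norm set_integral_diff gi ci\<close>)
        finally have "norm ((LBINT x:E n. g x) - (LBINT x:E n. ?d)) \<le> (LBINT x:E n. h x)"
          by (simp add: set_integral_diff[OF gi(1) ci(1)])
        then have "(LBINT x:E n. norm (g x)) \<le> norm (LBINT x:E n. g x) + (LBINT x:E n. 2 * h x)"
          using 1 norm_triangle_sub[of "LBINT x:E n. ?d" "LBINT x:E n. g x"] by (simp add: norm_minus_commute)
        then have "emeasure ?\<mu> (E n) \<le> ennreal (norm (vector_value ?D (E n))) + ennreal (LBINT x:E n. 2 * h x)"
          using Em Eb h_pos by (simp add: em val ennreal_plus[symmetric] set_lebesgue_integral_def less_imp_le del: ennreal_plus)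
        also have "ennreal (LBINT x:E n. 2 * h x) = emeasure (density lborel (\<lambda>x. ennreal (2 * h x))) (E n)"
        proof -
          have "emeasure (density lborel (\<lambda>x. ennreal (2 * h x))) (E n) = (\<integral>\<^sup>+x. ennreal (indicator (E n) x *\<^sub>R (2 * h x)) \<partial>lborel)"
            using Em by (subst emeasure_density) (auto intro!: nn_integral_cong split: split_indicator)
          also have "\<dots> = ennreal (LBINT x:E n. 2 * h x)"
            using hi h_pos unfolding set_lebesgue_integral_def set_integrable_def
            by (intro nn_integral_eq_integral) (auto simp: less_imp_le mult.left_commute)
          finally show ?thesis ..
        qed
        finally show ?thesis .
      qed
      have "emeasure ?\<mu> A = (\<Sum>n. emeasure ?\<mu> (E n))"
        unfolding E_UN[symmetric] using Em E_disj by (intro suminf_emeasure[symmetric]) auto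
      also have "\<dots> \<le> (\<Sum>n. ennreal (norm (vector_value ?D (E n))) + emeasure (density lborel (\<lambda>x. ennreal (2 * h x))) (E n))"
        by (rule suminf_le[OF piece]) auto
      also have "\<dots> = (\<Sum>n. ennreal (norm (vector_value ?D (E n)))) + (\<Sum>n. emeasure (density lborel (\<lambda>x. ennreal (2 * h x))) (E n))"
        by (rule suminf_add[symmetric]) auto
      finally have "emeasure ?\<mu> A \<le> \<dots>" .
      moreover have "(\<Sum>n. ennreal (norm (vector_value ?D (E n)))) \<le> ?S"
        by (rule SUP_upper) (use Em Eb E_UN E_disj in auto)
      moreover have "(\<Sum>n. emeasure (density lborel (\<lambda>x. ennreal (2 * h x))) (E n)) \<le> ennreal e"
      proof -
        have "(\<Sum>n. emeasure (density lborel (\<lambda>x. ennreal (2 * h x))) (E n)) = emeasure (density lborel (\<lambda>x. ennreal (2 * h x))) A"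
          unfolding E_UN[symmetric] using Em E_disj by (intro suminf_emeasure) auto
        also have "\<dots> \<le> (\<integral>\<^sup>+x. ennreal (2 * h x) \<partial>lborel)"
          by (subst emeasure_density) (auto intro!: nn_integral_mono split: split_indicator)
        finally show ?thesis using h_int by (rule order_trans)
      qed
      ultimately show ?thesis using add_mono order_trans by blast
    qed
    have "emeasure ?\<mu> A \<le> ?S" by (rule ennreal_le_epsilon) (rule le)
    then show "emeasure ?\<mu> A = ?S" using le1 by (rule antisym)
  qed
qed

section \<open>Weak derivatives of radial functions and fields\<close>

text \<open>The fundamental theorem for the gauge integral asks no regularity of \<open>f'\<close>;
  a bounded Borel \<open>f'\<close> then makes the integral a Lebesgue one. Differentiability in the
  open interval admits profiles with a one-sided derivative at \<open>0\<close>.\<close>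

lemma set_integral_derivative:
  fixes f f' :: "real \<Rightarrow> real"
  assumes "a \<le> b" "continuous_on {a..b} f" "\<And>x. a < x \<Longrightarrow> x < b \<Longrightarrow> (f has_real_derivative f' x) (at x)"
    and f': "f' \<in> borel_measurable borel" "\<And>x. a \<le> x \<Longrightarrow> x \<le> b \<Longrightarrow> \<bar>f' x\<bar> \<le> C"
  shows "(LBINT x:{a..b}. f' x) = f b - f a"
proof -
  have "(f' has_integral (f b - f a)) {a..b}"
    using assms by (intro fundamental_theorem_of_calculus_interior)
      (auto simp: has_real_derivative_iff_has_vector_derivative)
  moreover have "set_integrable lborel {a..b} f'"
  proof -
    have "set_integrable lborel {a..b} (\<lambda>x. indicator {a..b} x * f' x)"
      by (rule set_integrable_bounded[where C="\<bar>C\<bar>"]) (use f' in \<open>force simp: indicator_def\<close>)+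
    moreover have "(\<lambda>x. indicator {a..b} x *\<^sub>R (indicator {a..b} x * f' x)) = (\<lambda>x. indicator {a..b} x *\<^sub>R f' x)"
      by (auto simp: fun_eq_iff indicator_def)
    ultimately show ?thesis unfolding set_integrable_def by simp
  qed
  ultimately show ?thesis by (simp add: set_borel_integral_eq_integral(2) integral_unique)
qed

lemma lipschitz_of_deriv:
  assumes "continuous_on {0..} g" "\<And>t. 0 < t \<Longrightarrow> (g has_real_derivative g' t) (at t)"
    "\<And>t. 0 \<le> t \<Longrightarrow> t \<le> R \<Longrightarrow> \<bar>g' t\<bar> \<le> L" "0 \<le> r" "r \<le> R" "0 \<le> s" "s \<le> R"
  shows "\<bar>g r - g s\<bar> \<le> L * \<bar>r - (s::real)\<bar>"
proof -
  have *: "\<bar>g b - g a\<bar> \<le> L * (b - a)" if ab: "0 \<le> a" "a < b" "b \<le> R" for a b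
  proof -
    have "\<exists>l z. a < z \<and> z < b \<and> DERIV g z :> l \<and> g b - g a = (b - a) * l"
    proof (rule MVT[OF ab(2)])
      show "continuous_on {a..b} g" using ab by (intro continuous_on_subset[OF assms(1)]) auto
      show "g differentiable (at x)" if "a < x" "x < b" for x
        using assms(2)[of x] ab that by (auto simp: real_differentiable_def)
    qed
    then obtain l z where z: "a < z" "z < b" "DERIV g z :> l" "g b - g a = (b - a) * l" by blast
    then have "l = g' z" using assms(2)[of z] ab by (intro DERIV_unique) auto
    then have "\<bar>l\<bar> \<le> L" using assms(3)[of z] z ab by auto
    then show ?thesis using z(4) ab by (simp add: abs_mult mult.commute mult_left_mono)
  qed
  show ?thesis
    using *[of r s] *[of s r] assms by (cases r s rule: linorder_cases) (auto simp: abs_minus_commute)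
qed

text \<open>\<open>dg0\<close> is tied to \<open>g0\<close> only as the integrand of an indefinite
  integral. No pointwise limit of \<open>dg\<close> is asked for, since on \<open>{G = 1}\<close>
  there need not be one. \<open>B R\<close> bounds values and derivatives on \<open>[0,R]\<close>,
  hence is a Lipschitz constant there for every \<open>g j\<close> and for
  \<open>g0\<close>.\<close>

locale radial_approx =
  fixes g dg :: "nat \<Rightarrow> real \<Rightarrow> real" and g0 dg0 B :: "real \<Rightarrow> real"
  assumes meas [measurable]: "\<And>j. g j \<in> borel_measurable borel" "\<And>j. dg j \<in> borel_measurable borel"
      "g0 \<in> borel_measurable borel" "dg0 \<in> borel_measurable borel"
    and g_bound: "\<And>j r R. 0 \<le> r \<Longrightarrow> r \<le> R \<Longrightarrow> \<bar>g j r\<bar> \<le> B R"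
    and dg_bound: "\<And>j r R. 0 \<le> r \<Longrightarrow> r \<le> R \<Longrightarrow> \<bar>dg j r\<bar> \<le> B R"
    and dg0_bound: "\<And>r R. 0 \<le> r \<Longrightarrow> r \<le> R \<Longrightarrow> \<bar>dg0 r\<bar> \<le> B R"
    and g_cont: "\<And>j. continuous_on {0..} (g j)"
    and g_deriv: "\<And>j r. 0 < r \<Longrightarrow> (g j has_real_derivative dg j r) (at r)"
    and g_lim: "\<And>r. 0 \<le> r \<Longrightarrow> (\<lambda>j. g j r) \<longlonglongrightarrow> g0 r"
    and dg0_integral: "\<And>r. 0 \<le> r \<Longrightarrow> g0 r - g0 0 = (LBINT t:{0..r}. dg0 t)"
begin

lemma B_nonneg: "0 \<le> R \<Longrightarrow> 0 \<le> B R"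
  using dg0_bound[of 0 R] by (rule order_trans[OF abs_ge_zero]) auto

lemma dg_integral:
  assumes "0 \<le> a" "a \<le> b"
  shows "g j b - g j a = (LBINT t:{a..b}. dg j t)"
  by (rule set_integral_derivative[where C="B b", symmetric])
     (use assms g_deriv dg_bound in \<open>auto intro: continuous_on_subset[OF g_cont]\<close>)

lemma g_lipschitz:
  assumes "0 \<le> r" "r \<le> R" "0 \<le> s" "s \<le> R"
  shows "\<bar>g j r - g j s\<bar> \<le> B R * \<bar>r - s\<bar>"
  by (rule lipschitz_of_deriv[OF g_cont g_deriv dg_bound assms])

lemma g0_lipschitz:
  assumes "0 \<le> r" "r \<le> R" "0 \<le> s" "s \<le> R"
  shows "\<bar>g0 r - g0 s\<bar> \<le> B R * \<bar>r - s\<bar>"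
proof (rule LIMSEQ_le_const2)
  show "(\<lambda>j. \<bar>g j r - g j s\<bar>) \<longlonglongrightarrow> \<bar>g0 r - g0 s\<bar>" using assms by (intro tendsto_intros g_lim)
  show "\<exists>N. \<forall>n\<ge>N. \<bar>g n r - g n s\<bar> \<le> B R * \<bar>r - s\<bar>" using g_lipschitz[OF assms] by blast
qed

lemma g0_bound: "0 \<le> r \<Longrightarrow> r \<le> R \<Longrightarrow> \<bar>g0 r\<bar> \<le> B R"
  by (rule LIMSEQ_le_const2[OF tendsto_rabs[OF g_lim]]) (use g_bound in auto)

text \<open>The primitive of \<open>dg j\<close> is \<open>g j - g j 0\<close>, so the convergence
  of primitives is just that of the profiles.\<close>

lemma weak_radial:
  fixes \<psi> :: "'a::euclidean_space \<Rightarrow> real"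
  assumes "integrable lebesgue \<psi>" "\<And>x. R < norm x \<Longrightarrow> \<psi> x = 0" "0 \<le> R"
  shows "(\<lambda>j. \<integral>x. dg j (norm x) * \<psi> x \<partial>lebesgue) \<longlonglongrightarrow> (LINT x|lebesgue. dg0 (norm x) * \<psi> x)"
proof (rule tendsto_integral_radial[where R=R and C="B R"])
  fix r assume r: "0 \<le> r" "r \<le> R"
  have "(\<lambda>j. g j r - g j 0) \<longlonglongrightarrow> g0 r - g0 0" using r by (intro tendsto_intros g_lim) auto
  then show "(\<lambda>j. LBINT t:{0..r}. dg j t) \<longlonglongrightarrow> (LBINT t:{0..r}. dg0 t)"
    using r by (simp add: dg_integral dg0_integral)
qed (use assms dg_bound dg0_bound in auto)

text \<open>The weight is \<open>1\<close> for scalar radial functions and a component of \<open>sgn\<close> for radial fields; the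
  latter is only differentiable off the origin, where \<open>g\<close> has to vanish.\<close>

lemma weighted_by_parts:
  fixes a :: "'a::euclidean_space \<Rightarrow> real" and da :: "'a \<Rightarrow> 'a"
  assumes [measurable]: "a \<in> borel_measurable borel" "da \<in> borel_measurable borel"
    and a_le: "\<And>x. \<bar>a x\<bar> \<le> 1"
    and a_deriv: "\<And>x. x \<noteq> 0 \<Longrightarrow> (a has_derivative (\<lambda>h. da x \<bullet> h)) (at x)"
    and cases: "(\<forall>x. a x = 1 \<and> da x = 0) \<or> ((\<forall>j. g j 0 = 0) \<and>
       (\<forall>x y. \<bar>a x - a y\<bar> * norm y \<le> 2 * norm (x - y)) \<and> (\<forall>x. norm (da x) * norm x \<le> 2))"
    and \<zeta>: "test_function UNIV \<zeta>" and b: "b \<in> Basis"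
  shows "(LBINT x. g0 (norm x) * a x * (grad \<zeta> x \<bullet> b)) =
    - (LBINT x. (dg0 (norm x) * a x * (sgn x \<bullet> b) + g0 (norm x) * (da x \<bullet> b)) * \<zeta> x)"
proof -
  have sb: "\<bar>sgn x \<bullet> b\<bar> \<le> 1" for x :: 'a
    using Basis_le_norm[OF b, of "sgn x"] by (auto simp: norm_sgn split: if_splits)
  have dab: "\<bar>da x \<bullet> b\<bar> \<le> norm (da x)" for x using Basis_le_norm[OF b] .
  define D where "D j x = dg j (norm x) * a x * (sgn x \<bullet> b) + g j (norm x) * (da x \<bullet> b)" for j x
  \<comment> \<open>For a field, \<open>g j\<close> vanishes at \<open>0\<close>, so the bound
    \<open>B R' * norm x\<close> for it absorbs the singularity \<open>2 / norm x\<close> of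
    \<open>da\<close>.\<close>
  have gda: "\<bar>g j (norm x) * (da x \<bullet> b)\<bar> \<le> 2 * B R'" if "norm x \<le> R'" for j x R'
    using cases
  proof
    assume "\<forall>x. a x = 1 \<and> da x = 0"
    then show ?thesis using B_nonneg[of R'] that norm_ge_zero[of x] by simp
  next
    assume c: "(\<forall>j. g j 0 = 0) \<and> (\<forall>x y. \<bar>a x - a y\<bar> * norm y \<le> 2 * norm (x - y)) \<and> (\<forall>x. norm (da x) * norm x \<le> 2)"
    have R': "0 \<le> R'" using that norm_ge_zero[of x] by linarith
    have "\<bar>g j (norm x) - g j 0\<bar> \<le> B R' * \<bar>norm x - 0\<bar>" using that R' by (intro g_lipschitz) auto
    then have "\<bar>g j (norm x)\<bar> \<le> B R' * norm x" using c by simp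
    then have "\<bar>g j (norm x) * (da x \<bullet> b)\<bar> \<le> B R' * norm x * norm (da x)"
      unfolding abs_mult using dab[of x] B_nonneg[OF R'] by (intro mult_mono) auto
    also have "\<dots> = B R' * (norm (da x) * norm x)" by simp
    also have "\<dots> \<le> B R' * 2" using c B_nonneg[OF R'] by (intro mult_left_mono) auto
    finally show ?thesis by simp
  qed
  have da1: "\<bar>d * a x * (sgn x \<bullet> b)\<bar> \<le> c" if "\<bar>d\<bar> \<le> c" for d c x
  proof -
    have "\<bar>d\<bar> * \<bar>a x\<bar> * \<bar>sgn x \<bullet> b\<bar> \<le> c * 1 * 1"
      using that a_le[of x] sb[of x] by (intro mult_mono) auto
    then show ?thesis by (simp add: abs_mult)
  qed
  have by_parts: "(LBINT x. g j (norm x) * a x * (grad \<zeta> x \<bullet> b)) = - (LBINT x. D j x * \<zeta> x)" for j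
  proof (rule integral_by_parts_lipschitz[OF \<zeta> b])
    fix R'
    show "\<exists>L. \<forall>x y. norm x \<le> R' \<longrightarrow> norm y \<le> R' \<longrightarrow>
        \<bar>g j (norm x) * a x - g j (norm y) * a y\<bar> \<le> L * norm (x - y)"
    proof (intro exI[of _ "3 * B R'"] allI impI)
      fix x y :: 'a assume xy: "norm x \<le> R'" "norm y \<le> R'"
      have R': "0 \<le> R'" using xy norm_ge_zero[of x] by linarith
      have g: "\<bar>g j (norm x) - g j (norm y)\<bar> \<le> B R' * norm (x - y)"
      proof -
        have "\<bar>g j (norm x) - g j (norm y)\<bar> \<le> B R' * \<bar>norm x - norm y\<bar>" using xy by (intro g_lipschitz) auto
        also have "\<dots> \<le> B R' * norm (x - y)" using B_nonneg[OF R'] by (intro mult_left_mono norm_triangle_ineq3)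
        finally show ?thesis .
      qed
      \<comment> \<open>The increment of the weight is singular at the origin. It is paired with
        \<open>g j (norm y)\<close>, at most \<open>B R' * norm y\<close>, and the factor
        \<open>norm y\<close> is what the hypothesis on \<open>a\<close> compensates.\<close>
      have ay: "\<bar>g j (norm y)\<bar> * \<bar>a x - a y\<bar> \<le> 2 * B R' * norm (x - y)"
        using cases
      proof
        assume "\<forall>x. a x = 1 \<and> da x = 0"
        then show ?thesis using B_nonneg[OF R'] by simp
      next
        assume c: "(\<forall>j. g j 0 = 0) \<and> (\<forall>x y. \<bar>a x - a y\<bar> * norm y \<le> 2 * norm (x - y)) \<and> (\<forall>x. norm (da x) * norm x \<le> 2)"
        have "\<bar>g j (norm y) - g j 0\<bar> \<le> B R' * \<bar>norm y - 0\<bar>" using xy R' by (intro g_lipschitz) auto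
        then have "\<bar>g j (norm y)\<bar> * \<bar>a x - a y\<bar> \<le> B R' * norm y * \<bar>a x - a y\<bar>"
          using c by (intro mult_right_mono) auto
        also have "\<dots> = B R' * (\<bar>a x - a y\<bar> * norm y)" by simp
        also have "\<dots> \<le> B R' * (2 * norm (x - y))" using c B_nonneg[OF R'] by (intro mult_left_mono) auto
        finally show ?thesis by simp
      qed
      have "\<bar>g j (norm x) * a x - g j (norm y) * a y\<bar> =
          \<bar>(g j (norm x) - g j (norm y)) * a x + g j (norm y) * (a x - a y)\<bar>" by (simp add: algebra_simps)
      also have "\<dots> \<le> \<bar>g j (norm x) - g j (norm y)\<bar> * \<bar>a x\<bar> + \<bar>g j (norm y)\<bar> * \<bar>a x - a y\<bar>"
        unfolding abs_mult[symmetric] by (rule abs_triangle_ineq)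
      also have "\<dots> \<le> B R' * norm (x - y) * 1 + 2 * B R' * norm (x - y)"
        by (rule add_mono[OF mult_mono ay]) (use g a_le[of x] B_nonneg[OF R'] in auto)
      finally show "\<bar>g j (norm x) * a x - g j (norm y) * a y\<bar> \<le> 3 * B R' * norm (x - y)" by simp
    qed
    show "\<exists>C. \<forall>x. norm x \<le> R' \<longrightarrow> \<bar>D j x\<bar> \<le> C"
    proof (intro exI[of _ "B R' + 2 * B R'"] allI impI)
      fix x :: 'a assume x: "norm x \<le> R'"
      show "\<bar>D j x\<bar> \<le> B R' + 2 * B R'"
        unfolding D_def by (rule order_trans[OF abs_triangle_ineq], rule add_mono)
          (use x gda[OF x] in \<open>auto intro!: da1 dg_bound\<close>)
    qed
  next
    show "AE x in lborel. ((\<lambda>t. g j (norm (x + t *\<^sub>R b)) * a (x + t *\<^sub>R b)) has_real_derivative D j x) (at 0)"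
      using AE_lborel_singleton[of "0::'a"]
    proof eventually_elim
      case (elim x)
      have lin: "((\<lambda>t. x + t *\<^sub>R b) has_derivative (\<lambda>t. t *\<^sub>R b)) (at 0)"
        by (auto intro!: derivative_eq_intros)
      have "((\<lambda>t. a (x + t *\<^sub>R b)) has_derivative (\<lambda>t. da x \<bullet> (t *\<^sub>R b))) (at 0)"
        by (rule has_derivative_compose[OF lin]) (use a_deriv[OF elim] in simp)
      then have 1: "((\<lambda>t. a (x + t *\<^sub>R b)) has_real_derivative da x \<bullet> b) (at 0)"
        unfolding has_field_derivative_def by (rule has_derivative_eq_rhs) (auto simp: fun_eq_iff)
      have "((\<lambda>t. norm (x + t *\<^sub>R b)) has_derivative (\<lambda>t. (t *\<^sub>R b) \<bullet> sgn x)) (at 0)"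
        by (rule has_derivative_compose[OF lin]) (use has_derivative_norm[OF elim] in simp)
      then have 2: "((\<lambda>t. norm (x + t *\<^sub>R b)) has_real_derivative sgn x \<bullet> b) (at 0)"
        unfolding has_field_derivative_def by (rule has_derivative_eq_rhs) (auto simp: fun_eq_iff inner_commute)
      have "(g j has_real_derivative dg j (norm x)) (at (norm (x + 0 *\<^sub>R b)))" using elim g_deriv[of "norm x" j] by simp
      from DERIV_chain2[OF this 2] 
      have "((\<lambda>t. g j (norm (x + t *\<^sub>R b))) has_real_derivative dg j (norm x) * (sgn x \<bullet> b)) (at 0)" .
      from DERIV_mult[OF this 1] show ?case by (simp add: D_def algebra_simps)
    qed
  qed (auto simp: D_def)
  have [measurable]: "\<zeta> \<in> borel_measurable borel" by (rule bounded_supp_borel[OF bounded_supp_test(1)[OF \<zeta>]])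
  have L1: "(\<lambda>j. LBINT x. g j (norm x) * a x * (grad \<zeta> x \<bullet> b)) \<longlonglongrightarrow> (LBINT x. g0 (norm x) * a x * (grad \<zeta> x \<bullet> b))"
  proof (rule bounded_supp_tendsto(1)[OF bounded_supp_test(2)[OF \<zeta> b]])
    fix R :: real assume R: "0 < R"
    have "\<bar>g j (norm x) * a x\<bar> \<le> B R * 1" if "norm x \<le> R" for j x
      unfolding abs_mult using that a_le[of x] B_nonneg[of R] R by (intro mult_mono g_bound) auto
    then show "\<exists>C. \<forall>j x. norm x \<le> R \<longrightarrow> \<bar>g j (norm x) * a x\<bar> \<le> C" by blast
  qed (auto intro!: tendsto_mult g_lim)
  obtain R where R: "0 < R" "\<And>x. R < norm x \<Longrightarrow> \<zeta> x = 0"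
    using bounded_supp_test(1)[OF \<zeta>] unfolding bounded_supp_def by blast
  have I: "integrable lborel (\<lambda>x. d x * \<zeta> x)"
    if "d \<in> borel_measurable borel" "\<And>R x. norm x \<le> R \<Longrightarrow> \<bar>d x\<bar> \<le> C R" for d C
    by (rule bounded_supp_integrable[OF bounded_supp_test(1)[OF \<zeta>] that(1)]) (use that(2) in blast)
  \<comment> \<open>\<open>dg j\<close> converges only weakly, so the weight, the direction and
    \<open>\<zeta>\<close> are gathered into one integrable function. The term with
    \<open>da\<close> contains \<open>g j\<close> instead and converges pointwise.\<close>
  have L2: "(\<lambda>j. LBINT x. dg j (norm x) * (a x * (sgn x \<bullet> b) * \<zeta> x))
      \<longlonglongrightarrow> (LBINT x. dg0 (norm x) * (a x * (sgn x \<bullet> b) * \<zeta> x))"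
  proof -
    have "integrable lborel (\<lambda>x. a x * (sgn x \<bullet> b) * \<zeta> x)"
      using da1[of 1 1] by (intro I[where C="\<lambda>_. 1"]) auto
    then have "(\<lambda>j. LINT x|lebesgue. dg j (norm x) * (a x * (sgn x \<bullet> b) * \<zeta> x))
      \<longlonglongrightarrow> (LINT x|lebesgue. dg0 (norm x) * (a x * (sgn x \<bullet> b) * \<zeta> x))"
      by (intro weak_radial[where R=R]) (use R in \<open>auto simp: integrable_completion\<close>)
    then show ?thesis by (simp add: integral_completion)
  qed
  have gdab: "\<exists>C. \<forall>j x. norm x \<le> R \<longrightarrow> \<bar>g j (norm x) * (da x \<bullet> b)\<bar> \<le> C" for R using gda by blast
  have lim: "(\<lambda>j. g j (norm x) * (da x \<bullet> b)) \<longlonglongrightarrow> g0 (norm x) * (da x \<bullet> b)" for x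
    by (intro tendsto_mult g_lim) auto
  have m: "(\<lambda>x. g j (norm x) * (da x \<bullet> b)) \<in> borel_measurable borel" "(\<lambda>x. g0 (norm x) * (da x \<bullet> b)) \<in> borel_measurable borel" for j
    by measurable
  note L3 = bounded_supp_tendsto[OF bounded_supp_test(1)[OF \<zeta>] m gdab lim]
  have split: "(LBINT x. (d (norm x) * a x * (sgn x \<bullet> b) + h (norm x) * (da x \<bullet> b)) * \<zeta> x) =
     (LBINT x. d (norm x) * (a x * (sgn x \<bullet> b) * \<zeta> x)) + (LBINT x. h (norm x) * (da x \<bullet> b) * \<zeta> x)"
    if "d \<in> borel_measurable borel" "\<And>r R. 0 \<le> r \<Longrightarrow> r \<le> R \<Longrightarrow> \<bar>d r\<bar> \<le> B R"
       "integrable lborel (\<lambda>x. h (norm x) * (da x \<bullet> b) * \<zeta> x)" for d h :: "real \<Rightarrow> real"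
  proof -
    have "integrable lborel (\<lambda>x. d (norm x) * a x * (sgn x \<bullet> b) * \<zeta> x)"
      using that(1) by (intro I[where C=B]) (auto intro!: da1 that(2))
    from Bochner_Integration.integral_add[OF this that(3)] show ?thesis by (simp add: algebra_simps)
  qed
  have "(LBINT x. D j x * \<zeta> x) = (LBINT x. dg j (norm x) * (a x * (sgn x \<bullet> b) * \<zeta> x)) + (LBINT x. g j (norm x) * (da x \<bullet> b) * \<zeta> x)" for j
    unfolding D_def by (rule split[OF meas(2) dg_bound L3(3)])
  then have "(\<lambda>j. - (LBINT x. D j x * \<zeta> x)) \<longlonglongrightarrow>
     - ((LBINT x. dg0 (norm x) * (a x * (sgn x \<bullet> b) * \<zeta> x)) + (LBINT x. g0 (norm x) * (da x \<bullet> b) * \<zeta> x))"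
    by (simp only:) (intro tendsto_intros L2 L3(1))
  then have "(\<lambda>j. - (LBINT x. D j x * \<zeta> x)) \<longlonglongrightarrow>
     - (LBINT x. (dg0 (norm x) * a x * (sgn x \<bullet> b) + g0 (norm x) * (da x \<bullet> b)) * \<zeta> x)"
    by (subst split[OF meas(4) dg0_bound L3(2)])
  from LIMSEQ_unique[OF L1[unfolded by_parts] this] show ?thesis .
qed

end

section \<open>Weak gradients and divergences of radial functions and fields\<close>

lemma has_weak_gradI:
  fixes u :: "'a::euclidean_space \<Rightarrow> real"
  assumes u: "u \<in> borel_measurable borel" "\<And>R. \<exists>C. \<forall>x. norm x \<le> R \<longrightarrow> \<bar>u x\<bar> \<le> C"
    and g: "g \<in> borel_measurable borel" "\<And>R. \<exists>C. \<forall>x. norm x \<le> R \<longrightarrow> norm (g x) \<le> C"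
    and eq: "\<And>\<zeta> b. test_function UNIV \<zeta> \<Longrightarrow> b \<in> Basis \<Longrightarrow>
      (LBINT x. u x * (grad \<zeta> x \<bullet> b)) = - (LBINT x. (g x \<bullet> b) * \<zeta> x)"
  shows "has_weak_grad UNIV u g"
  unfolding has_weak_grad_def
proof (intro conjI allI impI ballI)
  show "L1_loc UNIV u" using u by (intro L1_loc_bounded) auto
  show "L1_loc UNIV g" using g by (intro L1_loc_bounded) auto
  fix \<zeta> :: "'a \<Rightarrow> real" and b :: 'a assume \<zeta>: "test_function UNIV \<zeta>" and b: "b \<in> Basis"
  have [measurable]: "\<zeta> \<in> borel_measurable borel" "(\<lambda>x. grad \<zeta> x \<bullet> b) \<in> borel_measurable borel"
    by (intro bounded_supp_borel bounded_supp_test[OF \<zeta>] b)+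
  have "(LINT x|lebesgue. u x * (grad \<zeta> x \<bullet> b)) = (LBINT x. u x * (grad \<zeta> x \<bullet> b))"
    by (rule integral_completion) (use u in measurable)
  moreover have "(LINT x|lebesgue. (g x \<bullet> b) * \<zeta> x) = (LBINT x. (g x \<bullet> b) * \<zeta> x)"
    by (rule integral_completion) (use g in measurable)
  ultimately show "(LINT x:UNIV|lebesgue. u x * (grad \<zeta> x \<bullet> b)) = - (LINT x:UNIV|lebesgue. (g x \<bullet> b) * \<zeta> x)"
    using eq[OF \<zeta> b] by (simp add: set_lebesgue_integral_def)
qed

lemma norm_sgn_le_1: "norm (sgn (x::'a::real_normed_vector)) \<le> 1"
  by (simp add: norm_sgn)

lemma abs_inner_sgn_le:
  assumes "b \<in> Basis" shows "\<bar>sgn (x::'a::euclidean_space) \<bullet> b\<bar> \<le> 1"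
  using Basis_le_norm[OF assms, of "sgn x"] norm_sgn_le_1[of x] by linarith

context radial_approx
begin

lemma radial_bounds:
  "\<exists>C. \<forall>x::'a::euclidean_space. norm x \<le> R \<longrightarrow> \<bar>g0 (norm x)\<bar> \<le> C"
  "\<exists>C. \<forall>x::'a::euclidean_space. norm x \<le> R \<longrightarrow> \<bar>dg0 (norm x)\<bar> \<le> C"
  "\<exists>C. \<forall>x::'a::euclidean_space. norm x \<le> R \<longrightarrow> norm (dg0 (norm x) *\<^sub>R sgn x) \<le> C"
proof -
  show "\<exists>C. \<forall>x::'a. norm x \<le> R \<longrightarrow> \<bar>g0 (norm x)\<bar> \<le> C" using g0_bound by (intro exI[of _ "B R"]) auto
  show d: "\<exists>C. \<forall>x::'a. norm x \<le> R \<longrightarrow> \<bar>dg0 (norm x)\<bar> \<le> C" using dg0_bound by (intro exI[of _ "B R"]) auto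
  then obtain C where C: "\<And>x::'a. norm x \<le> R \<Longrightarrow> \<bar>dg0 (norm x)\<bar> \<le> C" by blast
  have "norm (dg0 (norm x) *\<^sub>R sgn x) \<le> C" if "norm x \<le> R" for x :: 'a
    using C[OF that] by (auto simp: norm_sgn)
  then show "\<exists>C. \<forall>x::'a. norm x \<le> R \<longrightarrow> norm (dg0 (norm x) *\<^sub>R sgn x) \<le> C" by blast
qed

lemma radial_weak_grad:
  "has_weak_grad UNIV (\<lambda>x::'a::euclidean_space. g0 (norm x)) (\<lambda>x. dg0 (norm x) *\<^sub>R sgn x)"
proof (rule has_weak_gradI)
  fix \<zeta> :: "'a \<Rightarrow> real" and b :: 'a assume \<zeta>: "test_function UNIV \<zeta>" and b: "b \<in> Basis"
  show "(LBINT x. g0 (norm x) * (grad \<zeta> x \<bullet> b)) = - (LBINT x. ((dg0 (norm x) *\<^sub>R sgn x) \<bullet> b) * \<zeta> x)"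
    using weighted_by_parts[where a="\<lambda>_. 1" and da="\<lambda>_. 0", OF _ _ _ _ _ \<zeta> b] by simp
qed (use radial_bounds in auto)

lemma half_line_weak_grad: "has_weak_grad {0<..} g0 dg0"
  by (rule has_weak_grad_subset[OF radial_weak_grad]) auto

lemma half_line_W1inf: "W1inf {0<..<R} g0"
  unfolding W1inf_def
proof (intro conjI exI[of _ dg0])
  show "Linf {0<..<R} g0" by (rule Linf_bounded(1)[where C="B R"]) (use g0_bound in auto)
  show "Linf {0<..<R} dg0" by (rule Linf_bounded(1)[where C="B R"]) (use dg0_bound in auto)
  show "has_weak_grad {0<..<R} g0 dg0" by (rule has_weak_grad_subset[OF radial_weak_grad]) auto
qed

lemma radial_W1inf:
  assumes u: "\<And>r. 0 \<le> r \<Longrightarrow> \<bar>g0 r\<bar> \<le> C" and du: "\<And>r. 0 \<le> r \<Longrightarrow> \<bar>dg0 r\<bar> \<le> C"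
  shows "W1inf UNIV (\<lambda>x::'a::euclidean_space. g0 (norm x))"
  unfolding W1inf_def
proof (intro conjI exI[of _ "\<lambda>x. dg0 (norm x) *\<^sub>R sgn x"] radial_weak_grad)
  show "Linf UNIV (\<lambda>x::'a. g0 (norm x))" by (rule Linf_bounded(1)[where C=C]) (use u in auto)
  have "norm (dg0 (norm x) *\<^sub>R sgn x) \<le> C" for x :: 'a
    using du[of "norm x"] by (auto simp: norm_sgn)
  then show "Linf UNIV (\<lambda>x::'a. dg0 (norm x) *\<^sub>R sgn x)" by (intro Linf_bounded(1)[where C=C]) auto
qed

lemma radial_field_bound:
  fixes x :: "'a::euclidean_space"
  assumes "norm x \<le> R"
  shows "norm (g0 (norm x) *\<^sub>R sgn x) \<le> B R"
  using g0_bound[of "norm x" R] B_nonneg[of R] norm_ge_zero[of x] assms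
  by (cases "x = 0") (auto simp: norm_sgn)

context
  assumes g_zero: "\<And>j. g j 0 = 0"
begin

lemma g0_zero: "g0 0 = 0"
  using g_lim[of 0] by (simp add: g_zero LIMSEQ_const_iff)

lemma g0_div_bound:
  assumes "0 \<le> r" "r \<le> R" shows "\<bar>g0 r / r\<bar> \<le> B R"
proof -
  have "\<bar>g0 r - g0 0\<bar> \<le> B R * \<bar>r - 0\<bar>" using assms by (intro g0_lipschitz) auto
  then show ?thesis using assms B_nonneg[of R] by (auto simp: g0_zero divide_le_eq)
qed

text \<open>The gradient of the \<open>i\<close>-th component of the radial field with profile
  \<open>g0\<close>: the radial projection of \<open>i\<close> is scaled by \<open>dg0\<close>, the
  tangential one by \<open>g0 / r\<close>. At the origin \<open>sgn 0 = 0\<close> and division by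
  \<open>0\<close> give the value \<open>0\<close>.\<close>

definition field_grad :: "'a::euclidean_space \<Rightarrow> 'a \<Rightarrow> 'a" where
  "field_grad i x = (dg0 (norm x) * (sgn x \<bullet> i)) *\<^sub>R sgn x + (g0 (norm x) / norm x) *\<^sub>R (i - (sgn x \<bullet> i) *\<^sub>R sgn x)"

lemma field_grad_bound:
  fixes x :: "'a::euclidean_space"
  assumes i: "i \<in> Basis" and x: "norm x \<le> R"
  shows "norm (field_grad i x) \<le> 3 * B R"
proof -
  have R: "0 \<le> R" using x norm_ge_zero[of x] by linarith
  have "norm (dg0 (norm x) *\<^sub>R (sgn x \<bullet> i) *\<^sub>R sgn x) \<le> B R * (1 * 1)"
    unfolding norm_scaleR using x R B_nonneg[of R] abs_inner_sgn_le[OF i] norm_sgn_le_1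
    by (intro mult_mono) (auto intro!: dg0_bound simp: mult_le_one)
  moreover have "norm ((g0 (norm x) / norm x) *\<^sub>R (i - (sgn x \<bullet> i) *\<^sub>R sgn x)) \<le> B R * 2"
    unfolding norm_scaleR
  proof (rule mult_mono)
    show "\<bar>g0 (norm x) / norm x\<bar> \<le> B R" using x by (intro g0_div_bound) auto
    have "norm (i - (sgn x \<bullet> i) *\<^sub>R sgn x) \<le> norm i + norm ((sgn x \<bullet> i) *\<^sub>R sgn x)" by (rule norm_triangle_ineq4)
    also have "\<dots> \<le> 1 + 1 * 1" unfolding norm_scaleR
      using i abs_inner_sgn_le[OF i, of x] norm_sgn_le_1[of x] by (intro add_mono mult_mono) auto
    finally show "norm (i - (sgn x \<bullet> i) *\<^sub>R sgn x) \<le> 2" by simp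
  qed (use B_nonneg[OF R] in auto)
  ultimately show ?thesis unfolding field_grad_def
    by (intro order_trans[OF norm_triangle_ineq]) simp
qed

lemma radial_field_weak_grad:
  assumes i: "(i::'a::euclidean_space) \<in> Basis"
  shows "has_weak_grad UNIV (\<lambda>x. g0 (norm x) * (sgn x \<bullet> i)) (field_grad i)"
proof (rule has_weak_gradI)
  show "\<exists>C. \<forall>x::'a. norm x \<le> R \<longrightarrow> \<bar>g0 (norm x) * (sgn x \<bullet> i)\<bar> \<le> C" for R
  proof (intro exI[of _ "B R * 1"] allI impI)
    fix x :: 'a assume x: "norm x \<le> R"
    then show "\<bar>g0 (norm x) * (sgn x \<bullet> i)\<bar> \<le> B R * 1"
      unfolding abs_mult using abs_inner_sgn_le[OF i, of x] B_nonneg[of R] norm_ge_zero[of x]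
      by (intro mult_mono g0_bound) (auto intro: order_trans)
  qed
  show "\<exists>C. \<forall>x::'a. norm x \<le> R \<longrightarrow> norm (field_grad i x) \<le> C" for R
    using field_grad_bound[OF i] by blast
  show "field_grad i \<in> borel_measurable borel" unfolding field_grad_def by measurable
  fix \<zeta> :: "'a \<Rightarrow> real" and b :: 'a assume \<zeta>: "test_function UNIV \<zeta>" and b: "b \<in> Basis"
  define da where "da x = (1 / norm x) *\<^sub>R (i - (sgn x \<bullet> i) *\<^sub>R sgn x)" for x
  have "(LBINT x. g0 (norm x) * (sgn x \<bullet> i) * (grad \<zeta> x \<bullet> b)) =
    - (LBINT x. (dg0 (norm x) * (sgn x \<bullet> i) * (sgn x \<bullet> b) + g0 (norm x) * (da x \<bullet> b)) * \<zeta> x)"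
  proof (rule weighted_by_parts[OF _ _ _ _ _ \<zeta> b])
    show "da \<in> borel_measurable borel" unfolding da_def by measurable
    show "\<bar>sgn x \<bullet> i\<bar> \<le> 1" for x by (rule abs_inner_sgn_le[OF i])
    show "((\<lambda>x. sgn x \<bullet> i) has_derivative (\<lambda>h. da x \<bullet> h)) (at x)" if "x \<noteq> 0" for x
    proof -
      have "((\<lambda>x. inverse (norm x)) has_derivative (\<lambda>h. - (inverse (norm x) * (h \<bullet> sgn x) * inverse (norm x)))) (at x)"
        by (rule Deriv.has_derivative_inverse) (use that has_derivative_norm[OF that] in auto)
      moreover have "((\<lambda>x. x \<bullet> i) has_derivative (\<lambda>h. h \<bullet> i)) (at x)"
        by (rule has_derivative_inner_left[OF has_derivative_ident])
      ultimately have "((\<lambda>x. (x \<bullet> i) * inverse (norm x)) has_derivative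
          (\<lambda>h. (x \<bullet> i) * - (inverse (norm x) * (h \<bullet> sgn x) * inverse (norm x)) + (h \<bullet> i) * inverse (norm x))) (at x)"
        by (rule has_derivative_mult[rotated])
      then have "((\<lambda>x. (x \<bullet> i) * inverse (norm x)) has_derivative (\<lambda>h. da x \<bullet> h)) (at x)"
        by (rule has_derivative_eq_rhs)
           (use that in \<open>auto simp: fun_eq_iff da_def sgn_div_norm inner_diff_left inner_diff_right inner_commute field_simps\<close>)
      moreover have "(\<lambda>x. (x \<bullet> i) * inverse (norm x)) = (\<lambda>x. sgn x \<bullet> i)"
        by (auto simp: fun_eq_iff sgn_div_norm)
      ultimately show ?thesis by simp
    qed
    \<comment> \<open>After multiplication by \<open>norm y\<close>, the difference of directions is
      the vector from \<open>y\<close> to \<open>norm y *\<^sub>R sgn x\<close>. It splits into a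
      change of radius and \<open>x - y\<close>, each of length at most \<open>norm (x - y)\<close>;
      hence the factor \<open>2\<close>.\<close>
    have "\<bar>sgn x \<bullet> i - sgn y \<bullet> i\<bar> * norm y \<le> 2 * norm (x - y)" for x y
    proof -
      have "\<bar>sgn x \<bullet> i - sgn y \<bullet> i\<bar> * norm y = \<bar>(norm y *\<^sub>R sgn x - y) \<bullet> i\<bar>"
      proof -
        have "(norm y *\<^sub>R sgn x - y) \<bullet> i = (norm y *\<^sub>R sgn x - norm y *\<^sub>R sgn y) \<bullet> i"
          by (cases "y = 0") (auto simp: sgn_div_norm)
        also have "\<dots> = norm y * (sgn x \<bullet> i - sgn y \<bullet> i)" by (simp add: inner_diff_left algebra_simps)
        finally show ?thesis by (simp add: abs_mult)
      qed
      also have "\<dots> \<le> norm (norm y *\<^sub>R sgn x - y)" by (rule Basis_le_norm[OF i])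
      also have "norm y *\<^sub>R sgn x - y = (norm y - norm x) *\<^sub>R sgn x + (x - y)"
        by (cases "x = 0") (auto simp: sgn_div_norm algebra_simps)
      also have "norm \<dots> \<le> \<bar>norm y - norm x\<bar> * 1 + norm (x - y)"
        by (rule order_trans[OF norm_triangle_ineq], rule add_mono)
           (auto simp: norm_sgn)
      also have "\<dots> \<le> norm (x - y) + norm (x - y)"
        using norm_triangle_ineq3[of y x] by (simp add: norm_minus_commute)
      finally show ?thesis by simp
    qed
    moreover have "norm (da x) * norm x \<le> 2" for x
    proof (cases "x = 0")
      case False
      have "norm (da x) * norm x = norm (i - (sgn x \<bullet> i) *\<^sub>R sgn x)" using False by (simp add: da_def)
      also have "\<dots> \<le> norm i + norm ((sgn x \<bullet> i) *\<^sub>R sgn x)" by (rule norm_triangle_ineq4)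
      also have "\<dots> \<le> 1 + 1 * 1" unfolding norm_scaleR
        using i abs_inner_sgn_le[OF i, of x] norm_sgn_le_1[of x] by (intro add_mono mult_mono) auto
      finally show ?thesis by simp
    qed simp
    ultimately show "(\<forall>x. sgn x \<bullet> i = 1 \<and> da x = 0) \<or> (\<forall>j. g j 0 = 0) \<and>
        (\<forall>x y. \<bar>sgn x \<bullet> i - sgn y \<bullet> i\<bar> * norm y \<le> 2 * norm (x - y)) \<and> (\<forall>x. norm (da x) * norm x \<le> 2)"
      using g_zero by blast
  qed measurable
  then show "(LBINT x. g0 (norm x) * (sgn x \<bullet> i) * (grad \<zeta> x \<bullet> b)) = - (LBINT x. (field_grad i x \<bullet> b) * \<zeta> x)"
    by (simp add: field_grad_def da_def inner_add_left)
qed measurable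

lemma radial_div_bound:
  fixes x :: "'a::euclidean_space"
  assumes "norm x \<le> R"
  shows "\<bar>dg0 (norm x) + (real DIM('a) - 1) / norm x * g0 (norm x)\<bar> \<le> real DIM('a) * B R"
proof -
  have "\<bar>dg0 (norm x) + (real DIM('a) - 1) / norm x * g0 (norm x)\<bar> \<le> \<bar>dg0 (norm x)\<bar> + (real DIM('a) - 1) * \<bar>g0 (norm x) / norm x\<bar>"
    using DIM_positive[where 'a='a] by (intro order_trans[OF abs_triangle_ineq]) (simp add: abs_mult Suc_leI of_nat_diff)
  also have "\<dots> \<le> B R + (real DIM('a) - 1) * B R"
    using assms DIM_positive[where 'a='a] by (intro add_mono mult_left_mono dg0_bound g0_div_bound) (auto simp: Suc_leI)
  finally show ?thesis by (simp add: algebra_simps)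
qed

text \<open>The divergence is the trace of the weak Jacobian: the radial direction contributes
  \<open>dg0\<close>, and each of the remaining \<open>DIM('a) - 1\<close> tangential directions
  contributes \<open>g0 / r\<close>.\<close>

lemma radial_field_weak_div:
  "has_weak_div UNIV (\<lambda>x::'a::euclidean_space. g0 (norm x) *\<^sub>R sgn x)
     (\<lambda>x. dg0 (norm x) + (real DIM('a) - 1) / norm x * g0 (norm x))"
  unfolding has_weak_div_def
proof (intro conjI allI impI)
  let ?d = "\<lambda>x::'a. dg0 (norm x) + (real DIM('a) - 1) / norm x * g0 (norm x)"
  have db: "\<exists>C. \<forall>x. norm x \<le> R \<longrightarrow> \<bar>?d x\<bar> \<le> C" for R using radial_div_bound by blast
  have zb: "\<exists>C. \<forall>x::'a. norm x \<le> R \<longrightarrow> norm (g0 (norm x) *\<^sub>R sgn x) \<le> C" for R using radial_field_bound by blast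
  show "L1_loc UNIV (\<lambda>x::'a. g0 (norm x) *\<^sub>R sgn x)" using zb by (intro L1_loc_bounded) auto
  show "L1_loc UNIV ?d" using db by (intro L1_loc_bounded) auto
  fix \<zeta> :: "'a \<Rightarrow> real" assume \<zeta>: "test_function UNIV \<zeta>"
  note [measurable] = bounded_supp_test[OF \<zeta>, THEN bounded_supp_borel]
  have zb': "\<exists>C. \<forall>x. norm x \<le> R \<longrightarrow> \<bar>g0 (norm x) * (sgn x \<bullet> i)\<bar> \<le> C" if "i \<in> Basis" for R and i :: 'a
    using zb[of R] order_trans[OF Basis_le_norm[OF that]] by (metis inner_scaleR_left)
  have I1: "integrable lborel (\<lambda>x. g0 (norm x) * (sgn x \<bullet> i) * (grad \<zeta> x \<bullet> i))" if i: "i \<in> Basis" for i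
    by (rule bounded_supp_integrable[OF bounded_supp_test(2)[OF \<zeta>]]) (use zb' i in auto)
  have I2: "integrable lborel (\<lambda>x. (field_grad i x \<bullet> i) * \<zeta> x)" if i: "i \<in> Basis" for i :: 'a
  proof (rule bounded_supp_integrable[OF bounded_supp_test(1)[OF \<zeta>]])
    show "(\<lambda>x. field_grad i x \<bullet> i) \<in> borel_measurable borel" unfolding field_grad_def by measurable
    show "\<exists>C. \<forall>x. norm x \<le> R \<longrightarrow> \<bar>field_grad i x \<bullet> i\<bar> \<le> C" for R
      using order_trans[OF Basis_le_norm[OF i] field_grad_bound[OF i]] by blast
  qed
  have m: "(\<lambda>x. (g0 (norm x) *\<^sub>R sgn x) \<bullet> grad \<zeta> x) \<in> borel_measurable borel"
  proof -
    have "(\<lambda>x. \<Sum>i\<in>Basis. g0 (norm x) * (sgn x \<bullet> i) * (grad \<zeta> x \<bullet> i)) \<in> borel_measurable borel"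
      by (intro borel_measurable_sum) measurable
    then show ?thesis by (subst euclidean_inner) (simp add: mult.assoc)
  qed
  have "(LINT x|lebesgue. (g0 (norm x) *\<^sub>R sgn x) \<bullet> grad \<zeta> x) = (LBINT x. (g0 (norm x) *\<^sub>R sgn x) \<bullet> grad \<zeta> x)"
    by (rule integral_completion) (use m in simp)
  also have "\<dots> = (LBINT x. (\<Sum>i\<in>Basis. g0 (norm x) * (sgn x \<bullet> i) * (grad \<zeta> x \<bullet> i)))"
    by (subst euclidean_inner) (simp add: mult.assoc)
  also have "\<dots> = (\<Sum>i\<in>Basis. \<integral>x. g0 (norm x) * (sgn x \<bullet> i) * (grad \<zeta> x \<bullet> i) \<partial>lborel)"
    by (rule Bochner_Integration.integral_sum) (rule I1)
  also have "\<dots> = (\<Sum>i\<in>Basis. - (LBINT x. (field_grad i x \<bullet> i) * \<zeta> x))"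
  proof (rule sum.cong)
    fix i :: 'a assume i: "i \<in> Basis"
    have "(LINT x:UNIV|lebesgue. g0 (norm x) * (sgn x \<bullet> i) * (grad \<zeta> x \<bullet> i)) = - (LINT x:UNIV|lebesgue. (field_grad i x \<bullet> i) * \<zeta> x)"
      using radial_field_weak_grad[OF i] \<zeta> i unfolding has_weak_grad_def by blast
    moreover have "(LINT x:UNIV|lebesgue. g0 (norm x) * (sgn x \<bullet> i) * (grad \<zeta> x \<bullet> i)) = (LBINT x. g0 (norm x) * (sgn x \<bullet> i) * (grad \<zeta> x \<bullet> i))"
      using I1[OF i] by (simp add: set_lebesgue_integral_def integral_completion)
    moreover have "(LINT x:UNIV|lebesgue. (field_grad i x \<bullet> i) * \<zeta> x) = (LBINT x. (field_grad i x \<bullet> i) * \<zeta> x)"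
      using I2[OF i] by (simp add: set_lebesgue_integral_def integral_completion)
    ultimately show "(LBINT x. g0 (norm x) * (sgn x \<bullet> i) * (grad \<zeta> x \<bullet> i)) = - (LBINT x. (field_grad i x \<bullet> i) * \<zeta> x)"
      by simp
  qed simp
  also have "\<dots> = - (LBINT x. (\<Sum>i\<in>Basis. (field_grad i x \<bullet> i) * \<zeta> x))"
    by (subst Bochner_Integration.integral_sum) (auto intro: I2 simp: sum_negf)
  also have "(LBINT x. (\<Sum>i\<in>Basis. (field_grad i x \<bullet> i) * \<zeta> x)) = (LBINT x. ?d x * \<zeta> x)"
  proof (rule integral_cong_AE)
    show "(\<lambda>x. \<Sum>i\<in>Basis. (field_grad i x \<bullet> i) * \<zeta> x) \<in> borel_measurable lborel"
      unfolding field_grad_def by measurable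
    show "AE x in lborel. (\<Sum>i\<in>Basis. (field_grad i x \<bullet> i) * \<zeta> x) = ?d x * \<zeta> x"
      using AE_lborel_singleton[of "0::'a"]
    proof eventually_elim
      case (elim x)
      have s: "(\<Sum>i\<in>Basis. (sgn x \<bullet> i) * (sgn x \<bullet> i)) = 1"
        using elim euclidean_inner[of "sgn x" "sgn x"] by (simp add: norm_sgn dot_square_norm)
      have "(\<Sum>i\<in>Basis. field_grad i x \<bullet> i) =
         (\<Sum>i\<in>Basis. dg0 (norm x) * ((sgn x \<bullet> i) * (sgn x \<bullet> i)) + g0 (norm x) / norm x * (1 - (sgn x \<bullet> i) * (sgn x \<bullet> i)))"
        by (rule sum.cong) (auto simp: field_grad_def inner_add_left inner_diff_left inner_Basis)
      also have "\<dots> = dg0 (norm x) * 1 + g0 (norm x) / norm x * (real DIM('a) - 1)"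
        by (simp only: sum.distrib sum_distrib_left[symmetric] sum_subtractf s sum_constant) simp
      finally show ?case by (simp add: sum_distrib_right[symmetric])
    qed
  qed measurable
  also have "(LBINT x. ?d x * \<zeta> x) = (LINT x|lebesgue. ?d x * \<zeta> x)"
    by (rule integral_completion[symmetric]) measurable
  finally show "(LINT x:UNIV|lebesgue. (g0 (norm x) *\<^sub>R sgn x) \<bullet> grad \<zeta> x) = - (LINT x:UNIV|lebesgue. ?d x * \<zeta> x)"
    by (simp add: set_lebesgue_integral_def)
qed

lemma radial_field_W1inf_loc: "W1inf_loc_vec UNIV (\<lambda>x::'a::euclidean_space. g0 (norm x) *\<^sub>R sgn x)"
  unfolding W1inf_loc_vec_def W1inf_loc_def W1inf_def
proof (intro ballI allI impI conjI)
  fix i :: 'a and U assume i: "i \<in> Basis" and U: "compactly_inside U (UNIV :: 'a set)"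
  have zb: "\<exists>C. \<forall>x::'a. norm x \<le> R \<longrightarrow> norm ((g0 (norm x) *\<^sub>R sgn x) \<bullet> i) \<le> C" for R
    using order_trans[OF Basis_le_norm[OF i] radial_field_bound] unfolding real_norm_def by blast
  have "Linf_loc UNIV (\<lambda>x::'a. (g0 (norm x) *\<^sub>R sgn x) \<bullet> i)" by (rule Linf_loc_bounded[OF _ zb]) measurable
  then show "Linf U (\<lambda>x::'a. (g0 (norm x) *\<^sub>R sgn x) \<bullet> i)" using U unfolding Linf_loc_def by blast
  have "Linf_loc UNIV (field_grad i)"
  proof (rule Linf_loc_bounded)
    show "field_grad i \<in> borel_measurable borel" unfolding field_grad_def by measurable
    show "\<exists>C. \<forall>x. norm x \<le> R \<longrightarrow> norm (field_grad i x) \<le> C" for R using field_grad_bound[OF i] by blast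
  qed
  then have "Linf U (field_grad i)" using U unfolding Linf_loc_def by blast
  moreover have "has_weak_grad U (\<lambda>x. (g0 (norm x) *\<^sub>R sgn x) \<bullet> i) (field_grad i)"
    by (rule has_weak_grad_subset[OF radial_field_weak_grad[OF i]]) auto
  ultimately show "\<exists>ga. has_weak_grad U (\<lambda>x. (g0 (norm x) *\<^sub>R sgn x) \<bullet> i) ga \<and> Linf U ga" by blast
qed

end

end

section \<open>Products of profiles and the Anzellotti pairing\<close>

lemma (in radial_approx) radial_approx_uminus:
  "radial_approx (\<lambda>j r. - g j r) (\<lambda>j r. - dg j r) (\<lambda>r. - g0 r) (\<lambda>r. - dg0 r) B"
proof
  show "- g0 r - - g0 0 = (LBINT t:{0..r}. - dg0 t)" if "0 \<le> r" for r
  proof -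
    have "(LBINT t:{0..r}. - dg0 t) = - (LBINT t:{0..r}. dg0 t)"
      by (simp add: set_lebesgue_integral_def)
    then show ?thesis using dg0_integral[OF that] by linarith
  qed
  show "continuous_on {0..} (\<lambda>r. - g j r)" for j by (intro continuous_on_minus g_cont)
  show "((\<lambda>r. - g j r) has_real_derivative - dg j r) (at r)" if "0 < r" for j r
    by (rule DERIV_minus[OF g_deriv[OF that]])
  show "(\<lambda>j. - g j r) \<longlonglongrightarrow> - g0 r" if "0 \<le> r" for r by (intro tendsto_minus g_lim that)
qed (simp_all add: g_bound dg_bound dg0_bound)

lemma integrable_Icc_bounded:
  fixes f :: "real \<Rightarrow> real"
  assumes "f \<in> borel_measurable borel" "\<And>t. 0 \<le> t \<Longrightarrow> t \<le> r \<Longrightarrow> \<bar>f t\<bar> \<le> C"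
  shows "integrable lborel (\<lambda>t. indicator {0..r} t * f t)"
proof (rule integrable_bounded_support[where C="\<bar>C\<bar>" and R="\<bar>r\<bar>"])
  show "(\<lambda>t. indicator {0..r} t * f t) \<in> borel_measurable borel"
    using assms(1) by measurable
  show "norm (indicator {0..r} t * f t) \<le> \<bar>C\<bar>" for t
    using assms(2)[of t] by (auto simp: indicator_def)
  show "indicator {0..r} t * f t = 0" if "\<bar>r\<bar> < norm t" for t using that by (auto simp: indicator_def)
qed

text \<open>Weak times strong: with \<open>h j = h0 + (h j - h0)\<close>, the first part is weak
  convergence against a fixed integrable function, and the second tends to \<open>0\<close> because
  \<open>dg j\<close> is bounded and \<open>h j\<close> tends to \<open>h0\<close> in
  \<open>L^1\<close> of the interval.\<close>

lemma (in radial_approx) tendsto_integral_dg_mult: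
  assumes r: "0 \<le> r" and [measurable]: "\<And>j. h j \<in> borel_measurable borel" "h0 \<in> borel_measurable borel"
    and h: "\<And>j t. 0 \<le> t \<Longrightarrow> t \<le> r \<Longrightarrow> \<bar>h j t\<bar> \<le> C"
    and lim: "\<And>t. 0 \<le> t \<Longrightarrow> (\<lambda>j. h j t) \<longlonglongrightarrow> h0 t"
  shows "(\<lambda>j. LBINT t:{0..r}. dg j t * h j t) \<longlonglongrightarrow> (LBINT t:{0..r}. dg0 t * h0 t)"
proof -
  have h0: "\<bar>h0 t\<bar> \<le> C" if "0 \<le> t" "t \<le> r" for t
    by (rule LIMSEQ_le_const2[OF tendsto_rabs[OF lim]]) (use that h in auto)
  have C0: "0 \<le> C" using h0[of 0] r by simp
  define \<psi> where "\<psi> t = indicator {0..r} t * h0 t" for t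
  have \<psi>i: "integrable lborel \<psi>" unfolding \<psi>_def by (rule integrable_Icc_bounded) (use h0 in auto)
  have [measurable]: "\<psi> \<in> borel_measurable borel" using \<psi>i by auto
  \<comment> \<open>The statement for the space is used on the real line, where \<open>norm\<close>
    is the absolute value. Since \<open>\<psi>\<close> vanishes off \<open>[0,r]\<close>, negative
    arguments contribute nothing.\<close>
  have "(\<lambda>j. \<integral>x. dg j (norm x) * \<psi> x \<partial>lebesgue) \<longlonglongrightarrow> (LINT x|lebesgue. dg0 (norm x) * \<psi> x)"
  proof (rule weak_radial[where R=r])
    show "integrable lebesgue \<psi>" using \<psi>i by (simp add: integrable_completion)
  qed (use r in \<open>auto simp: \<psi>_def indicator_def\<close>)
  moreover have "(LINT x|lebesgue. d (norm x) * \<psi> x) = (LBINT t:{0..r}. d t * h0 t)"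
    if [measurable]: "d \<in> borel_measurable borel" for d :: "real \<Rightarrow> real"
  proof -
    have "(LINT x|lebesgue. d (norm x) * \<psi> x) = (LBINT x. d (norm x) * \<psi> x)"
      by (rule integral_completion) measurable
    also have "\<dots> = (LBINT t:{0..r}. d t * h0 t)"
      unfolding set_lebesgue_integral_def \<psi>_def
      by (rule Bochner_Integration.integral_cong) (auto simp: indicator_def)
    finally show ?thesis .
  qed
  ultimately have L1: "(\<lambda>j. LBINT t:{0..r}. dg j t * h0 t) \<longlonglongrightarrow> (LBINT t:{0..r}. dg0 t * h0 t)"
    by simp
  have e: "(\<lambda>j. \<integral>t. indicator {0..r} t * \<bar>h j t - h0 t\<bar> \<partial>lborel) \<longlonglongrightarrow> integral\<^sup>L lborel (\<lambda>t::real. 0)"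
  proof (rule integral_dominated_convergence[where w="\<lambda>t. indicator {0..r} t * (2 * C)"])
    show "integrable lborel (\<lambda>t. indicator {0..r} t * (2 * C))"
      by (rule integrable_Icc_bounded) auto
    show "AE t in lborel. (\<lambda>j. indicator {0..r} t * \<bar>h j t - h0 t\<bar>) \<longlonglongrightarrow> 0"
    proof (rule AE_I2)
      fix t :: real
      show "(\<lambda>j. indicator {0..r} t * \<bar>h j t - h0 t\<bar>) \<longlonglongrightarrow> 0"
      proof (cases "t \<in> {0..r}")
        case True
        have "(\<lambda>j. \<bar>h j t - h0 t\<bar>) \<longlonglongrightarrow> \<bar>h0 t - h0 t\<bar>" using True by (intro tendsto_intros lim) auto
        then show ?thesis using True by simp
      qed simp
    qed
    show "AE t in lborel. norm (indicator {0..r} t * \<bar>h j t - h0 t\<bar>) \<le> indicator {0..r} t * (2 * C)" for j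
    proof (rule AE_I2)
      fix t show "norm (indicator {0..r} t * \<bar>h j t - h0 t\<bar>) \<le> indicator {0..r} t * (2 * C)"
        using h[of t j] h0[of t] by (auto simp: indicator_def)
    qed
  qed measurable
  have L2: "(\<lambda>j. LBINT t:{0..r}. dg j t * (h j t - h0 t)) \<longlonglongrightarrow> 0"
  proof (rule Lim_null_comparison)
    show "(\<lambda>j. B r * (LBINT t. indicator {0..r} t * \<bar>h j t - h0 t\<bar>)) \<longlonglongrightarrow> 0"
      using tendsto_mult_left[OF e, of "B r"] by simp
    show "\<forall>\<^sub>F j in sequentially. norm (LBINT t:{0..r}. dg j t * (h j t - h0 t)) \<le>
        B r * (LBINT t. indicator {0..r} t * \<bar>h j t - h0 t\<bar>)"
    proof (rule always_eventually, rule allI)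
      fix j
      have i1: "integrable lborel (\<lambda>t. indicator {0..r} t * (dg j t * (h j t - h0 t)))"
      proof (rule integrable_Icc_bounded[where C="B r * (2 * C)"])
        show "\<bar>dg j t * (h j t - h0 t)\<bar> \<le> B r * (2 * C)" if "0 \<le> t" "t \<le> r" for t
          unfolding abs_mult using that h[of t j] h0[of t] B_nonneg[OF r] by (intro mult_mono dg_bound) auto
      qed measurable
      have "norm (LBINT t:{0..r}. dg j t * (h j t - h0 t)) \<le> (LBINT t. norm (indicator {0..r} t * (dg j t * (h j t - h0 t))))"
        unfolding set_lebesgue_integral_def real_scaleR_def by (rule integral_norm_bound)
      also have "\<dots> \<le> (LBINT t. B r * (indicator {0..r} t * \<bar>h j t - h0 t\<bar>))"
      proof (rule integral_mono)
        show "integrable lborel (\<lambda>t. norm (indicator {0..r} t * (dg j t * (h j t - h0 t))))" using i1 by simp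
        show "integrable lborel (\<lambda>t. B r * (indicator {0..r} t * \<bar>h j t - h0 t\<bar>))"
        proof (intro integrable_mult_right integrable_Icc_bounded[where C="2 * C"])
          show "\<bar>\<bar>h j t - h0 t\<bar>\<bar> \<le> 2 * C" if "0 \<le> t" "t \<le> r" for t
            using that h[of t j] h0[of t] by auto
        qed measurable
        fix t show "norm (indicator {0..r} t * (dg j t * (h j t - h0 t))) \<le> B r * (indicator {0..r} t * \<bar>h j t - h0 t\<bar>)"
          using dg_bound[of t r j] by (auto simp: indicator_def abs_mult intro!: mult_right_mono)
      qed
      finally show "norm (LBINT t:{0..r}. dg j t * (h j t - h0 t)) \<le>
        B r * (LBINT t. indicator {0..r} t * \<bar>h j t - h0 t\<bar>)" by simp
    qed
  qed
  have "(LBINT t:{0..r}. dg j t * h j t) = (LBINT t:{0..r}. dg j t * h0 t) + (LBINT t:{0..r}. dg j t * (h j t - h0 t))" for j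
  proof -
    have "set_integrable lborel {0..r} (\<lambda>t. dg j t * h0 t)" unfolding set_integrable_def real_scaleR_def
      by (rule integrable_Icc_bounded[where C="B r * C"])
         (use h0 B_nonneg[OF r] in \<open>auto simp: abs_mult intro!: mult_mono dg_bound\<close>)
    moreover have "set_integrable lborel {0..r} (\<lambda>t. dg j t * (h j t - h0 t))" unfolding set_integrable_def real_scaleR_def
    proof (rule integrable_Icc_bounded[where C="B r * (2 * C)"])
      show "\<bar>dg j t * (h j t - h0 t)\<bar> \<le> B r * (2 * C)" if "0 \<le> t" "t \<le> r" for t
        unfolding abs_mult using that h[of t j] h0[of t] B_nonneg[OF r] by (intro mult_mono dg_bound) auto
    qed measurable
    ultimately show ?thesis by (subst set_integral_add(2)[symmetric]) (auto simp: algebra_simps)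
  qed
  then show ?thesis using tendsto_add[OF L1 L2] by simp
qed

text \<open>The product rule survives in the limit because each of its two terms pairs a weakly
  convergent derivative with a pointwise convergent bounded factor. The \<open>2\<close> in the new
  bound counts these terms.\<close>

lemma radial_approx_mult:
  assumes "radial_approx g dg g0 dg0 B" "radial_approx h dh h0 dh0 B'"
  shows "radial_approx (\<lambda>j r. g j r * h j r) (\<lambda>j r. dg j r * h j r + g j r * dh j r)
    (\<lambda>r. g0 r * h0 r) (\<lambda>r. dg0 r * h0 r + g0 r * dh0 r) (\<lambda>R. 2 * (B R * B' R))"
proof -
  interpret g: radial_approx g dg g0 dg0 B by fact
  interpret h: radial_approx h dh h0 dh0 B' by fact
  have bb: "\<bar>a * b\<bar> \<le> B R * B' R" if "\<bar>a\<bar> \<le> B R" "\<bar>b\<bar> \<le> B' R" "0 \<le> R" for a b R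
    unfolding abs_mult using that g.B_nonneg by (intro mult_mono) auto
  have bn: "0 \<le> B R * B' R" if "0 \<le> R" for R using that g.B_nonneg h.B_nonneg by simp
  have bs: "\<bar>a * b + a' * b'\<bar> \<le> 2 * (B R * B' R)"
    if "\<bar>a\<bar> \<le> B R" "\<bar>b\<bar> \<le> B' R" "\<bar>a'\<bar> \<le> B R" "\<bar>b'\<bar> \<le> B' R" "0 \<le> R" for a b a' b' R
    using bb[of a R b] bb[of a' R b'] that by (intro order_trans[OF abs_triangle_ineq]) auto
  show ?thesis
  proof
    show "\<bar>g j r * h j r\<bar> \<le> 2 * (B R * B' R)" if "0 \<le> r" "r \<le> R" for j r R
      using bb[of "g j r" R "h j r"] g.g_bound[OF that] h.g_bound[OF that] bn[of R] that by fastforce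
    show "\<bar>dg j r * h j r + g j r * dh j r\<bar> \<le> 2 * (B R * B' R)" if "0 \<le> r" "r \<le> R" for j r R
      using that by (intro bs g.g_bound h.g_bound g.dg_bound h.dg_bound) auto
    show "\<bar>dg0 r * h0 r + g0 r * dh0 r\<bar> \<le> 2 * (B R * B' R)" if "0 \<le> r" "r \<le> R" for r R
      using that by (intro bs g.g0_bound h.g0_bound g.dg0_bound h.dg0_bound) auto
    show "continuous_on {0..} (\<lambda>r. g j r * h j r)" for j by (intro continuous_intros g.g_cont h.g_cont)
    show deriv: "((\<lambda>r. g j r * h j r) has_real_derivative dg j r * h j r + g j r * dh j r) (at r)" if "0 < r" for j r
      using DERIV_mult[OF g.g_deriv[OF that, of j] h.g_deriv[OF that, of j]] by (simp add: mult.commute)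
    show lim: "(\<lambda>j. g j r * h j r) \<longlonglongrightarrow> g0 r * h0 r" if "0 \<le> r" for r
      by (intro tendsto_mult g.g_lim h.g_lim that)
    fix r :: real assume r: "0 \<le> r"
    have si: "set_integrable lborel {0..r} (\<lambda>t. a t * b t)"
      if "\<And>t. 0 \<le> t \<Longrightarrow> t \<le> r \<Longrightarrow> \<bar>a t\<bar> \<le> B r" "\<And>t. 0 \<le> t \<Longrightarrow> t \<le> r \<Longrightarrow> \<bar>b t\<bar> \<le> B' r"
        and [measurable]: "a \<in> borel_measurable borel" "b \<in> borel_measurable borel" for a b
      unfolding set_integrable_def real_scaleR_def
      by (rule integrable_Icc_bounded[where C="B r * B' r"]) (use that bb r in auto)
    have "g j r * h j r - g j 0 * h j 0 = (LBINT t:{0..r}. dg j t * h j t) + (LBINT t:{0..r}. dh j t * g j t)" for j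
    proof -
      have s: "set_integrable lborel {0..r} (\<lambda>t. dg j t * h j t)" "set_integrable lborel {0..r} (\<lambda>t. g j t * dh j t)"
        by (auto intro!: si g.g_bound h.g_bound g.dg_bound h.dg_bound)
      have "continuous_on {0..} (\<lambda>r. g j r * h j r)" by (intro continuous_on_mult g.g_cont h.g_cont)
      then have "(LBINT t:{0..r}. dg j t * h j t + g j t * dh j t) = g j r * h j r - g j 0 * h j 0"
        using r by (intro set_integral_derivative[where C="2 * (B r * B' r)"])
          (auto intro: continuous_on_subset deriv intro!: bs g.g_bound h.g_bound g.dg_bound h.dg_bound)
      then show ?thesis using set_integral_add(2)[OF s] by (simp add: mult.commute)
    qed
    moreover have "(\<lambda>j. (LBINT t:{0..r}. dg j t * h j t) + (LBINT t:{0..r}. dh j t * g j t)) \<longlonglongrightarrow>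
        (LBINT t:{0..r}. dg0 t * h0 t) + (LBINT t:{0..r}. dh0 t * g0 t)"
      by (intro tendsto_add g.tendsto_integral_dg_mult[OF r] h.tendsto_integral_dg_mult[OF r])
         (auto intro: g.g_lim h.g_lim g.g_bound h.g_bound)
    moreover have "(\<lambda>j. g j r * h j r - g j 0 * h j 0) \<longlonglongrightarrow> g0 r * h0 r - g0 0 * h0 0"
      using r by (intro tendsto_diff lim) auto
    ultimately have "g0 r * h0 r - g0 0 * h0 0 = (LBINT t:{0..r}. dg0 t * h0 t) + (LBINT t:{0..r}. dh0 t * g0 t)"
      by (metis (no_types, lifting) LIMSEQ_unique ext)
    also have "\<dots> = (LBINT t:{0..r}. dg0 t * h0 t + g0 t * dh0 t)"
    proof -
      have s: "set_integrable lborel {0..r} (\<lambda>t. dg0 t * h0 t)" "set_integrable lborel {0..r} (\<lambda>t. g0 t * dh0 t)"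
        by (auto intro!: si g.g0_bound h.g0_bound g.dg0_bound h.dg0_bound)
      show ?thesis using set_integral_add(2)[OF s] by (simp add: mult.commute)
    qed
    finally show "g0 r * h0 r - g0 0 * h0 0 = (LBINT t:{0..r}. dg0 t * h0 t + g0 t * dh0 t)" .
  qed measurable
qed

text \<open>With \<open>d\<close> the divergence of \<open>z\<close>, the relation
  \<open>dv0 * G0 = dv0\<close> makes \<open>dv0 - v0 * d\<close> the divergence of the field with
  profile \<open>v0 * G0\<close>. Testing with \<open>\<zeta>\<close> leaves the density
  \<open>- dv0\<close> for the pairing, and this is the norm of the gradient because
  \<open>dv0 \<le> 0\<close>.\<close>

lemma pairing_eq_total_variation_radial:
  assumes V: "radial_approx v dv v0 dv0 B" and G: "radial_approx G dG G0 dG0 B'"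
    and G_zero: "\<And>j. G j 0 = 0" and dv0: "\<And>r. 0 \<le> r \<Longrightarrow> dv0 r \<le> 0" "\<And>r. 0 \<le> r \<Longrightarrow> - C \<le> dv0 r"
    and dv0_G0: "\<And>r. 0 \<le> r \<Longrightarrow> dv0 r * G0 r = dv0 r"
  shows "pairing_eq_total_variation (\<lambda>x::'a::euclidean_space. - (G0 (norm x) *\<^sub>R sgn x)) (\<lambda>x. v0 (norm x))"
proof -
  interpret V: radial_approx v dv v0 dv0 B by fact
  interpret G: radial_approx G dG G0 dG0 B' by fact
  interpret VG: radial_approx "\<lambda>j r. v j r * G j r" "\<lambda>j r. dv j r * G j r + v j r * dG j r"
    "\<lambda>r. v0 r * G0 r" "\<lambda>r. dv0 r * G0 r + v0 r * dG0 r" "\<lambda>R. 2 * (B R * B' R)"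
    by (rule radial_approx_mult[OF V G])
  interpret N: radial_approx "\<lambda>j r. - G j r" "\<lambda>j r. - dG j r" "\<lambda>r. - G0 r" "\<lambda>r. - dG0 r" B'
    by (rule G.radial_approx_uminus)
  define Du where "Du x = dv0 (norm x) *\<^sub>R sgn x" for x :: 'a
  define d where "d x = - (dG0 (norm x) + (real DIM('a) - 1) / norm x * G0 (norm x))" for x :: 'a
  have [measurable]: "Du \<in> borel_measurable borel" "d \<in> borel_measurable borel" unfolding Du_def d_def by measurable
  \<comment> \<open>The factor \<open>norm (sgn x)\<close> is \<open>1\<close> except at the origin,
    where it is \<open>0\<close>; keeping it makes the identity valid everywhere.\<close>
  have nDu: "norm (Du x) = - dv0 (norm x) * norm (sgn x)" for x
    using dv0(1)[of "norm x"] by (simp add: Du_def)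
  have C0: "0 \<le> C" using dv0[of 0] by linarith
  have DuC: "norm (Du x) \<le> C" for x
    unfolding nDu using dv0[of "norm x"] norm_sgn_le_1[of x] C0 mult_mono[of "- dv0 (norm x)" C "norm (sgn x)" 1] by simp
  define D where "D b = (density lborel (\<lambda>x. ennreal (Du x \<bullet> b)), density lborel (\<lambda>x. ennreal (- (Du x \<bullet> b))))" for b
  define \<mu> where "\<mu> = density lborel (\<lambda>x. ennreal (norm (Du x)))"
  \<comment> \<open>The pairing turns out to be a positive measure, so the subtracted component is
    the zero measure.\<close>
  define \<nu> where "\<nu> = (\<mu>, density lborel (\<lambda>_::'a. ennreal 0))"
  have tv: "is_total_variation D \<mu>"
    unfolding D_def \<mu>_def by (rule is_total_variation_density[OF _ DuC]) measurable
  have radon_dens: "radon (density lborel (\<lambda>x. ennreal (k x)))"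
    if [measurable]: "k \<in> borel_measurable borel" and k: "\<And>x. k x \<le> C" for k :: "'a \<Rightarrow> real"
    unfolding radon_def
  proof (intro conjI allI impI)
    fix K :: "'a set" assume K: "compact K"
    then have [measurable]: "K \<in> sets borel" by (simp add: compact_imp_closed borel_closed)
    have "emeasure (density lborel (\<lambda>x. ennreal (k x))) K = (\<integral>\<^sup>+x. ennreal (k x) * indicator K x \<partial>lborel)"
      by (rule emeasure_density) auto
    also have "\<dots> \<le> (\<integral>\<^sup>+x. ennreal C * indicator K x \<partial>lborel)"
      by (intro nn_integral_mono mult_right_mono ennreal_leI k) auto
    also have "\<dots> = ennreal C * emeasure lborel K" by (simp add: nn_integral_cmult_indicator)
    also have "\<dots> < \<infinity>"
      using emeasure_bounded_finite[OF compact_imp_bounded[OF K]] by (simp add: ennreal_mult_less_top)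
    finally show "emeasure (density lborel (\<lambda>x. ennreal (k x))) K < \<infinity>" .
  qed simp
  have sint: "integral\<^sup>L (density lborel (\<lambda>x. ennreal (k x))) \<zeta> = (LBINT x. max 0 (k x) * \<zeta> x)"
    if [measurable]: "k \<in> borel_measurable borel" "\<zeta> \<in> borel_measurable borel" for k \<zeta> :: "'a \<Rightarrow> real"
  proof -
    have "integral\<^sup>L (density lborel (\<lambda>x. ennreal (max 0 (k x)))) \<zeta> = (LBINT x. max 0 (k x) *\<^sub>R \<zeta> x)"
      by (rule integral_density) auto
    moreover have "(\<lambda>x. ennreal (max 0 (k x))) = (\<lambda>x. ennreal (k x))"
      by (auto simp: fun_eq_iff max_def ennreal_neg)
    ultimately show ?thesis by simp
  qed
  have Dub: "\<bar>Du x \<bullet> b\<bar> \<le> C" if "b \<in> Basis" for b x using Basis_le_norm[OF that, of "Du x"] DuC[of x] by linarith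
  have grad: "has_weak_grad UNIV (\<lambda>x::'a. v0 (norm x)) Du"
    using V.radial_weak_grad[where 'a='a] unfolding Du_def .
  have D: "has_measure_derivative (\<lambda>x. v0 (norm x)) D"
    unfolding has_measure_derivative_def
  proof (intro conjI allI impI ballI)
    fix b :: 'a assume b: "b \<in> Basis"
    show "signed_radon (D b)"
      unfolding signed_radon_def D_def fst_conv snd_conv
      using Dub[OF b] by (intro conjI radon_dens) (auto intro: order_trans[OF abs_ge_self] order_trans[OF abs_ge_minus_self])
    fix \<zeta> :: "'a \<Rightarrow> real" assume \<zeta>: "test_function UNIV \<zeta>"
    note [measurable] = bounded_supp_test(1)[OF \<zeta>, THEN bounded_supp_borel]
    have i: "integrable lborel (\<lambda>x. max 0 (k x) * \<zeta> x)"
      if "k \<in> borel_measurable borel" "\<And>x. \<bar>k x\<bar> \<le> C" for k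
      by (rule bounded_supp_integrable[OF bounded_supp_test(1)[OF \<zeta>]])
         (use that C0 in \<open>auto simp: max_def intro!: exI[of _ C] intro: order_trans[OF abs_ge_self]\<close>)
    have "signed_integral (D b) \<zeta> = (LBINT x. max 0 (Du x \<bullet> b) * \<zeta> x) - (LBINT x. max 0 (- (Du x \<bullet> b)) * \<zeta> x)"
      unfolding signed_integral_def D_def fst_conv snd_conv by (simp add: sint)
    also have "\<dots> = (LBINT x. max 0 (Du x \<bullet> b) * \<zeta> x - max 0 (- (Du x \<bullet> b)) * \<zeta> x)"
      using Dub[OF b] by (intro Bochner_Integration.integral_diff[symmetric] i) auto
    also have "\<dots> = (LBINT x. (Du x \<bullet> b) * \<zeta> x)"
      by (rule Bochner_Integration.integral_cong) (auto simp: max_def)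
    also have "\<dots> = (LINT x|lebesgue. (Du x \<bullet> b) * \<zeta> x)"
      by (rule integral_completion[symmetric]) measurable
    finally show "(LINT x|lebesgue. v0 (norm x) * (grad \<zeta> x \<bullet> b)) = - signed_integral (D b) \<zeta>"
      using grad \<zeta> b unfolding has_weak_grad_def by (simp add: set_lebesgue_integral_def)
  qed
  have vl: "\<exists>C. \<forall>x::'a. norm x \<le> R \<longrightarrow> \<bar>v0 (norm x)\<bar> \<le> C" for R by (rule V.radial_bounds)
  have dl: "\<exists>C. \<forall>x. norm x \<le> R \<longrightarrow> \<bar>d x\<bar> \<le> C" for R
    unfolding d_def abs_minus_cancel using G.radial_div_bound[OF G_zero] by blast
  have zl: "\<exists>C. \<forall>x::'a. norm x \<le> R \<longrightarrow> norm (- (G0 (norm x) *\<^sub>R sgn x)) \<le> C" for R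
    unfolding norm_minus_cancel using G.radial_field_bound by blast
  have div: "has_weak_div UNIV (\<lambda>x::'a. - (G0 (norm x) *\<^sub>R sgn x)) d"
  proof -
    have "has_weak_div UNIV (\<lambda>x::'a. (- G0 (norm x)) *\<^sub>R sgn x)
       (\<lambda>x. - dG0 (norm x) + (real DIM('a) - 1) / norm x * (- G0 (norm x)))"
      by (rule N.radial_field_weak_div) (simp add: G_zero)
    moreover have "(\<lambda>x::'a. - dG0 (norm x) + (real DIM('a) - 1) / norm x * (- G0 (norm x))) = d"
      by (auto simp: fun_eq_iff d_def)
    ultimately show ?thesis by simp
  qed
  have anz: "is_anzellotti_pairing (\<lambda>x. - (G0 (norm x) *\<^sub>R sgn x)) (\<lambda>x. v0 (norm x)) \<nu>"
    unfolding is_anzellotti_pairing_def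
  proof (intro conjI exI[of _ d] allI impI)
    show "Linf_loc UNIV (\<lambda>x::'a. - (G0 (norm x) *\<^sub>R sgn x))" by (rule Linf_loc_bounded[OF _ zl]) measurable
    show "Linf_loc UNIV (\<lambda>x::'a. v0 (norm x))" by (rule Linf_loc_bounded) (use vl in auto)
    show "Linf_loc UNIV d" by (rule Linf_loc_bounded) (use dl in auto)
    show "BV_loc (\<lambda>x::'a. v0 (norm x))" unfolding BV_loc_def
      using D by (auto intro!: L1_loc_bounded simp: vl)
    show "signed_radon \<nu>"
      unfolding signed_radon_def \<nu>_def \<mu>_def fst_conv snd_conv
      using DuC C0 by (intro conjI radon_dens) auto
    show "has_weak_div UNIV (\<lambda>x::'a. - (G0 (norm x) *\<^sub>R sgn x)) d" by (rule div)
    fix \<zeta> :: "'a \<Rightarrow> real" assume \<zeta>: "test_function UNIV \<zeta>"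
    note [measurable] = bounded_supp_test(1)[OF \<zeta>, THEN bounded_supp_borel]
    have "has_weak_div UNIV (\<lambda>x::'a. (v0 (norm x) * G0 (norm x)) *\<^sub>R sgn x)
       (\<lambda>x. dv0 (norm x) * G0 (norm x) + v0 (norm x) * dG0 (norm x) + (real DIM('a) - 1) / norm x * (v0 (norm x) * G0 (norm x)))"
      by (rule VG.radial_field_weak_div) (simp add: G_zero)
    moreover have "(\<lambda>x::'a. dv0 (norm x) * G0 (norm x) + v0 (norm x) * dG0 (norm x) + (real DIM('a) - 1) / norm x * (v0 (norm x) * G0 (norm x)))
       = (\<lambda>x. dv0 (norm x) - v0 (norm x) * d x)"
    proof
      fix x :: 'a
      have "dv0 (norm x) * G0 (norm x) = dv0 (norm x)" by (rule dv0_G0) simp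
      then show "dv0 (norm x) * G0 (norm x) + v0 (norm x) * dG0 (norm x) + (real DIM('a) - 1) / norm x * (v0 (norm x) * G0 (norm x))
          = dv0 (norm x) - v0 (norm x) * d x"
        by (simp only:) (simp add: d_def algebra_simps)
    qed
    ultimately have "has_weak_div UNIV (\<lambda>x::'a. (v0 (norm x) * G0 (norm x)) *\<^sub>R sgn x) (\<lambda>x. dv0 (norm x) - v0 (norm x) * d x)"
      by simp
    then have "(LINT x|lebesgue. ((v0 (norm x) * G0 (norm x)) *\<^sub>R sgn x) \<bullet> grad \<zeta> x) = - (LINT x|lebesgue. (dv0 (norm x) - v0 (norm x) * d x) * \<zeta> x)"
      using \<zeta> unfolding has_weak_div_def by (simp add: set_lebesgue_integral_def)
    moreover have "(LINT x|lebesgue. ((v0 (norm x) * G0 (norm x)) *\<^sub>R sgn x) \<bullet> grad \<zeta> x) =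
        - (LINT x|lebesgue. v0 (norm x) * ((- (G0 (norm x) *\<^sub>R sgn x)) \<bullet> grad \<zeta> x))"
      by (simp add: mult.assoc)
    moreover have "(LINT x|lebesgue. (dv0 (norm x) - v0 (norm x) * d x) * \<zeta> x) =
        (LBINT x. dv0 (norm x) * \<zeta> x) - (LINT x|lebesgue. v0 (norm x) * \<zeta> x * d x)"
    proof -
      have i1: "integrable lborel (\<lambda>x. dv0 (norm x) * \<zeta> x)"
        by (rule bounded_supp_integrable[OF bounded_supp_test(1)[OF \<zeta>]]) (use V.radial_bounds(2) in auto)
      have i2: "integrable lborel (\<lambda>x. v0 (norm x) * d x * \<zeta> x)"
      proof (rule bounded_supp_integrable[OF bounded_supp_test(1)[OF \<zeta>]])
        show "\<exists>C. \<forall>x. norm x \<le> R \<longrightarrow> \<bar>v0 (norm x) * d x\<bar> \<le> C" for R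
        proof -
          obtain C1 C2 where "\<And>x::'a. norm x \<le> R \<Longrightarrow> \<bar>v0 (norm x)\<bar> \<le> C1" "\<And>x. norm x \<le> R \<Longrightarrow> \<bar>d x\<bar> \<le> C2"
            using vl[of R] dl[of R] by blast
          then have "\<bar>v0 (norm x) * d x\<bar> \<le> C1 * C2" if "norm x \<le> R" for x
            unfolding abs_mult using that by (intro mult_mono) (auto intro: order_trans[OF abs_ge_zero])
          then show ?thesis by blast
        qed
      qed measurable
      have "(LINT x|lebesgue. (dv0 (norm x) - v0 (norm x) * d x) * \<zeta> x) = (LBINT x. dv0 (norm x) * \<zeta> x - v0 (norm x) * d x * \<zeta> x)"
        by (subst integral_completion) (auto simp: algebra_simps)
      also have "\<dots> = (LBINT x. dv0 (norm x) * \<zeta> x) - (LBINT x. v0 (norm x) * d x * \<zeta> x)"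
        by (rule Bochner_Integration.integral_diff[OF i1 i2])
      also have "(LBINT x. v0 (norm x) * d x * \<zeta> x) = (LINT x|lebesgue. v0 (norm x) * \<zeta> x * d x)"
        by (subst integral_completion) (auto simp: ac_simps)
      finally show ?thesis .
    qed
    moreover have "signed_integral \<nu> \<zeta> = - (LBINT x. dv0 (norm x) * \<zeta> x)"
    proof -
      have "integral\<^sup>L (density lborel (\<lambda>x. ennreal (norm (Du x)))) \<zeta> = (LBINT x. norm (Du x) * \<zeta> x)"
        using sint[of "\<lambda>x. norm (Du x)" \<zeta>] by simp
      also have "\<dots> = (LBINT x. - (dv0 (norm x) * \<zeta> x))"
      proof (rule integral_cong_AE)
        show "AE x in lborel. norm (Du x) * \<zeta> x = - (dv0 (norm x) * \<zeta> x)"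
          using AE_lborel_singleton[of "0::'a"] by eventually_elim (simp add: nDu norm_sgn)
      qed measurable
      moreover have "integral\<^sup>L (density lborel (\<lambda>_::'a. ennreal 0)) \<zeta> = 0"
        using sint[of "\<lambda>_. 0" \<zeta>] by simp
      ultimately show ?thesis unfolding signed_integral_def \<nu>_def \<mu>_def by simp
    qed
    ultimately show "signed_integral \<nu> \<zeta> = - (LINT x|lebesgue. v0 (norm x) * \<zeta> x * d x) -
        (LINT x|lebesgue. v0 (norm x) * ((- (G0 (norm x) *\<^sub>R sgn x)) \<bullet> grad \<zeta> x))"
      by linarith
  qed
  have "signed_value \<nu> A = measure \<mu> A" if "A \<in> sets borel" for A
    using that by (simp add: signed_value_def \<nu>_def measure_def emeasure_density)
  then show ?thesis unfolding pairing_eq_total_variation_def using anz D tv by blast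
qed

section \<open>Radial solutions for a fixed exponent\<close>

lemma holder_loc_continuous_on:
  fixes S :: "'a::heine_borel set"
  assumes "holder_loc \<alpha> S f" "0 < \<alpha>" "closed S"
  shows "continuous_on S f"
  unfolding continuous_on_def
proof
  fix x assume x: "x \<in> S"
  have "compact (S \<inter> cball x 1)" using assms(3) by (simp add: closed_Int_compact)
  then obtain C where C: "\<And>y z. y \<in> S \<inter> cball x 1 \<Longrightarrow> z \<in> S \<inter> cball x 1 \<Longrightarrow> dist (f y) (f z) \<le> C * dist y z powr \<alpha>"
    using assms(1) unfolding holder_loc_def by (metis Int_lower1)
  show "(f \<longlongrightarrow> f x) (at x within S)"
  proof (rule metric_tendsto_imp_tendsto[where f="\<lambda>y. C * dist y x powr \<alpha>" and a=0])
    have "((\<lambda>y. dist y x) \<longlongrightarrow> 0) (at x within S)" by (rule tendsto_dist_iff[THEN iffD1]) (rule tendsto_ident_at)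
    then have "((\<lambda>y. C * dist y x powr \<alpha>) \<longlongrightarrow> C * 0 powr \<alpha>) (at x within S)"
      using assms(2) by (intro tendsto_intros tendsto_powr2) auto
    then show "((\<lambda>y. C * dist y x powr \<alpha>) \<longlongrightarrow> 0) (at x within S)" using assms(2) by simp
    have "\<forall>\<^sub>F y in at x within S. y \<in> S \<inter> cball x 1"
      unfolding eventually_at by (intro exI[of _ 1]) (auto simp: dist_commute)
    then show "\<forall>\<^sub>F y in at x within S. dist (f y) (f x) \<le> dist (C * dist y x powr \<alpha>) 0"
    proof eventually_elim
      case (elim y)
      have "dist (f y) (f x) \<le> C * dist y x powr \<alpha>" using x by (intro C elim) auto
      then show ?case by (simp add: dist_real_def)
    qed
  qed
qed

lemma set_integral_Icc_continuous:
  fixes f :: "real \<Rightarrow> real"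
  assumes "continuous_on {a..b} f"
  shows "(LBINT t:{a..b}. f t) = integral {a..b} f"
  by (rule set_borel_integral_eq_integral(2)[OF borel_integrable_atLeastAtMost'[OF assms]])

lemma has_real_derivative_integral_half_line:
  fixes f :: "real \<Rightarrow> real"
  assumes f: "continuous_on {0..} f" and r: "0 \<le> r"
  shows "((\<lambda>r. LBINT t:{0..r}. f t) has_real_derivative f r) (at r within {0..})"
proof -
  have "((\<lambda>x. integral {0..x} f) has_real_derivative f r) (at r within {0..r+1})"
    using r by (intro integral_has_real_derivative continuous_on_subset[OF f]) auto
  moreover have "at r within {0..r+1} = at r within {0..}"
    by (rule at_within_nhd[where S="{..<r+1}"]) auto
  ultimately have "((\<lambda>x. integral {0..x} f) has_real_derivative f r) (at r within {0..})" by simp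
  then show ?thesis unfolding has_field_derivative_def
  proof (rule has_derivative_transform[rotated 2])
    show "(LBINT t:{0..x}. f t) = integral {0..x} f" if "x \<in> {0..}" for x
      by (rule set_integral_Icc_continuous[OF continuous_on_subset[OF f]]) auto
  qed (use r in auto)
qed

lemma at_half_line_neq_bot: "0 \<le> r \<Longrightarrow> at (r::real) within {0..} \<noteq> bot"
proof
  assume "0 \<le> r" "at r within {0..} = bot"
  have "{r<..} \<subseteq> {0..}" using \<open>0 \<le> r\<close> by auto
  from at_le[OF this, of r] have "at_right r \<le> bot" using \<open>at r within {0..} = bot\<close> by simp
  then show False using trivial_limit_at_right_real[of r] by (simp add: bot_unique)
qed

text \<open>The upper bound is the flux of the constant \<open>C\<close>. Its linear decay at
  \<open>0\<close> offsets every factor \<open>1 / r\<close> later on, gives continuity at the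
  origin, and keeps the flux away from \<open>1\<close> on a fixed ball.\<close>

lemma flux_bounds:
  assumes k: "continuous_on {0..} k" and n: "0 < n" and s: "0 \<le> s"
    and b: "\<And>t. 0 \<le> t \<Longrightarrow> t \<le> s \<Longrightarrow> 0 \<le> k t \<and> k t \<le> C"
  shows "0 \<le> flux n k s" "flux n k s \<le> C * s / real n"
proof -
  have c: "continuous_on {0..s} (\<lambda>t. t ^ (n - 1) * k t)"
    by (intro continuous_intros continuous_on_subset[OF k]) auto
  have e: "(LBINT t:{0..s}. t ^ (n - 1) * k t) = integral {0..s} (\<lambda>t. t ^ (n - 1) * k t)"
    by (rule set_integral_Icc_continuous[OF c])
  have "0 \<le> integral {0..s} (\<lambda>t. t ^ (n - 1) * k t)"
    by (rule integral_nonneg[OF integrable_continuous_interval[OF c]]) (use b in auto)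
  then show "0 \<le> flux n k s" unfolding flux_def e by simp
  have "integral {0..s} (\<lambda>t. t ^ (n - 1) * k t) \<le> integral {0..s} (\<lambda>t. t ^ (n - 1) * C)"
    by (rule integral_le) (use b c in \<open>auto intro!: integrable_continuous_interval continuous_intros mult_left_mono\<close>)
  also have "\<dots> = C / n * s ^ n - C / n * 0 ^ n"
  proof (rule integral_unique, rule fundamental_theorem_of_calculus[OF s])
    fix t :: real
    have "((\<lambda>t. C / n * t ^ n) has_real_derivative t ^ (n - 1) * C) (at t within {0..s})"
      using n by (auto intro!: derivative_eq_intros)
    then show "((\<lambda>t. C / n * t ^ n) has_vector_derivative t ^ (n - 1) * C) (at t within {0..s})"
      by (simp add: has_real_derivative_iff_has_vector_derivative)
  qed
  finally have le: "integral {0..s} (\<lambda>t. t ^ (n - 1) * k t) \<le> C / n * s ^ n" using n by (simp add: zero_power)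
  show "flux n k s \<le> C * s / real n"
  proof (cases "s = 0")
    case False
    then have s0: "0 < s" using s by simp
    have "flux n k s = s powr (1 - real n) * integral {0..s} (\<lambda>t. t ^ (n - 1) * k t)"
      unfolding flux_def e using False by simp
    also have "\<dots> \<le> s powr (1 - real n) * (C / n * s ^ n)"
      by (rule mult_left_mono[OF le]) simp
    also have "s powr (1 - real n) = s / s ^ n"
      using s0 by (simp add: powr_diff powr_realpow)
    also have "s / s ^ n * (C / n * s ^ n) = C * s / n" using s0 by simp
    finally show ?thesis .
  qed (simp add: flux_def)
qed

text \<open>The radial form of the divergence equation, \<open>K = G' + (n - 1) / r * G\<close>,
  obtained from the product rule.\<close>

lemma flux_deriv:
  assumes k: "continuous_on {0..} k" and n: "0 < n" and s: "0 < s"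
  shows "(flux n k has_real_derivative k s - (real n - 1) / s * flux n k s) (at s)"
proof -
  let ?H = "\<lambda>s. LBINT t:{0..s}. t ^ (n - 1) * k t"
  have "(?H has_real_derivative s ^ (n - 1) * k s) (at s within {0..})"
    by (rule has_real_derivative_integral_half_line) (use s in \<open>auto intro!: continuous_intros k\<close>)
  then have H: "(?H has_real_derivative s ^ (n - 1) * k s) (at s)"
    using at_within_interior[of s "{0..}"] s by simp
  have P: "((\<lambda>s. s powr (1 - real n)) has_real_derivative (1 - real n) * s powr (1 - real n - 1)) (at s)"
    using s by (intro has_real_derivative_powr) auto
  have "((\<lambda>s. s powr (1 - real n) * ?H s) has_real_derivative
      (1 - real n) * s powr (1 - real n - 1) * ?H s + s ^ (n - 1) * k s * s powr (1 - real n)) (at s)"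
    by (rule DERIV_mult[OF P H])
  moreover have "(1 - real n) * s powr (1 - real n - 1) * ?H s + s ^ (n - 1) * k s * s powr (1 - real n) =
      k s - (real n - 1) / s * flux n k s"
  proof -
    have "s ^ (n - 1) * s powr (1 - real n) = 1"
      using s n by (simp add: powr_realpow[symmetric] powr_add[symmetric] of_nat_diff)
    then have 1: "s ^ (n - 1) * k s * s powr (1 - real n) = k s"
      by (metis mult.commute mult.left_commute mult.right_neutral)
    have "s powr (1 - real n - 1) = s powr (1 - real n) / s powr 1" by (rule powr_diff)
    then have 2: "s powr (1 - real n - 1) = s powr (1 - real n) / s" using s by simp
    have 3: "flux n k s = s powr (1 - real n) * ?H s" using s by (simp add: flux_def)
    show ?thesis unfolding 1 2 3 using s by (simp add: field_simps)
  qed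
  ultimately have "((\<lambda>s. s powr (1 - real n) * ?H s) has_real_derivative k s - (real n - 1) / s * flux n k s) (at s)"
    by simp
  then show ?thesis
    by (rule DERIV_cong_ev[OF refl _ refl, THEN iffD1, rotated])
       (use s in \<open>auto simp: flux_def eventually_nhds intro!: exI[of _ "{0<..}"]\<close>)
qed

lemma flux_continuous:
  assumes k: "continuous_on {0..} k" and n: "0 < n" and k0: "\<And>t. 0 \<le> t \<Longrightarrow> 0 \<le> k t"
  shows "continuous_on {0..} (flux n k)"
  unfolding continuous_on_eq_continuous_within
proof
  fix s :: real assume "s \<in> {0..}"
  then consider "s = 0" | "0 < s" by fastforce
  then show "continuous (at s within {0..}) (flux n k)"
  proof cases
    case 1
    have "compact (k ` {0..1})" by (intro compact_continuous_image continuous_on_subset[OF k]) auto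
    then obtain C where "\<forall>y\<in>k ` {0..1}. norm y \<le> C" using compact_imp_bounded bounded_iff by metis
    then have C: "k t \<le> C" if "0 \<le> t" "t \<le> 1" for t using that by force
    \<comment> \<open>At the origin the flux is \<open>0\<close> by definition; the linear bound
      identifies this as its limit.\<close>
    have ev: "\<forall>\<^sub>F t in at 0 within {0..}. norm (flux n k t) \<le> C * t / real n"
      unfolding eventually_at
    proof (intro exI[of _ 1] conjI ballI impI)
      fix t :: real assume t: "t \<in> {0..}" "t \<noteq> 0 \<and> dist t 0 < 1"
      then show "norm (flux n k t) \<le> C * t / real n"
        using flux_bounds[OF k n, of t C] C k0 by auto
    qed simp
    have "((\<lambda>t. C * t / real n) \<longlongrightarrow> C * 0 / real n) (at 0 within {0..})"
      using n by (intro tendsto_intros) auto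
    then have "((\<lambda>t. C * t / real n) \<longlongrightarrow> 0) (at 0 within {0..})" by simp
    from Lim_null_comparison[OF ev this] show ?thesis
      using 1 flux_def[of n k 0] by (simp add: continuous_within)
  next
    case 2
    then show ?thesis using DERIV_isCont[OF flux_deriv[OF k n 2]] by (simp add: continuous_at_imp_continuous_at_within)
  qed
qed

section \<open>The profile, its flux and its source for one exponent\<close>

locale radial_sol =
  fixes n :: nat and l \<xi>1 \<xi>2 p \<beta> :: real and F :: "real \<times> real \<times> real \<Rightarrow> real" and v :: "real \<Rightarrow> real"
  assumes n: "0 < n" and p: "1 < p" and l: "0 < l" and \<xi>: "0 < \<xi>1" "0 < \<xi>2"
    and F_cont: "continuous_on ({0..} \<times> {0..} \<times> {0..}) F"
    and F_nonneg: "\<And>r u \<rho>. 0 \<le> r \<Longrightarrow> 0 < u \<Longrightarrow> u \<le> \<xi>1 \<Longrightarrow> 0 \<le> \<rho> \<Longrightarrow> \<rho> \<le> \<xi>2 \<Longrightarrow> 0 \<le> F (r, u, \<rho>)"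
    and sol: "radial_solution n l \<xi>1 \<xi>2 p F \<beta> v"
begin

abbreviation "K \<equiv> source F \<beta> v"
abbreviation "G \<equiv> flux n K"

lemma v_bounds:
  assumes "0 \<le> r"
  shows "inverse \<xi>1 * barrier n l p r \<le> v r" "0 < v r" "v r \<le> \<xi>1" "\<bar>half_deriv v r\<bar> \<le> \<xi>2"
proof -
  show *: "inverse \<xi>1 * barrier n l p r \<le> v r" "v r \<le> \<xi>1" "\<bar>half_deriv v r\<bar> \<le> \<xi>2"
    using sol assms unfolding radial_solution_def by auto
  have "0 < inverse \<xi>1 * barrier n l p r" using \<xi> l unfolding barrier_def by simp
  with * show "0 < v r" by linarith
qed

lemma v_cont: "continuous_on {0..} v" and dv_cont: "continuous_on {0..} (half_deriv v)"
proof -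
  have "C1_halfline v" using sol unfolding radial_solution_def by auto
  then show "continuous_on {0..} v" "continuous_on {0..} (half_deriv v)"
    unfolding C1_halfline_def by (auto intro!: differentiable_imp_continuous_on simp: differentiable_on_def)
qed

lemma K_cont: "continuous_on {0..} K"
proof -
  have "continuous_on {0..} (\<lambda>r. F (r, v r, \<bar>half_deriv v r\<bar>))"
    by (rule continuous_on_compose2[OF F_cont])
       (use v_bounds in \<open>auto intro!: continuous_intros v_cont dv_cont intro: less_imp_le\<close>)
  moreover have "continuous_on {0..} (\<lambda>r. v r powr (- \<beta>))"
    by (intro continuous_on_powr v_cont continuous_on_const) (use v_bounds(2) in force)
  ultimately show ?thesis unfolding source_def by (intro continuous_on_mult)
qed

lemma K_nonneg: "0 \<le> r \<Longrightarrow> 0 \<le> K r"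
  unfolding source_def using v_bounds[of r] by (intro mult_nonneg_nonneg F_nonneg) auto

lemma G_cont: "continuous_on {0..} G"
  by (rule flux_continuous[OF K_cont n K_nonneg])

lemma G_deriv: "0 < s \<Longrightarrow> (G has_real_derivative K s - (real n - 1) / s * G s) (at s)"
  by (rule flux_deriv[OF K_cont n])

lemma G_nonneg: "0 \<le> s \<Longrightarrow> 0 \<le> G s"
proof -
  assume s: "0 \<le> s"
  have "compact (K ` {0..s})" by (intro compact_continuous_image continuous_on_subset[OF K_cont]) auto
  then obtain C where "\<forall>y\<in>K ` {0..s}. norm y \<le> C" using compact_imp_bounded bounded_iff by metis
  then have "K t \<le> C" if "0 \<le> t" "t \<le> s" for t using that by force
  then show "0 \<le> G s" using flux_bounds(1)[OF K_cont n s, of C] K_nonneg by auto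
qed

lemma v_deriv_within:
  assumes r: "0 \<le> r"
  shows "(v has_real_derivative - (G r powr (1 / (p - 1)))) (at r within {0..})"
proof -
  let ?f = "\<lambda>s. G s powr (1 / (p - 1))"
  have f_cont: "continuous_on {0..} ?f"
    by (intro continuous_on_powr' G_cont continuous_on_const) (use G_nonneg p in auto)
  have eq: "v r = (LBINT s:{r..}. ?f s)" if "0 \<le> r" for r
    using sol that unfolding radial_solution_def by auto
  \<comment> \<open>A non-integrable function has integral \<open>0\<close> by convention, so the
    integral equation would give \<open>v 0 = 0\<close>, against the positive barrier.\<close>
  have int: "set_integrable lborel {0..} ?f"
  proof (rule ccontr)
    assume "\<not> ?thesis"
    then have "v 0 = 0" unfolding eq[OF order_refl] set_lebesgue_integral_def set_integrable_def
      by (rule not_integrable_integral_eq)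
    then show False using v_bounds(2)[of 0] by simp
  qed
  have v_eq: "v r = v 0 - (LBINT s:{0..r}. ?f s)" if r: "0 \<le> r" for r
  proof -
    have un: "{0..} = {0..<r} \<union> {r..}" using r by auto
    have "v 0 = (LBINT s:{0..<r} \<union> {r..}. ?f s)" using eq[of 0] un by simp
    also have "\<dots> = (LBINT s:{0..<r}. ?f s) + (LBINT s:{r..}. ?f s)"
      by (rule set_integral_Un) (use r in \<open>auto intro: set_integrable_subset[OF int]\<close>)
    also have "(LBINT s:{0..<r}. ?f s) = (LBINT s:{0..r}. ?f s)"
    proof -
      have i: "set_integrable lborel {0..r} ?f" "set_integrable lborel {0..<r} ?f"
        by (rule set_integrable_subset[OF int]; use r in auto)+
      show ?thesis unfolding set_lebesgue_integral_def
      proof (rule integral_cong_AE)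
        show "AE x in lborel. indicator {0..<r} x *\<^sub>R ?f x = indicator {0..r} x *\<^sub>R ?f x"
          using AE_lborel_singleton[of r] by eventually_elim (auto simp: indicator_def)
      qed (use i in \<open>auto simp: set_integrable_def\<close>)
    qed
    finally show ?thesis using eq[OF r] by simp
  qed
  have "((\<lambda>r. v 0 - (LBINT s:{0..r}. ?f s)) has_real_derivative 0 - ?f r) (at r within {0..})"
    by (intro DERIV_diff DERIV_const has_real_derivative_integral_half_line f_cont r)
  then have "((\<lambda>r. v 0 - (LBINT s:{0..r}. ?f s)) has_real_derivative - ?f r) (at r within {0..})"
    by simp
  then show ?thesis unfolding has_field_derivative_def
  proof (rule has_derivative_transform[rotated 2])
    show "v x = v 0 - (LBINT s:{0..x}. ?f s)" if "x \<in> {0..}" for x using v_eq[of x] that by simp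
  qed (use r in auto)
qed

lemma half_deriv_eq:
  assumes "0 \<le> r" shows "half_deriv v r = - (G r powr (1 / (p - 1)))"
  unfolding half_deriv_def
  using v_deriv_within[OF assms] at_half_line_neq_bot[OF assms]
  by (intro vector_derivative_within) (auto simp: has_real_derivative_iff_has_vector_derivative)

lemma v_deriv: "0 < r \<Longrightarrow> (v has_real_derivative half_deriv v r) (at r)"
  using v_deriv_within[of r] at_within_interior[of r "{0..}"] by (simp add: half_deriv_eq)

lemma v_decreasing:
  assumes "0 \<le> r" "r \<le> s" shows "v s \<le> v r"
proof (cases "r = s")
  case False
  then have rs: "r < s" using assms by simp
  have "\<exists>l z. r < z \<and> z < s \<and> DERIV v z :> l \<and> v s - v r = (s - r) * l"
  proof (rule MVT[OF rs])
    show "continuous_on {r..s} v" using assms by (intro continuous_on_subset[OF v_cont]) auto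
    show "v differentiable (at x)" if "r < x" "x < s" for x
      using v_deriv[of x] assms that by (auto simp: real_differentiable_def)
  qed
  then obtain d z where z: "r < z" "DERIV v z :> d" "v s - v r = (s - r) * d" by blast
  then have "d = half_deriv v z" using v_deriv[of z] assms by (intro DERIV_unique) auto
  then have "d \<le> 0" using half_deriv_eq[of z] z assms by simp
  then show ?thesis using z(3) rs mult_nonneg_nonpos[of "s - r" d] by simp
qed simp

lemma G_le:
  assumes "0 \<le> r" shows "G r \<le> \<xi>2 powr (p - 1)"
proof -
  have "G r powr (1 / (p - 1)) \<le> \<xi>2" using v_bounds(4)[OF assms] half_deriv_eq[OF assms] by simp
  then have "(G r powr (1 / (p - 1))) powr (p - 1) \<le> \<xi>2 powr (p - 1)" using p by (intro powr_mono2) auto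
  moreover have "(G r powr (1 / (p - 1))) powr (p - 1) = G r"
    using p G_nonneg[OF assms] by (simp add: powr_powr)
  ultimately show ?thesis by simp
qed

lemma grad_radial: "grad (\<lambda>x::'a::euclidean_space. v (norm x)) x = half_deriv v (norm x) *\<^sub>R sgn x"
proof (rule grad_eqI, cases "x = 0")
  case False
  have "(v has_derivative (\<lambda>h. half_deriv v (norm x) * h)) (at (norm x))"
    using v_deriv[of "norm x"] False by (simp add: has_field_derivative_def)
  from has_derivative_compose[OF has_derivative_norm[OF False] this]
  show "((\<lambda>x. v (norm x)) has_derivative (\<lambda>h. (half_deriv v (norm x) *\<^sub>R sgn x) \<bullet> h)) (at x)"
    by (rule has_derivative_eq_rhs) (auto simp: fun_eq_iff inner_commute)
next
  case True
  \<comment> \<open>The vanishing flux makes the one-sided derivative of \<open>v\<close> at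
    \<open>0\<close> vanish, so the radial function is differentiable there with gradient
    \<open>0\<close>; this agrees with the formula since \<open>sgn 0 = 0\<close>.\<close>
  have "G 0 = 0" by (simp add: flux_def)
  then have "(v has_real_derivative 0) (at 0 within {0..})" using v_deriv_within[of 0] by simp
  then have "((\<lambda>r. (v r - v 0) / (r - 0)) \<longlongrightarrow> 0) (at 0 within {0..})" by (simp add: has_field_derivative_iff)
  moreover have "filterlim (norm :: 'a \<Rightarrow> real) (at 0 within {0..}) (at 0)"
    by (auto simp: filterlim_at eventually_at_filter intro!: tendsto_norm_zero)
  ultimately have "((\<lambda>x::'a. (v (norm x) - v 0) / (norm x - 0)) \<longlongrightarrow> 0) (at 0)" by (rule filterlim_compose)
  from tendsto_norm_zero[OF this] have "((\<lambda>x::'a. v (norm x)) has_derivative (\<lambda>h. 0)) (at 0)"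
    by (simp add: has_derivative_iff_norm norm_divide bounded_linear_zero)
  then show "((\<lambda>x. v (norm x)) has_derivative (\<lambda>h. (half_deriv v (norm x) *\<^sub>R sgn x) \<bullet> h)) (at x)"
    using True by simp
qed

end

section \<open>Uniform bounds and extraction of a subsequence\<close>

text \<open>The diagonal extraction runs over the nonnegative rationals, so one subsequence serves
  all intervals \<open>[0,R]\<close> at once. Equi-Lipschitz continuity then upgrades convergence on
  a finite rational grid to uniform convergence.\<close>

lemma arzela_ascoli_half_line:
  fixes f :: "nat \<Rightarrow> real \<Rightarrow> real"
  assumes bd: "\<And>j r. 0 \<le> r \<Longrightarrow> \<bar>f j r\<bar> \<le> M"
    and lip: "\<And>R. \<exists>L. \<forall>j r s. 0 \<le> r \<longrightarrow> r \<le> R \<longrightarrow> 0 \<le> s \<longrightarrow> s \<le> R \<longrightarrow> \<bar>f j r - f j s\<bar> \<le> L * \<bar>r - s\<bar>"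
  obtains \<sigma> f0 where "strict_mono \<sigma>" "\<And>R. uniform_limit {0..R} (\<lambda>j. f (\<sigma> j)) f0 sequentially"
proof -
  let ?S = "\<rat> \<inter> {0..} :: real set"
  obtain \<sigma> where \<sigma>: "strict_mono (\<sigma> :: nat \<Rightarrow> nat)" "\<And>x. x \<in> ?S \<Longrightarrow> \<exists>l. (\<lambda>n. f (\<sigma> n) x) \<longlonglongrightarrow> l"
  proof (rule function_convergent_subsequence[of ?S f M])
    show "countable ?S" by (rule countable_subset[OF _ countable_rat]) auto
  qed (use bd that in auto)
  have unif: "uniformly_convergent_on {0..R} (\<lambda>j. f (\<sigma> j))" for R
  proof (rule Cauchy_uniformly_convergent, rule uniformly_Cauchy_onI)
    fix e :: real assume e: "0 < e"
    obtain L where L: "\<And>j r s. 0 \<le> r \<Longrightarrow> r \<le> R + 1 \<Longrightarrow> 0 \<le> s \<Longrightarrow> s \<le> R + 1 \<Longrightarrow> \<bar>f j r - f j s\<bar> \<le> L * \<bar>r - s\<bar>"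
      using lip[of "R + 1"] by blast
    \<comment> \<open>A grid of width \<open>1 / m\<close> keeps the oscillation to the nearest
      lower grid point below \<open>e / 4\<close>; two such oscillations and one Cauchy error at the
      grid point stay below \<open>e\<close>.\<close>
    obtain m :: nat where m: "4 * (\<bar>L\<bar> + 1) / e < real m" using reals_Archimedean2 by blast
    have m0: "0 < real m" using m e by (smt (verit) divide_pos_pos)
    have Lm: "\<bar>L\<bar> * (1 / real m) < e / 4" using m m0 e by (simp add: field_simps)
    define Q where "Q = (\<lambda>i. real i / real m) ` {..nat \<lceil>R * real m\<rceil>}"
    have Q: "finite Q" "\<And>q. q \<in> Q \<Longrightarrow> q \<in> ?S" by (auto simp: Q_def)
    have "\<forall>q\<in>Q. \<exists>n0. \<forall>n\<ge>n0. \<forall>k\<ge>n0. \<bar>f (\<sigma> n) q - f (\<sigma> k) q\<bar> < e / 4"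
    proof
      fix q assume "q \<in> Q"
      then obtain l where "(\<lambda>n. f (\<sigma> n) q) \<longlonglongrightarrow> l" using \<sigma>(2) Q(2) by blast
      then have "Cauchy (\<lambda>n. f (\<sigma> n) q)" by (rule LIMSEQ_imp_Cauchy)
      from CauchyD[OF this, of "e / 4"] show "\<exists>n0. \<forall>n\<ge>n0. \<forall>k\<ge>n0. \<bar>f (\<sigma> n) q - f (\<sigma> k) q\<bar> < e / 4"
        using e by simp
    qed
    then obtain n0 where n0: "\<And>q n k. q \<in> Q \<Longrightarrow> n0 q \<le> n \<Longrightarrow> n0 q \<le> k \<Longrightarrow> \<bar>f (\<sigma> n) q - f (\<sigma> k) q\<bar> < e / 4"
      by metis
    show "\<exists>M. \<forall>x\<in>{0..R}. \<forall>n\<ge>M. \<forall>k\<ge>M. dist (f (\<sigma> n) x) (f (\<sigma> k) x) < e"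
    proof (intro exI[of _ "Max (insert 0 (n0 ` Q))"] ballI allI impI)
      fix x n k assume x: "x \<in> {0..R}" and nk: "Max (insert 0 (n0 ` Q)) \<le> n" "Max (insert 0 (n0 ` Q)) \<le> k"
      \<comment> \<open>Rounding down: \<open>q\<close> is the last grid point not exceeding
        \<open>x\<close>, so it stays in the interval.\<close>
      define i where "i = nat \<lfloor>x * real m\<rfloor>"
      define q where "q = real i / real m"
      have xm: "0 \<le> x * real m" using x m0 by auto
      have ir: "real i = of_int \<lfloor>x * real m\<rfloor>" using xm by (simp add: i_def)
      have i1: "real i \<le> x * real m" "x * real m < real i + 1" unfolding ir by linarith+
      have qx: "q \<le> x" "x < q + 1 / real m" using i1 m0 by (auto simp: q_def field_simps)
      have q0: "0 \<le> q" by (simp add: q_def)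
      have "x * real m \<le> R * real m" using x m0 by (intro mult_right_mono) auto
      then have "i \<le> nat \<lceil>R * real m\<rceil>" unfolding i_def by (intro nat_mono) linarith
      then have qQ: "q \<in> Q" by (auto simp: Q_def q_def)
      then have n0q: "n0 q \<le> n" "n0 q \<le> k" using nk Q(1) by auto
      have close: "\<bar>f j x - f j q\<bar> < e / 4" for j
      proof -
        have "\<bar>f j x - f j q\<bar> \<le> L * \<bar>x - q\<bar>" using x qx q0 by (intro L) auto
        also have "\<dots> \<le> \<bar>L\<bar> * (1 / real m)" using qx by (intro mult_mono) auto
        finally show ?thesis using Lm by linarith
      qed
      show "dist (f (\<sigma> n) x) (f (\<sigma> k) x) < e"
        using close[of "\<sigma> n"] close[of "\<sigma> k"] n0[OF qQ n0q] unfolding dist_real_def by linarith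
    qed
  qed
  define f0 where "f0 x = lim (\<lambda>j. f (\<sigma> j) x)" for x
  have "uniform_limit {0..R} (\<lambda>j. f (\<sigma> j)) f0 sequentially" for R
    using unif[of R] unfolding uniformly_convergent_uniform_limit_iff f0_def .
  then show thesis using that \<sigma>(1) by blast
qed

section \<open>Estimates uniform along the sequence of exponents\<close>

locale p_laplace_seq =
  fixes N :: nat and \<alpha> l \<xi>1 \<xi>2 c :: real
    and F :: "real \<Rightarrow> real \<times> real \<times> real \<Rightarrow> real"
    and \<phi> :: "real \<Rightarrow> real \<times> real \<Rightarrow> real"
    and \<beta> :: "real \<Rightarrow> real"
    and vp :: "real \<Rightarrow> real \<Rightarrow> real"
    and F1 :: "real \<times> real \<times> real \<Rightarrow> real"
    and p :: "nat \<Rightarrow> real"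
  assumes N: "2 \<le> N" and \<alpha>: "0 < \<alpha>" "\<alpha> \<le> 1"
    and pos: "0 < l" "0 < \<xi>1" "0 < \<xi>2"
    and p_range: "\<And>j. 1 < p j \<and> p j < min 2 (sqrt (real N))"
    and p_lim: "p \<longlonglongrightarrow> 1"
    and adm: "\<And>j. admissible N \<alpha> l \<xi>1 \<xi>2 (p j) (F (p j)) (\<phi> (p j)) (\<beta> (p j))"
    and F1: "holder_loc \<alpha> ({0..} \<times> {0..} \<times> {0..}) F1"
    and F_lim: "loc_uniform_limit ({0..} \<times> {0..} \<times> {0..}) F F1 (at_right 1)"
    and \<beta>_lim: "((\<lambda>q. \<beta> q / (q - 1)) \<longlongrightarrow> c) (at_right 1)"
    and c: "0 \<le> c" "c \<le> 1"
    and sol: "\<And>j. radial_solution N l \<xi>1 \<xi>2 (p j) (F (p j)) (\<beta> (p j)) (vp (p j))"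
begin

lemma closed_octant: "closed ({0..} \<times> {0..} \<times> {0..} :: (real \<times> real \<times> real) set)"
  by (intro closed_Times closed_atLeast)

lemma F_cont: "continuous_on ({0..} \<times> {0..} \<times> {0..}) (F (p j))"
  using adm[of j] \<alpha>(1) closed_octant unfolding admissible_def by (blast intro: holder_loc_continuous_on)

lemma F1_cont: "continuous_on ({0..} \<times> {0..} \<times> {0..}) F1"
  by (rule holder_loc_continuous_on[OF F1 \<alpha>(1) closed_octant])

sublocale S: radial_sol N l \<xi>1 \<xi>2 "p j" "\<beta> (p j)" "F (p j)" "vp (p j)" for j
proof
  show "0 \<le> F (p j) (r, u, \<rho>)" if "0 \<le> r" "0 < u" "u \<le> \<xi>1" "0 \<le> \<rho>" "\<rho> \<le> \<xi>2" for r u \<rho>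
    using adm[of j] that unfolding admissible_def by (meson order_trans)
qed (use N pos p_range[of j] F_cont sol in auto)

lemma p_at_right: "filterlim p (at_right 1) sequentially"
  using p_lim p_range by (auto simp: filterlim_at intro!: always_eventually) (metis less_irrefl p_range)

lemma \<beta>_range: "0 \<le> \<beta> (p j)" "\<beta> (p j) < p j - 1"
  using adm[of j] unfolding admissible_def by auto

lemma p_gt: "1 < p j" "p j < 2" "p j < real N"
  using p_range[of j] N by auto

text \<open>Raised to the power \<open>p - 1\<close>, the condition relating \<open>l\<close> to
  \<open>\<xi>1\<close> becomes \<open>l powr (- (N - 1)) \<le> 1\<close> in the limit. From here on
  powers of \<open>max l r\<close> are monotone in the exponent.\<close>

lemma l_ge_1: "1 \<le> l"
proof (rule ccontr)
  assume "\<not> 1 \<le> l"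
  have "l powr (- (real N - 1)) \<le> 1"
  proof (rule LIMSEQ_le)
    show "(\<lambda>j. l powr (- (real N - p j))) \<longlonglongrightarrow> l powr (- (real N - 1))"
      using pos by (intro tendsto_intros p_lim) auto
    have "(\<lambda>j. (\<xi>1\<^sup>2) powr (p j - 1)) \<longlonglongrightarrow> (\<xi>1\<^sup>2) powr (1 - 1)"
      using pos by (intro tendsto_intros p_lim) auto
    then show "(\<lambda>j. (\<xi>1\<^sup>2) powr (p j - 1)) \<longlonglongrightarrow> 1" using pos by simp
    have "l powr (- (real N - p j)) \<le> (\<xi>1\<^sup>2) powr (p j - 1)" for j
    proof -
      have "l powr (- ((real N - p j) / (p j - 1))) \<le> \<xi>1\<^sup>2" using adm[of j] unfolding admissible_def by auto
      then have "(l powr (- ((real N - p j) / (p j - 1)))) powr (p j - 1) \<le> (\<xi>1\<^sup>2) powr (p j - 1)"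
        using p_gt(1)[of j] by (intro powr_mono2) auto
      moreover have "(l powr (- ((real N - p j) / (p j - 1)))) powr (p j - 1) = l powr (- (real N - p j))"
        using p_gt(1)[of j] by (simp add: powr_powr)
      ultimately show ?thesis by simp
    qed
    then show "\<exists>M. \<forall>n\<ge>M. l powr (- (real N - p n)) \<le> (\<xi>1\<^sup>2) powr (p n - 1)" by blast
  qed
  moreover have "1 < l powr (- (real N - 1))"
  proof -
    have "l powr (real N - 1) < 1 powr (real N - 1)"
      using \<open>\<not> 1 \<le> l\<close> pos N by (intro powr_less_mono2) auto
    then have "1 < inverse (l powr (real N - 1))" using pos by (intro one_less_inverse) auto
    then show ?thesis using powr_minus[of l "real N - 1"] by simp
  qed
  ultimately show False by simp
qed

text \<open>Uniform convergence on a compact box handles large \<open>j\<close>, compactness the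
  finitely many remaining ones; their bounds are summed up.\<close>

lemma F_bound: "\<exists>C. \<forall>j r u \<rho>. 0 \<le> r \<longrightarrow> r \<le> R \<longrightarrow> 0 \<le> u \<longrightarrow> u \<le> \<xi>1 \<longrightarrow> 0 \<le> \<rho> \<longrightarrow> \<rho> \<le> \<xi>2 \<longrightarrow>
   \<bar>F (p j) (r, u, \<rho>)\<bar> \<le> C \<and> \<bar>F1 (r, u, \<rho>)\<bar> \<le> C"
proof -
  let ?D = "{0..R} \<times> {0..\<xi>1} \<times> {0..\<xi>2}"
  have D: "compact ?D" "?D \<subseteq> {0..} \<times> {0..} \<times> {0..}" by (auto intro!: compact_Times)
  have bd: "\<exists>C. \<forall>x\<in>?D. \<bar>f x\<bar> \<le> C" if "continuous_on ({0..} \<times> {0..} \<times> {0..}) f" for f :: "real \<times> real \<times> real \<Rightarrow> real"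
  proof -
    have "compact (f ` ?D)" by (intro compact_continuous_image continuous_on_subset[OF that] D)
    then obtain C where "\<forall>y\<in>f ` ?D. norm y \<le> C" using compact_imp_bounded bounded_iff by metis
    then show ?thesis by auto
  qed
  obtain C1 where C1: "\<And>x. x \<in> ?D \<Longrightarrow> \<bar>F1 x\<bar> \<le> C1" using bd[OF F1_cont] by blast
  have "\<forall>j. \<exists>C. \<forall>x\<in>?D. \<bar>F (p j) x\<bar> \<le> C" using bd[OF F_cont] by blast
  then obtain C where C: "\<And>j x. x \<in> ?D \<Longrightarrow> \<bar>F (p j) x\<bar> \<le> C j" by metis
  have "uniform_limit ?D F F1 (at_right 1)" using F_lim D unfolding loc_uniform_limit_def by blast
  then have "uniform_limit ?D (\<lambda>j. F (p j)) F1 sequentially"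
    by (rule filterlim_compose[OF _ p_at_right])
  then have "\<forall>\<^sub>F j in sequentially. \<forall>x\<in>?D. dist (F (p j) x) (F1 x) < 1"
    by (rule uniform_limitD) simp
  then obtain J where J: "\<And>j x. J \<le> j \<Longrightarrow> x \<in> ?D \<Longrightarrow> \<bar>F (p j) x - F1 x\<bar> < 1"
    unfolding eventually_sequentially dist_real_def by blast
  have C0: "\<bar>F (p j) x\<bar> \<le> C1 + 1 + (\<Sum>i<J. \<bar>C i\<bar>)" if x: "x \<in> ?D" for j x
  proof (cases "J \<le> j")
    case True
    have "0 \<le> (\<Sum>i<J. \<bar>C i\<bar>)" by (rule sum_nonneg) auto
    then show ?thesis using J[OF True x] C1[OF x] by linarith
  next
    case False
    have "\<bar>C j\<bar> \<le> (\<Sum>i<J. \<bar>C i\<bar>)" by (rule member_le_sum) (use False in auto)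
    then show ?thesis using C[OF x, of j] C1[OF x] by linarith
  qed
  have "\<bar>F1 x\<bar> \<le> C1 + 1 + (\<Sum>i<J. \<bar>C i\<bar>)" if x: "x \<in> ?D" for x
  proof -
    have "0 \<le> (\<Sum>i<J. \<bar>C i\<bar>)" by (rule sum_nonneg) auto
    then show ?thesis using C1[OF x] by linarith
  qed
  then show ?thesis using C0 by (intro exI[of _ "C1 + 1 + (\<Sum>i<J. \<bar>C i\<bar>)"]) auto
qed

text \<open>The power \<open>p - 1\<close> cancels the denominator in the exponent of the barrier,
  so this bound stays away from \<open>0\<close> on bounded sets as \<open>p\<close> tends to
  \<open>1\<close>, even where the barrier itself tends to \<open>0\<close>.\<close>

lemma v_powr_lower:
  assumes "0 \<le> r"
  shows "inverse \<xi>1 powr (p j - 1) * max l r powr (- (real N - p j)) \<le> vp (p j) r powr (p j - 1)"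
proof -
  have "(inverse \<xi>1 * barrier N l (p j) r) powr (p j - 1) \<le> vp (p j) r powr (p j - 1)"
    using S.v_bounds(1)[OF assms, of j] p_gt(1)[of j] pos by (intro powr_mono2) (auto simp: barrier_def)
  moreover have "(inverse \<xi>1 * barrier N l (p j) r) powr (p j - 1) =
      inverse \<xi>1 powr (p j - 1) * max l r powr (- (real N - p j))"
    using p_gt(1)[of j] pos by (simp add: barrier_def powr_mult powr_powr)
  ultimately show ?thesis by simp
qed

text \<open>The danger is \<open>v powr (- \<beta>)\<close> where \<open>v\<close> is tiny. The
  barrier bounds it by a power of \<open>max l r\<close> with exponent
  \<open>\<beta> / (p - 1) * (N - p)\<close>, and \<open>\<beta> < p - 1\<close> keeps this exponent
  below \<open>N\<close> for every \<open>j\<close>.\<close>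

lemma source_bound: "\<exists>C. \<forall>j r. 0 \<le> r \<longrightarrow> r \<le> R \<longrightarrow> source (F (p j)) (\<beta> (p j)) (vp (p j)) r \<le> C"
proof -
  obtain C where C: "\<And>j r u \<rho>. 0 \<le> r \<Longrightarrow> r \<le> R \<Longrightarrow> 0 \<le> u \<Longrightarrow> u \<le> \<xi>1 \<Longrightarrow> 0 \<le> \<rho> \<Longrightarrow> \<rho> \<le> \<xi>2 \<Longrightarrow> \<bar>F (p j) (r, u, \<rho>)\<bar> \<le> C"
    using F_bound[of R] by blast
  have "source (F (p j)) (\<beta> (p j)) (vp (p j)) r \<le> C * (max 1 \<xi>1 * max l R powr real N)"
    if r: "0 \<le> r" "r \<le> R" for j r
  proof -
    note vb = S.v_bounds[OF r(1), of j]
    let ?b = "\<beta> (p j)"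
    have F: "F (p j) (r, vp (p j) r, \<bar>half_deriv (vp (p j)) r\<bar>) \<le> C"
      using C[of r "vp (p j) r" "\<bar>half_deriv (vp (p j)) r\<bar>" j] vb r by auto
    have b0: "0 < inverse \<xi>1 * barrier N l (p j) r" using pos by (simp add: barrier_def)
    have "vp (p j) r powr (- ?b) \<le> (inverse \<xi>1 * barrier N l (p j) r) powr (- ?b)"
      using vb(1) b0 \<beta>_range[of j] by (intro powr_mono2') auto
    also have "\<dots> = \<xi>1 powr ?b * max l r powr (?b * ((real N - p j) / (p j - 1)))"
      using pos by (simp add: barrier_def powr_mult powr_powr powr_minus inverse_powr) (simp add: field_simps)
    also have "\<dots> \<le> max 1 \<xi>1 * max l R powr real N"
    proof (rule mult_mono)
      show "\<xi>1 powr ?b \<le> max 1 \<xi>1"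
      proof (cases "\<xi>1 \<le> 1")
        case True
        then have "\<xi>1 powr ?b \<le> 1" using pos \<beta>_range[of j] by (simp add: powr_le1)
        then show ?thesis by simp
      next
        case False
        then have "\<xi>1 powr ?b \<le> \<xi>1 powr 1" using \<beta>_range[of j] p_gt[of j] by (intro powr_mono) auto
        then show ?thesis using pos by simp
      qed
      have "?b * ((real N - p j) / (p j - 1)) = (?b / (p j - 1)) * (real N - p j)" by simp
      also have "\<dots> \<le> 1 * (real N - p j)"
        using \<beta>_range[of j] p_gt[of j] by (intro mult_right_mono) auto
      also have "\<dots> \<le> real N" using p_gt(1)[of j] by simp
      finally have e: "?b * ((real N - p j) / (p j - 1)) \<le> real N" .
      have "max l r powr (?b * ((real N - p j) / (p j - 1))) \<le> max l r powr real N"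
        using e l_ge_1 by (intro powr_mono) auto
      also have "\<dots> \<le> max l R powr real N" using l_ge_1 r by (intro powr_mono2) auto
      finally show "max l r powr (?b * ((real N - p j) / (p j - 1))) \<le> max l R powr real N" .
    qed auto
    finally have v: "vp (p j) r powr (- ?b) \<le> max 1 \<xi>1 * max l R powr real N" .
    have "0 \<le> C" using C[of r 0 0 j] r pos by auto
    with F v show ?thesis unfolding source_def by (intro mult_mono) auto
  qed
  then show ?thesis by blast
qed

text \<open>The profiles are extended to negative radii by their values at \<open>0\<close>, which makes them Borel functions
  on the line. At \<open>r = 0\<close> the quotient in \<open>dG\<close> is the default value \<open>0\<close>.\<close>

definition "V j r = vp (p j) (max 0 r)"
definition "dV j r = half_deriv (vp (p j)) (max 0 r)"
definition "K j r = source (F (p j)) (\<beta> (p j)) (vp (p j)) (max 0 r)"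
definition "G j r = flux N (source (F (p j)) (\<beta> (p j)) (vp (p j))) (max 0 r)"
definition "dG j r = K j r - (real N - 1) / r * G j r"

lemma V_meas [measurable]: "V j \<in> borel_measurable borel" "dV j \<in> borel_measurable borel"
    "K j \<in> borel_measurable borel" "G j \<in> borel_measurable borel" "dG j \<in> borel_measurable borel"
proof -
  have m: "(\<lambda>r. f (max 0 r)) \<in> borel_measurable borel" if "continuous_on {0..} f" for f :: "real \<Rightarrow> real"
    by (intro borel_measurable_continuous_onI continuous_on_compose2[OF that] continuous_intros) auto
  show "V j \<in> borel_measurable borel" unfolding V_def[abs_def] by (rule m[OF S.v_cont])
  show "dV j \<in> borel_measurable borel" unfolding dV_def[abs_def] by (rule m[OF S.dv_cont])
  show [measurable]: "K j \<in> borel_measurable borel" unfolding K_def[abs_def] by (rule m[OF S.K_cont])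
  show [measurable]: "G j \<in> borel_measurable borel" unfolding G_def[abs_def] by (rule m[OF S.G_cont])
  show "dG j \<in> borel_measurable borel" unfolding dG_def[abs_def] by measurable
qed

lemma V_bounds: "0 < V j r" "V j r \<le> \<xi>1" "\<bar>dV j r\<bar> \<le> \<xi>2" "0 \<le> K j r" "0 \<le> G j r" "G j r \<le> \<xi>2 powr (p j - 1)"
    "dV j r = - (G j r powr (1 / (p j - 1)))"
  unfolding V_def dV_def K_def G_def
  using S.v_bounds[of "max 0 r" j] S.K_nonneg[of "max 0 r" j] S.G_nonneg[of "max 0 r" j] S.G_le[of "max 0 r" j]
    S.half_deriv_eq[of "max 0 r" j] by simp_all

lemma V_cont: "continuous_on {0..} (V j)" "continuous_on {0..} (G j)"
proof -
  show "continuous_on {0..} (V j)" using S.v_cont[of j] by (rule continuous_on_eq) (simp add: V_def)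
  show "continuous_on {0..} (G j)" using S.G_cont[of j] by (rule continuous_on_eq) (simp add: G_def)
qed

lemma V_deriv:
  assumes "0 < r"
  shows "(V j has_real_derivative dV j r) (at r)" "(G j has_real_derivative dG j r) (at r)"
proof -
  have ev: "\<forall>\<^sub>F x in nhds r. f x = f (max 0 x)" for f :: "real \<Rightarrow> real"
    unfolding eventually_nhds using assms by (intro exI[of _ "{0<..}"]) auto
  have "(vp (p j) has_real_derivative dV j r) (at r)"
    using S.v_deriv[OF assms, of j] assms by (simp add: dV_def)
  then show "(V j has_real_derivative dV j r) (at r)"
    unfolding V_def[abs_def] using DERIV_cong_ev[OF refl ev[of "vp (p j)"] refl] by blast
  let ?G = "flux N (source (F (p j)) (\<beta> (p j)) (vp (p j)))"
  have "(?G has_real_derivative dG j r) (at r)"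
    using S.G_deriv[OF assms, of j] assms by (simp add: dG_def K_def G_def)
  then show "(G j has_real_derivative dG j r) (at r)"
    unfolding G_def[abs_def] using DERIV_cong_ev[OF refl ev[of ?G] refl] by blast
qed

lemma G_le_linear:
  assumes "0 \<le> r" "r \<le> R" and C: "\<And>j r. 0 \<le> r \<Longrightarrow> r \<le> R \<Longrightarrow> K j r \<le> C"
  shows "G j r \<le> C * r / real N"
proof -
  have "flux N (source (F (p j)) (\<beta> (p j)) (vp (p j))) r \<le> C * r / real N"
  proof (rule flux_bounds(2)[OF S.K_cont S.n assms(1)])
    show "0 \<le> source (F (p j)) (\<beta> (p j)) (vp (p j)) t \<and> source (F (p j)) (\<beta> (p j)) (vp (p j)) t \<le> C"
      if "0 \<le> t" "t \<le> r" for t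
      using C[of t j] S.K_nonneg[of t j] that assms by (simp add: K_def)
  qed
  then show ?thesis using assms by (simp add: G_def)
qed

lemma K_bound: "\<exists>C\<ge>0. \<forall>j r. 0 \<le> r \<longrightarrow> r \<le> R \<longrightarrow> K j r \<le> C"
proof -
  obtain C where "\<And>j r. 0 \<le> r \<Longrightarrow> r \<le> R \<Longrightarrow> source (F (p j)) (\<beta> (p j)) (vp (p j)) r \<le> C"
    using source_bound[of R] by blast
  then show ?thesis by (intro exI[of _ "max 0 C"]) (auto simp: K_def le_max_iff_disj)
qed

text \<open>The factor \<open>(N - 1) / r\<close> is offset by the linear bound
  \<open>C * r / N\<close> for the flux, so both terms of the derivative lie in
  \<open>[0,C]\<close>.\<close>

lemma dG_bound:
  assumes "0 \<le> r" "r \<le> R" and C: "\<And>j r. 0 \<le> r \<Longrightarrow> r \<le> R \<Longrightarrow> K j r \<le> C" and "0 \<le> C"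
  shows "\<bar>dG j r\<bar> \<le> 2 * C"
proof -
  have "(real N - 1) / r * G j r \<le> C"
  proof (cases "r = 0")
    case False
    then have "(real N - 1) / r * G j r \<le> (real N - 1) / r * (C * r / real N)"
      using N assms by (intro mult_left_mono G_le_linear[where R=R] C) auto
    also have "\<dots> = C * ((real N - 1) / real N)" using False by simp
    also have "\<dots> \<le> C * 1" using N assms(4) by (intro mult_left_mono) auto
    finally show ?thesis by simp
  qed (use assms in simp)
  moreover have "0 \<le> (real N - 1) / r * G j r" using V_bounds(5)[of j r] N assms(1) by simp
  moreover have "\<bar>a - b\<bar> \<le> 2 * C" if "b \<le> C" "0 \<le> b" "a \<le> C" "0 \<le> a" for a b :: real
    using that by linarith
  ultimately show ?thesis using C[OF assms(1,2), of j] V_bounds(4)[of j r] unfolding dG_def by blast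
qed

lemma G_le_max: "G j r \<le> max 1 \<xi>2"
proof -
  have "\<xi>2 powr (p j - 1) \<le> max 1 \<xi>2"
  proof (cases "\<xi>2 \<le> 1")
    case True
    then have "\<xi>2 powr (p j - 1) \<le> 1" using pos p_gt[of j] by (simp add: powr_le1)
    then show ?thesis by simp
  next
    case False
    then have "\<xi>2 powr (p j - 1) \<le> \<xi>2 powr 1" using p_gt[of j] by (intro powr_mono) auto
    then show ?thesis using pos by simp
  qed
  then show ?thesis using V_bounds(6)[of j r] by linarith
qed

lemma V_lipschitz: "0 \<le> r \<Longrightarrow> 0 \<le> s \<Longrightarrow> \<bar>V j r - V j s\<bar> \<le> \<xi>2 * \<bar>r - s\<bar>"
  by (rule lipschitz_of_deriv[OF V_cont(1) V_deriv(1), where R="max r s"]) (auto simp: V_bounds(3))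

lemma G_lipschitz:
  "\<exists>L. \<forall>j r s. 0 \<le> r \<longrightarrow> r \<le> R \<longrightarrow> 0 \<le> s \<longrightarrow> s \<le> R \<longrightarrow> \<bar>G j r - G j s\<bar> \<le> L * \<bar>r - s\<bar>"
proof -
  obtain C where C: "0 \<le> C" "\<And>j r. 0 \<le> r \<Longrightarrow> r \<le> R \<Longrightarrow> K j r \<le> C" using K_bound[of R] by blast
  have "\<bar>G j r - G j s\<bar> \<le> 2 * C * \<bar>r - s\<bar>" if "0 \<le> r" "r \<le> R" "0 \<le> s" "s \<le> R" for j r s
    by (rule lipschitz_of_deriv[OF V_cont(2) V_deriv(2) dG_bound[OF _ _ C(2) C(1)] that])
  then show ?thesis by blast
qed

lemma subsequence:
  assumes "strict_mono \<sigma>"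
  shows "p_laplace_seq N \<alpha> l \<xi>1 \<xi>2 c F \<phi> \<beta> vp F1 (\<lambda>j. p (\<sigma> j))"
  using LIMSEQ_subseq_LIMSEQ[OF p_lim assms] N \<alpha> pos p_range adm F1 F_lim \<beta>_lim c sol
  by unfold_locales (auto simp: o_def)

lemma V_powr_bounds: "0 < V j r powr (p j - 1)" "V j r powr (p j - 1) \<le> max 1 \<xi>1"
proof -
  show "0 < V j r powr (p j - 1)" using V_bounds(1)[of j r] by simp
  have "V j r powr (p j - 1) \<le> max 1 \<xi>1 powr (p j - 1)"
    using V_bounds(1,2)[of j r] p_gt[of j] by (intro powr_mono2) auto
  also have "\<dots> \<le> max 1 \<xi>1 powr 1" using p_gt[of j] by (intro powr_mono) auto
  finally show "V j r powr (p j - 1) \<le> max 1 \<xi>1" by simp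
qed

lemma extraction:
  obtains \<sigma> v0 G0 W where "strict_mono \<sigma>"
    "\<And>R. uniform_limit {0..R} (\<lambda>j. V (\<sigma> j)) v0 sequentially"
    "\<And>R. uniform_limit {0..R} (\<lambda>j. G (\<sigma> j)) G0 sequentially"
    "mono W" "\<And>r. isCont W r \<Longrightarrow> (\<lambda>j. V (\<sigma> j) r powr (p (\<sigma> j) - 1)) \<longlonglongrightarrow> - W r"
proof -
  obtain \<sigma>1 v0 where 1: "strict_mono \<sigma>1" "\<And>R. uniform_limit {0..R} (\<lambda>j. V (\<sigma>1 j)) v0 sequentially"
  proof (rule arzela_ascoli_half_line[of V \<xi>1])
    show "\<bar>V j r\<bar> \<le> \<xi>1" for j r using V_bounds(1,2)[of j r] by simp
    show "\<exists>L. \<forall>j r s. 0 \<le> r \<longrightarrow> r \<le> R \<longrightarrow> 0 \<le> s \<longrightarrow> s \<le> R \<longrightarrow> \<bar>V j r - V j s\<bar> \<le> L * \<bar>r - s\<bar>" for R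
      using V_lipschitz by blast
  qed (use that in blast)
  obtain \<sigma>2 G0 where 2: "strict_mono \<sigma>2" "\<And>R. uniform_limit {0..R} (\<lambda>j. G (\<sigma>1 (\<sigma>2 j))) G0 sequentially"
  proof (rule arzela_ascoli_half_line[of "\<lambda>j. G (\<sigma>1 j)" "max 1 \<xi>2"])
    show "\<bar>G (\<sigma>1 j) r\<bar> \<le> max 1 \<xi>2" for j r using V_bounds(5) G_le_max by simp
    show "\<exists>L. \<forall>j r s. 0 \<le> r \<longrightarrow> r \<le> R \<longrightarrow> 0 \<le> s \<longrightarrow> s \<le> R \<longrightarrow> \<bar>G (\<sigma>1 j) r - G (\<sigma>1 j) s\<bar> \<le> L * \<bar>r - s\<bar>" for R
      using G_lipschitz[of R] by blast
  qed (use that in blast)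
  \<comment> \<open>The sign makes these functions nondecreasing, as Helly's theorem wants. The
    constant extension to negative radii keeps them continuous and monotone on the whole
    line.\<close>
  define h where "h j r = - (V (\<sigma>1 (\<sigma>2 j)) r powr (p (\<sigma>1 (\<sigma>2 j)) - 1))" for j r
  have V_isCont: "isCont (V j) r" for j r
  proof -
    have "continuous_on UNIV (V j)" unfolding V_def[abs_def]
      by (intro continuous_on_compose2[OF S.v_cont] continuous_intros) auto
    then show ?thesis by (simp add: continuous_on_eq_continuous_at)
  qed
  have "\<exists>s. strict_mono (s::nat \<Rightarrow> nat) \<and> (\<exists>W. (\<forall>x. continuous (at_right x) W) \<and> mono W \<and> (\<forall>x. \<bar>W x\<bar> \<le> max 1 \<xi>1) \<and>
    (\<forall>x. continuous (at x) W \<longrightarrow> (\<lambda>n. h (s n) x) \<longlonglongrightarrow> W x))"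
  proof (rule Helly_selection)
    show "continuous (at_right x) (h j)" for j x
    proof -
      have "isCont (h j) x" unfolding h_def[abs_def]
        by (intro continuous_intros V_isCont) (use V_bounds(1) less_imp_neq in \<open>metis less_irrefl\<close>)
      then show ?thesis by (rule continuous_at_imp_continuous_at_within)
    qed
    show "mono (h j)" for j
    proof (rule monoI)
      fix x y :: real assume "x \<le> y"
      then have "V i y \<le> V i x" for i unfolding V_def by (intro S.v_decreasing) auto
      then have "V i y powr (p i - 1) \<le> V i x powr (p i - 1)" for i
        using V_bounds(1)[of i y] p_gt[of i] by (intro powr_mono2) (auto intro: less_imp_le)
      then show "h j x \<le> h j y" by (simp add: h_def)
    qed
    show "\<bar>h j x\<bar> \<le> max 1 \<xi>1" for j x using V_powr_bounds[of "\<sigma>1 (\<sigma>2 j)" x] by (simp add: h_def)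
  qed
  then obtain s W where s: "strict_mono (s :: nat \<Rightarrow> nat)" "mono W" "\<And>x. isCont W x \<Longrightarrow> (\<lambda>n. h (s n) x) \<longlonglongrightarrow> W x"
    by blast
  define \<sigma> where "\<sigma> j = \<sigma>1 (\<sigma>2 (s j))" for j
  show thesis
  proof
    show "strict_mono \<sigma>" using 1(1) 2(1) s(1) unfolding \<sigma>_def strict_mono_def by blast
    have fs: "filterlim s sequentially sequentially" "filterlim (\<lambda>j. \<sigma>2 (s j)) sequentially sequentially"
      using s(1) 2(1) by (auto intro!: filterlim_subseq simp: strict_mono_def)
    show "uniform_limit {0..R} (\<lambda>j. V (\<sigma> j)) v0 sequentially" for R
      unfolding \<sigma>_def by (rule filterlim_compose[OF 1(2) fs(2)])
    show "uniform_limit {0..R} (\<lambda>j. G (\<sigma> j)) G0 sequentially" for R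
      unfolding \<sigma>_def by (rule filterlim_compose[OF 2(2) fs(1)])
    show "mono W" by fact
    show "(\<lambda>j. V (\<sigma> j) r powr (p (\<sigma> j) - 1)) \<longlonglongrightarrow> - W r" if "isCont W r" for r
      using tendsto_minus[OF s(3)[OF that]] by (simp add: h_def \<sigma>_def)
  qed
qed

end

section \<open>The limit problem\<close>

text \<open>Extracts pointwise information from integrals: applied to the set where a relation
  fails, it shows that this set is null.\<close>

lemma AE_set_integral_nonneg_imp:
  fixes h :: "real \<Rightarrow> real"
  assumes [measurable]: "A \<in> sets borel" and h: "set_integrable lborel A h" "\<And>x. x \<in> A \<Longrightarrow> 0 < h x"
    and le: "(LBINT x:A. h x) \<le> 0"
  shows "AE x in lborel. x \<notin> A"
proof -
  have i: "integrable lborel (\<lambda>x. indicator A x * h x)" using h(1) by (simp add: set_integrable_def)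
  have n: "AE x in lborel. 0 \<le> indicator A x * h x" using h(2) by (auto simp: indicator_def intro!: AE_I2 less_imp_le)
  have "(LBINT x. indicator A x * h x) = 0"
    using le integral_nonneg_AE[OF n] by (simp add: set_lebesgue_integral_def)
  then have "AE x in lborel. indicator A x * h x = 0" using integral_nonneg_eq_0_iff_AE[OF i n] by simp
  then show ?thesis
  proof eventually_elim
    case (elim x)
    show ?case
    proof
      assume "x \<in> A"
      with elim h(2)[of x] show False by simp
    qed
  qed
qed

text \<open>The sign of \<open>W0\<close> comes from Helly's theorem, which is about nondecreasing functions.\<close>

locale p_laplace_limit = p_laplace_seq +
  fixes v0 G0 W0 :: "real \<Rightarrow> real"
  assumes v0_lim: "\<And>R. uniform_limit {0..R} V v0 sequentially"
    and G0_lim: "\<And>R. uniform_limit {0..R} G G0 sequentially"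
    and W0_mono: "mono W0"
    and W0_lim: "\<And>r. isCont W0 r \<Longrightarrow> (\<lambda>j. V j r powr (p j - 1)) \<longlonglongrightarrow> - W0 r"
begin

definition "Vl r = v0 (max 0 r)"
definition "Gl r = G0 (max 0 r)"
text \<open>Helly's limit is trustworthy only at its continuity points. Clamping it between the two
  bounds makes them hold at every radius, and changes nothing at continuity points in
  \<open>[0,\<infinity>)\<close>.\<close>

definition "w r = max (max l r powr (- (real N - 1))) (min 1 (- W0 r))"
text \<open>The value \<open>(N - 1) / r\<close> on \<open>{G = 1}\<close> is forced by
  \<open>K = G' + (N - 1) / r * G\<close> with \<open>G' = 0\<close> there, as befits the derivative
  of a Lipschitz function on a level set. The identity thus holds at every radius
  \<open>r \<ge> 0\<close>.\<close>

definition "Kl r = (if Gl r < 1 then w r powr (- c) * F1 (max 0 r, Vl r, 0) else (real N - 1) / r)"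
definition "dGl r = (if Gl r < 1 then Kl r - (real N - 1) / r * Gl r else 0)"

lemma Vl_lim: "(\<lambda>j. V j r) \<longlonglongrightarrow> Vl r"
proof -
  have "(\<lambda>j. V j (max 0 r)) \<longlonglongrightarrow> v0 (max 0 r)" by (rule tendsto_uniform_limitI[OF v0_lim[of "max 0 r"]]) simp
  then show ?thesis by (simp add: V_def Vl_def)
qed

lemma Gl_lim: "(\<lambda>j. G j r) \<longlonglongrightarrow> Gl r"
proof -
  have "(\<lambda>j. G j (max 0 r)) \<longlonglongrightarrow> G0 (max 0 r)" by (rule tendsto_uniform_limitI[OF G0_lim[of "max 0 r"]]) simp
  then show ?thesis by (simp add: G_def Gl_def)
qed

lemma Vl_range: "0 \<le> Vl r" "Vl r \<le> \<xi>1"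
  by (rule LIMSEQ_le_const[OF Vl_lim], use V_bounds(1) less_imp_le in blast)
     (rule LIMSEQ_le_const2[OF Vl_lim], use V_bounds(2) in blast)

lemma Vl_lipschitz: "\<bar>Vl x - Vl y\<bar> \<le> \<xi>2 * \<bar>x - y\<bar>"
proof (rule LIMSEQ_le_const2)
  show "(\<lambda>j. \<bar>V j x - V j y\<bar>) \<longlonglongrightarrow> \<bar>Vl x - Vl y\<bar>" by (intro tendsto_intros Vl_lim)
  have "\<bar>V j x - V j y\<bar> \<le> \<xi>2 * \<bar>x - y\<bar>" for j
  proof -
    have "\<bar>V j (max 0 x) - V j (max 0 y)\<bar> \<le> \<xi>2 * \<bar>max 0 x - max 0 y\<bar>" by (rule V_lipschitz) auto
    also have "\<dots> \<le> \<xi>2 * \<bar>x - y\<bar>" using pos by (intro mult_left_mono) auto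
    finally show ?thesis by (simp add: V_def)
  qed
  then show "\<exists>N. \<forall>j\<ge>N. \<bar>V j x - V j y\<bar> \<le> \<xi>2 * \<bar>x - y\<bar>" by blast
qed

lemma powr_p_lim: "0 < a \<Longrightarrow> (\<lambda>j. a powr (p j - 1)) \<longlonglongrightarrow> 1"
proof -
  assume a: "0 < a"
  have "(\<lambda>j. a powr (p j - 1)) \<longlonglongrightarrow> a powr (1 - 1)" using a by (intro tendsto_intros p_lim) auto
  then show ?thesis using a by simp
qed

lemma Gl_range: "0 \<le> Gl r" "Gl r \<le> 1"
proof -
  show "0 \<le> Gl r" by (rule LIMSEQ_le_const[OF Gl_lim]) (use V_bounds(5) in blast)
  show "Gl r \<le> 1" by (rule LIMSEQ_le[OF Gl_lim powr_p_lim[OF pos(3)]]) (use V_bounds(6) in blast)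
qed

lemma G_zero: "G j 0 = 0" by (simp add: G_def flux_def)

lemma Gl_zero: "Gl 0 = 0"
  using Gl_lim[of 0] by (simp add: G_zero LIMSEQ_const_iff)

lemma lim_meas [measurable]: "Vl \<in> borel_measurable borel" "Gl \<in> borel_measurable borel" "w \<in> borel_measurable borel"
    "Kl \<in> borel_measurable borel" "dGl \<in> borel_measurable borel"
proof -
  show [measurable]: "Vl \<in> borel_measurable borel" by (rule borel_measurable_LIMSEQ_real[OF Vl_lim V_meas(1)])
  show [measurable]: "Gl \<in> borel_measurable borel" by (rule borel_measurable_LIMSEQ_real[OF Gl_lim V_meas(4)])
  have [measurable]: "W0 \<in> borel_measurable borel" using W0_mono by (rule borel_measurable_mono)
  show [measurable]: "w \<in> borel_measurable borel" unfolding w_def[abs_def] by measurable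
  have "continuous_on UNIV Vl"
  proof -
    have "\<xi>2-lipschitz_on UNIV Vl" using Vl_lipschitz pos by (auto intro!: lipschitz_onI simp: dist_real_def)
    then show ?thesis by (rule lipschitz_on_continuous_on)
  qed
  then have "continuous_on UNIV (\<lambda>r. F1 (max 0 r, Vl r, 0))"
    by (intro continuous_on_compose2[OF F1_cont] continuous_intros) (auto simp: Vl_range)
  then have [measurable]: "(\<lambda>r. F1 (max 0 r, Vl r, 0)) \<in> borel_measurable borel" by (rule borel_measurable_continuous_onI)
  show [measurable]: "Kl \<in> borel_measurable borel" unfolding Kl_def[abs_def] by measurable
  show "dGl \<in> borel_measurable borel" unfolding dGl_def[abs_def] by measurable
qed

lemma AE_isCont: "AE r in lborel. isCont W0 r"
proof -
  have "countable {r. \<not> isCont W0 r}" using mono_ctble_discont[OF W0_mono] by simp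
  then have "AE r in lborel. r \<notin> {r. \<not> isCont W0 r}" by (intro AE_not_in countable_imp_null_set_lborel)
  then show ?thesis by simp
qed

lemma w_bounds: "max l r powr (- (real N - 1)) \<le> w r" "w r \<le> 1" "0 < w r"
proof -
  show le: "max l r powr (- (real N - 1)) \<le> w r" by (simp add: w_def)
  have "max l r powr (- (real N - 1)) \<le> max l r powr 0" using l_ge_1 N by (intro powr_mono) auto
  also have "\<dots> = 1" using l_ge_1 by (auto simp: max_def)
  finally show "w r \<le> 1" using l_ge_1 by (auto simp: w_def)
  have "0 < max l r powr (- (real N - 1))" using pos by simp
  with le show "0 < w r" by linarith
qed

text \<open>Both clamps in \<open>w\<close> are limits of bounds for
  \<open>V j r powr (p j - 1)\<close>: the upper one comes from
  \<open>\<xi>1 powr (p j - 1)\<close>, the lower one from the barrier. Hence they are inactive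
  here.\<close>

lemma w_lim:
  assumes r: "0 \<le> r" and "isCont W0 r"
  shows "(\<lambda>j. V j r powr (p j - 1)) \<longlonglongrightarrow> w r"
proof -
  note L = W0_lim[OF assms(2)]
  have "- W0 r \<le> 1"
  proof (rule LIMSEQ_le[OF L powr_p_lim[OF pos(2)]])
    have "V j r powr (p j - 1) \<le> \<xi>1 powr (p j - 1)" for j
      using V_bounds(1,2)[of j r] p_gt[of j] by (intro powr_mono2) auto
    then show "\<exists>N. \<forall>j\<ge>N. V j r powr (p j - 1) \<le> \<xi>1 powr (p j - 1)" by blast
  qed
  moreover have "max l r powr (- (real N - 1)) \<le> - W0 r"
  proof (rule LIMSEQ_le[OF _ L])
    have "(\<lambda>j. inverse \<xi>1 powr (p j - 1) * max l r powr (- (real N - p j))) \<longlonglongrightarrow> 1 * max l r powr (- (real N - 1))"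
      using pos by (intro tendsto_mult powr_p_lim tendsto_intros p_lim) auto
    then show "(\<lambda>j. inverse \<xi>1 powr (p j - 1) * max l r powr (- (real N - p j))) \<longlonglongrightarrow> max l r powr (- (real N - 1))"
      by simp
    show "\<exists>M. \<forall>j\<ge>M. inverse \<xi>1 powr (p j - 1) * max l r powr (- (real N - p j)) \<le> V j r powr (p j - 1)"
      using v_powr_lower[OF r] r by (simp add: V_def)
  qed
  ultimately have "w r = - W0 r" by (simp add: w_def)
  then show ?thesis using L by simp
qed

text \<open>A base with positive limit raised to an exponent tending to \<open>0\<close> tends to
  \<open>1\<close>.\<close>

lemma w_eq_1:
  assumes "0 \<le> r" "isCont W0 r" "0 < Vl r" shows "w r = 1"
proof (rule LIMSEQ_unique[OF w_lim[OF assms(1,2)]])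
  have "(\<lambda>j. V j r powr (p j - 1)) \<longlonglongrightarrow> Vl r powr (1 - 1)"
    using assms(3) by (intro tendsto_intros p_lim Vl_lim) auto
  then show "(\<lambda>j. V j r powr (p j - 1)) \<longlonglongrightarrow> 1" using assms(3) by simp
qed

lemma inverse_p_at_top: "filterlim (\<lambda>j. 1 / (p j - 1)) at_top sequentially"
proof -
  have "(\<lambda>j. p j - 1) \<longlonglongrightarrow> 1 - 1" by (intro tendsto_intros p_lim)
  then have "filterlim (\<lambda>j. inverse (p j - 1)) at_top sequentially"
    using p_gt by (intro filterlim_inverse_at_top) (auto intro!: always_eventually)
  then show ?thesis by (simp add: inverse_eq_divide)
qed

lemma dV_lim:
  assumes "Gl r < 1" shows "(\<lambda>j. dV j r) \<longlonglongrightarrow> 0"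
proof -
  \<comment> \<open>Any number strictly between \<open>Gl r\<close> and \<open>1\<close> serves:
    eventually the flux is below it, and \<open>\<delta> powr (1 / (p j - 1))\<close> tends to
    \<open>0\<close>.\<close>
  define \<delta> where "\<delta> = (1 + Gl r) / 2"
  have \<delta>: "0 < \<delta>" "\<delta> < 1" "Gl r < \<delta>" using assms Gl_range[of r] by (auto simp: \<delta>_def)
  have ev: "\<forall>\<^sub>F j in sequentially. G j r < \<delta>" using order_tendstoD(2)[OF Gl_lim \<delta>(3)] .
  show ?thesis
  proof (rule Lim_null_comparison)
    show "\<forall>\<^sub>F j in sequentially. norm (dV j r) \<le> exp (ln \<delta> * (1 / (p j - 1)))"
      using ev
    proof eventually_elim
      case (elim j)
      have "G j r powr (1 / (p j - 1)) \<le> \<delta> powr (1 / (p j - 1))"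
        using elim V_bounds(5)[of j r] p_gt[of j] by (intro powr_mono2) auto
      also have "\<dots> = exp (ln \<delta> * (1 / (p j - 1)))" using \<delta> by (simp add: powr_def)
      finally show ?case by (simp add: V_bounds(7))
    qed
    have "filterlim (\<lambda>j. ln \<delta> * (1 / (p j - 1))) at_bot sequentially"
      by (rule filterlim_tendsto_neg_mult_at_bot[OF tendsto_const _ inverse_p_at_top]) (use \<delta> in auto)
    then show "(\<lambda>j. exp (ln \<delta> * (1 / (p j - 1)))) \<longlonglongrightarrow> 0"
      by (rule filterlim_compose[OF exp_at_bot])
  qed
qed

text \<open>Function and argument both vary with \<open>j\<close>: uniform convergence on a compact
  box replaces \<open>F (p j)\<close> by \<open>F1\<close>, whose continuity then lets the argument
  converge. The last slot tends to \<open>0\<close> since the flux stays below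
  \<open>1\<close>.\<close>

lemma F_seq_lim:
  assumes r: "0 \<le> r" and "Gl r < 1"
  shows "(\<lambda>j. F (p j) (r, V j r, \<bar>dV j r\<bar>)) \<longlonglongrightarrow> F1 (r, Vl r, 0)"
proof -
  let ?D = "{r} \<times> {0..\<xi>1} \<times> {0..\<xi>2}"
  have D: "compact ?D" "?D \<subseteq> {0..} \<times> {0..} \<times> {0..}" using r by (auto intro!: compact_Times)
  have xD: "(r, V j r, \<bar>dV j r\<bar>) \<in> ?D" for j using V_bounds[of j r] by auto
  have lim: "(\<lambda>j. (r, V j r, \<bar>dV j r\<bar>)) \<longlonglongrightarrow> (r, Vl r, 0)"
    using dV_lim[OF assms(2)] by (intro tendsto_Pair tendsto_const Vl_lim tendsto_rabs_zero)
  have "uniform_limit ?D F F1 (at_right 1)" using F_lim D unfolding loc_uniform_limit_def by blast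
  then have u: "uniform_limit ?D (\<lambda>j. F (p j)) F1 sequentially"
    by (rule filterlim_compose[OF _ p_at_right])
  have "(\<lambda>j. F (p j) (r, V j r, \<bar>dV j r\<bar>) - F1 (r, V j r, \<bar>dV j r\<bar>)) \<longlonglongrightarrow> 0"
  proof (rule tendstoI)
    fix e :: real assume "0 < e"
    from uniform_limitD[OF u this]
    show "\<forall>\<^sub>F j in sequentially. dist (F (p j) (r, V j r, \<bar>dV j r\<bar>) - F1 (r, V j r, \<bar>dV j r\<bar>)) 0 < e"
      by eventually_elim (use xD in \<open>auto simp: dist_real_def\<close>)
  qed
  moreover have "(\<lambda>j. F1 (r, V j r, \<bar>dV j r\<bar>)) \<longlonglongrightarrow> F1 (r, Vl r, 0)"
    by (rule continuous_on_tendsto_compose[OF F1_cont lim])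
       (use r Vl_range xD D in \<open>auto intro!: always_eventually less_imp_le[OF V_bounds(1)]\<close>)
  ultimately have "(\<lambda>j. F (p j) (r, V j r, \<bar>dV j r\<bar>) - F1 (r, V j r, \<bar>dV j r\<bar>) + F1 (r, V j r, \<bar>dV j r\<bar>)) \<longlonglongrightarrow> 0 + F1 (r, Vl r, 0)"
    by (rule tendsto_add)
  then show ?thesis by simp
qed

text \<open>The singular factor is rewritten as
  \<open>(V j r powr (p j - 1)) powr (- (\<beta> (p j) / (p j - 1)))\<close>, whose base and
  exponent both converge; this produces \<open>w r powr (- c)\<close>.\<close>

lemma K_lim:
  assumes r: "0 \<le> r" and "isCont W0 r" "Gl r < 1"
  shows "(\<lambda>j. K j r) \<longlonglongrightarrow> Kl r"
proof -
  have "(\<lambda>j. \<beta> (p j) / (p j - 1)) \<longlonglongrightarrow> c" by (rule filterlim_compose[OF \<beta>_lim p_at_right])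
  then have "(\<lambda>j. (V j r powr (p j - 1)) powr (- (\<beta> (p j) / (p j - 1)))) \<longlonglongrightarrow> w r powr (- c)"
    using w_bounds(3)[of r] by (intro tendsto_powr w_lim assms tendsto_minus) auto
  moreover have "(V j r powr (p j - 1)) powr (- (\<beta> (p j) / (p j - 1))) = V j r powr (- \<beta> (p j))" for j
    using p_gt(1)[of j] by (simp add: powr_powr)
  ultimately have "(\<lambda>j. V j r powr (- \<beta> (p j))) \<longlonglongrightarrow> w r powr (- c)" by simp
  from tendsto_mult[OF F_seq_lim[OF r assms(3)] this] show ?thesis
    using assms by (simp add: K_def source_def V_def dV_def Kl_def mult.commute)
qed

lemma Gl_linear:
  assumes "0 \<le> r" "r \<le> R" and C: "\<And>j r. 0 \<le> r \<Longrightarrow> r \<le> R \<Longrightarrow> K j r \<le> C"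
  shows "Gl r \<le> C * r / real N"
  by (rule LIMSEQ_le_const2[OF Gl_lim]) (use G_le_linear[OF assms] in blast)

lemma Kl_eq: "0 \<le> r \<Longrightarrow> Kl r = dGl r + (real N - 1) / r * Gl r"
  using Gl_range(2)[of r] by (auto simp: dGl_def Kl_def)

lemma Kl_bounds: "\<exists>C. \<forall>r. 0 \<le> r \<longrightarrow> r \<le> R \<longrightarrow> \<bar>dGl r\<bar> \<le> C \<and> \<bar>Kl r\<bar> \<le> C"
proof -
  obtain C where C: "0 \<le> C" "\<And>j r. 0 \<le> r \<Longrightarrow> r \<le> R \<Longrightarrow> K j r \<le> C" using K_bound[of R] by blast
  obtain C1 where C1: "\<And>r u \<rho>. 0 \<le> r \<Longrightarrow> r \<le> R \<Longrightarrow> 0 \<le> u \<Longrightarrow> u \<le> \<xi>1 \<Longrightarrow> 0 \<le> \<rho> \<Longrightarrow> \<rho> \<le> \<xi>2 \<Longrightarrow> \<bar>F1 (r, u, \<rho>)\<bar> \<le> C1"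
    using F_bound[of R] by blast
  define C2 where "C2 = max l R powr (real N - 1) * C1"
  have "\<bar>dGl r\<bar> \<le> \<bar>C2\<bar> + C \<and> \<bar>Kl r\<bar> \<le> (\<bar>C2\<bar> + C) + C" if r: "0 \<le> r" "r \<le> R" for r
  proof -
    have g: "\<bar>(real N - 1) / r * Gl r\<bar> \<le> C"
    proof (cases "r = 0")
      case False
      have "\<bar>(real N - 1) / r * Gl r\<bar> = (real N - 1) / r * Gl r" using r N Gl_range(1)[of r] by simp
      also have "\<dots> \<le> (real N - 1) / r * (C * r / real N)"
        using r N by (intro mult_left_mono Gl_linear[where R=R] C) auto
      also have "\<dots> = C * ((real N - 1) / real N)" using False by simp
      also have "\<dots> \<le> C * 1" using N C by (intro mult_left_mono) auto
      finally show ?thesis by simp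
    qed (use C in simp)
    have k: "\<bar>Kl r\<bar> \<le> C2" if "Gl r < 1"
    proof -
      \<comment> \<open>The negative exponent turns the lower bound for \<open>w\<close> into an
        upper bound; then \<open>c \<le> 1\<close> and \<open>max l r \<ge> 1\<close> remove
        \<open>c\<close>.\<close>
      have "w r powr (- c) \<le> (max l r powr (- (real N - 1))) powr (- c)"
        using w_bounds[of r] pos c by (intro powr_mono2') auto
      also have "\<dots> = max l r powr ((real N - 1) * c)" by (simp only: powr_powr minus_mult_minus)
      also have "\<dots> \<le> max l r powr (real N - 1)"
        using l_ge_1 N c mult_left_mono[of c 1 "real N - 1"] by (intro powr_mono) auto
      also have "\<dots> \<le> max l R powr (real N - 1)" using r l_ge_1 N by (intro powr_mono2) auto
      finally have "w r powr (- c) \<le> max l R powr (real N - 1)" .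
      moreover have "\<bar>F1 (r, Vl r, 0)\<bar> \<le> C1" using r Vl_range[of r] pos by (intro C1) auto
      ultimately have "w r powr (- c) * \<bar>F1 (r, Vl r, 0)\<bar> \<le> C2"
        unfolding C2_def by (intro mult_mono) auto
      then show ?thesis using that r by (simp add: Kl_def abs_mult)
    qed
    have d: "\<bar>dGl r\<bar> \<le> \<bar>C2\<bar> + C"
    proof (cases "Gl r < 1")
      case True
      then have "dGl r = Kl r - (real N - 1) / r * Gl r" by (simp add: dGl_def)
      then have "\<bar>dGl r\<bar> \<le> \<bar>Kl r\<bar> + \<bar>(real N - 1) / r * Gl r\<bar>" by (simp only: abs_triangle_ineq4)
      then show ?thesis using k[OF True] g by linarith
    next
      case False
      then show ?thesis using C by (simp add: dGl_def)
    qed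
    moreover have "\<bar>Kl r\<bar> \<le> (\<bar>C2\<bar> + C) + C"
      unfolding Kl_eq[OF r(1)] using d g by (intro order_trans[OF abs_triangle_ineq] add_mono)
    ultimately show ?thesis by simp
  qed
  then have "\<forall>r. 0 \<le> r \<longrightarrow> r \<le> R \<longrightarrow> \<bar>dGl r\<bar> \<le> (\<bar>C2\<bar> + C) + C \<and> \<bar>Kl r\<bar> \<le> (\<bar>C2\<bar> + C) + C"
    using C(1) by fastforce
  then show ?thesis by blast
qed

text \<open>On \<open>{G = 1}\<close> the derivatives of \<open>G j\<close> need not converge. The cut-off \<open>1 - (G j)^m\<close> removes this
  set in the limit \<open>j \<rightarrow> \<infinity>\<close>, and letting then \<open>m \<rightarrow> \<infinity>\<close> identifies the weak derivative of the limit, which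
  vanishes there.\<close>

lemma dGl_integral:
  assumes r: "0 \<le> r"
  shows "Gl r - Gl 0 = (LBINT t:{0..r}. dGl t)"
proof -
  obtain C where C: "0 \<le> C" "\<And>j r'. 0 \<le> r' \<Longrightarrow> r' \<le> r \<Longrightarrow> K j r' \<le> C" using K_bound[of r] by blast
  obtain C' where C': "\<And>t. 0 \<le> t \<Longrightarrow> t \<le> r \<Longrightarrow> \<bar>dGl t\<bar> \<le> C'" using Kl_bounds[of r] by blast
  define M where "M = max 1 \<xi>2"
  have M: "0 \<le> G j t" "G j t \<le> M" for j t using V_bounds(5) G_le_max by (auto simp: M_def)
  \<comment> \<open>A primitive of \<open>1 - t^m\<close>. On \<open>[0,1]\<close>, the range of the
    limit flux, it tends to the identity as \<open>m\<close> grows.\<close>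
  define \<Phi> where "\<Phi> m t = t - t ^ Suc m / real (Suc m)" for m :: nat and t :: real
  have \<Phi>': "(\<Phi> m has_real_derivative 1 - t ^ m) (at t)" for m t
    unfolding \<Phi>_def[abs_def]
    by (rule derivative_eq_intros refl | simp)+
  have cut: "\<bar>(1 - G j t ^ m) * dG j t\<bar> \<le> (1 + M ^ m) * (2 * C)" if "0 \<le> t" "t \<le> r" for j t m
  proof -
    have "\<bar>1 - G j t ^ m\<bar> \<le> 1 + M ^ m"
      using power_mono[OF M(2) M(1), of j t m] zero_le_power[OF M(1), of j t m] by linarith
    then show ?thesis unfolding abs_mult
      using dG_bound[OF that C(2) C(1), of j] by (intro mult_mono) auto
  qed
  have step1: "\<Phi> m (G j r) - \<Phi> m (G j 0) = (LBINT t. indicator {0..r} t * ((1 - G j t ^ m) * dG j t))" for m j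
  proof -
    have c: "continuous_on {0..} (\<lambda>t. \<Phi> m (G j t))" unfolding \<Phi>_def by (intro continuous_intros V_cont) auto
    have "(LBINT t:{0..r}. (1 - G j t ^ m) * dG j t) = \<Phi> m (G j r) - \<Phi> m (G j 0)"
    proof (rule set_integral_derivative[OF r _ _ _ cut])
      show "((\<lambda>t. \<Phi> m (G j t)) has_real_derivative (1 - G j t ^ m) * dG j t) (at t)" if "0 < t" for t
        using DERIV_chain2[OF \<Phi>' V_deriv(2)[OF that]] .
    qed (auto intro: continuous_on_subset[OF c])
    then show ?thesis by (simp add: set_lebesgue_integral_def)
  qed
  have step2: "\<Phi> m (Gl r) - \<Phi> m (Gl 0) = (LBINT t. indicator {0..r} t * ((1 - Gl t ^ m) * dGl t))" for m
  proof (rule LIMSEQ_unique)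
    show "(\<lambda>j. \<Phi> m (G j r) - \<Phi> m (G j 0)) \<longlonglongrightarrow> \<Phi> m (Gl r) - \<Phi> m (Gl 0)"
      unfolding \<Phi>_def by (intro tendsto_intros Gl_lim) auto
    show "(\<lambda>j. \<Phi> m (G j r) - \<Phi> m (G j 0)) \<longlonglongrightarrow> (LBINT t. indicator {0..r} t * ((1 - Gl t ^ m) * dGl t))"
      unfolding step1
    proof (rule integral_dominated_convergence[where w="\<lambda>t. indicator {0..r} t * ((1 + M ^ m) * (2 * C))"])
      show "integrable lborel (\<lambda>t. indicator {0..r} t * ((1 + M ^ m) * (2 * C)))"
        by (rule integrable_Icc_bounded) auto
      show "AE t in lborel. norm (indicator {0..r} t * ((1 - G j t ^ m) * dG j t)) \<le> indicator {0..r} t * ((1 + M ^ m) * (2 * C))" for j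
      proof (rule AE_I2)
        fix t show "norm (indicator {0..r} t * ((1 - G j t ^ m) * dG j t)) \<le> indicator {0..r} t * ((1 + M ^ m) * (2 * C))"
          using cut[of t j m] by (auto simp: indicator_def)
      qed
      show "AE t in lborel. (\<lambda>j. indicator {0..r} t * ((1 - G j t ^ m) * dG j t)) \<longlonglongrightarrow> indicator {0..r} t * ((1 - Gl t ^ m) * dGl t)"
        using AE_isCont
      proof eventually_elim
        case (elim t)
        show ?case
        proof (cases "t \<in> {0..r}")
          case True
          have Gm: "(\<lambda>j. 1 - G j t ^ m) \<longlonglongrightarrow> 1 - Gl t ^ m" by (intro tendsto_intros Gl_lim)
          have "(\<lambda>j. (1 - G j t ^ m) * dG j t) \<longlonglongrightarrow> (1 - Gl t ^ m) * dGl t"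
          proof (cases "Gl t < 1")
            case lt: True
            have "(\<lambda>j. dG j t) \<longlonglongrightarrow> Kl t - (real N - 1) / t * Gl t"
              unfolding dG_def using True lt elim by (intro tendsto_intros K_lim Gl_lim) auto
            then show ?thesis using lt by (intro tendsto_mult Gm) (simp add: dGl_def)
          next
            case False
            then have G1: "Gl t = 1" using Gl_range(2)[of t] by simp
            have "(\<lambda>j. 2 * C * \<bar>1 - G j t ^ m\<bar>) \<longlonglongrightarrow> 2 * C * \<bar>1 - Gl t ^ m\<bar>" by (intro tendsto_intros Gl_lim)
            then have "(\<lambda>j. 2 * C * \<bar>1 - G j t ^ m\<bar>) \<longlonglongrightarrow> 0" by (simp add: G1)
            moreover have "\<forall>\<^sub>F j in sequentially. norm ((1 - G j t ^ m) * dG j t) \<le> 2 * C * \<bar>1 - G j t ^ m\<bar>"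
              using dG_bound[OF _ _ C(2) C(1), of t] True
              by (intro always_eventually allI) (auto simp: abs_mult mult.commute[of "2 * C"] intro!: mult_left_mono)
            ultimately have "(\<lambda>j. (1 - G j t ^ m) * dG j t) \<longlonglongrightarrow> 0" by (rule Lim_null_comparison[rotated])
            then show ?thesis by (simp add: G1)
          qed
          then show ?thesis using True by simp
        qed simp
      qed
    qed measurable
  qed
  show ?thesis
  proof (rule LIMSEQ_unique)
    have \<Phi>lim: "(\<lambda>m. \<Phi> m a) \<longlonglongrightarrow> a" if a: "0 \<le> a" "a \<le> 1" for a
    proof -
      have "(\<lambda>m. a ^ Suc m / real (Suc m)) \<longlonglongrightarrow> 0"
      proof (rule Lim_null_comparison)
        show "(\<lambda>m. inverse (real (Suc m))) \<longlonglongrightarrow> 0" by (rule LIMSEQ_inverse_real_of_nat)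
        have "a ^ Suc m \<le> 1" for m using a by (rule power_le_one)
        then show "\<forall>\<^sub>F m in sequentially. norm (a ^ Suc m / real (Suc m)) \<le> inverse (real (Suc m))"
          using a by (intro always_eventually allI) (simp add: divide_simps del: power_Suc)
      qed
      from tendsto_diff[OF tendsto_const[of a] this] show ?thesis by (simp add: \<Phi>_def)
    qed
    show "(\<lambda>m. \<Phi> m (Gl r) - \<Phi> m (Gl 0)) \<longlonglongrightarrow> Gl r - Gl 0"
      by (intro tendsto_diff \<Phi>lim Gl_range)
    show "(\<lambda>m. \<Phi> m (Gl r) - \<Phi> m (Gl 0)) \<longlonglongrightarrow> (LBINT t:{0..r}. dGl t)"
      unfolding step2 set_lebesgue_integral_def real_scaleR_def
    proof (rule integral_dominated_convergence[where w="\<lambda>t. indicator {0..r} t * C'"])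
      show "integrable lborel (\<lambda>t. indicator {0..r} t * C')" by (rule integrable_Icc_bounded) auto
      show "AE t in lborel. norm (indicator {0..r} t * ((1 - Gl t ^ m) * dGl t)) \<le> indicator {0..r} t * C'" for m
      proof (rule AE_I2)
        fix t
        have "\<bar>1 - Gl t ^ m\<bar> \<le> 1" using Gl_range[of t] power_le_one[of "Gl t" m] by simp
        then have "\<bar>(1 - Gl t ^ m) * dGl t\<bar> \<le> 1 * C'" if "0 \<le> t" "t \<le> r"
          unfolding abs_mult using C'[OF that] by (intro mult_mono) auto
        then show "norm (indicator {0..r} t * ((1 - Gl t ^ m) * dGl t)) \<le> indicator {0..r} t * C'"
          by (auto simp: indicator_def)
      qed
      show "AE t in lborel. (\<lambda>m. indicator {0..r} t * ((1 - Gl t ^ m) * dGl t)) \<longlonglongrightarrow> indicator {0..r} t * dGl t"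
      proof (rule AE_I2)
        fix t
        \<comment> \<open>Below \<open>1\<close> the powers die out and the factor tends to
          \<open>1\<close>; where \<open>Gl t = 1\<close> both sides vanish because
          \<open>dGl\<close> is \<open>0\<close> by definition.\<close>
        have "(\<lambda>m. (1 - Gl t ^ m) * dGl t) \<longlonglongrightarrow> dGl t"
        proof (cases "Gl t < 1")
          case True
          have "(\<lambda>m. Gl t ^ m) \<longlonglongrightarrow> 0" using Gl_range[of t] True by (intro LIMSEQ_realpow_zero) auto
          then have "(\<lambda>m. (1 - Gl t ^ m) * dGl t) \<longlonglongrightarrow> (1 - 0) * dGl t"
            by (intro tendsto_mult tendsto_diff tendsto_const)
          then show ?thesis by simp
        qed (simp add: dGl_def)
        then show "(\<lambda>m. indicator {0..r} t * ((1 - Gl t ^ m) * dGl t)) \<longlonglongrightarrow> indicator {0..r} t * dGl t"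
          by (rule tendsto_mult_left)
      qed
    qed measurable
  qed
qed

lemma radial_approx_G: "\<exists>B. radial_approx G dG Gl dGl B"
proof -
  have "\<forall>R. \<exists>C. \<forall>r. 0 \<le> r \<longrightarrow> r \<le> R \<longrightarrow> (\<forall>j. \<bar>G j r\<bar> \<le> C \<and> \<bar>dG j r\<bar> \<le> C) \<and> \<bar>dGl r\<bar> \<le> C"
  proof
    fix R
    obtain C where C: "0 \<le> C" "\<And>j r'. 0 \<le> r' \<Longrightarrow> r' \<le> R \<Longrightarrow> K j r' \<le> C" using K_bound[of R] by blast
    obtain C' where C': "\<And>t. 0 \<le> t \<Longrightarrow> t \<le> R \<Longrightarrow> \<bar>dGl t\<bar> \<le> C'" using Kl_bounds[of R] by blast
    show "\<exists>C. \<forall>r. 0 \<le> r \<longrightarrow> r \<le> R \<longrightarrow> (\<forall>j. \<bar>G j r\<bar> \<le> C \<and> \<bar>dG j r\<bar> \<le> C) \<and> \<bar>dGl r\<bar> \<le> C"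
    proof (intro exI[of _ "max 1 \<xi>2 + 2 * C + \<bar>C'\<bar>"] allI impI conjI)
      fix r j assume r: "0 \<le> r" "r \<le> R"
      show "\<bar>G j r\<bar> \<le> max 1 \<xi>2 + 2 * C + \<bar>C'\<bar>" using V_bounds(5)[of j r] G_le_max[of j r] C(1) by linarith
      show "\<bar>dG j r\<bar> \<le> max 1 \<xi>2 + 2 * C + \<bar>C'\<bar>" using dG_bound[OF r C(2) C(1), of j] by linarith
    next
      fix r assume r: "0 \<le> r" "r \<le> R"
      show "\<bar>dGl r\<bar> \<le> max 1 \<xi>2 + 2 * C + \<bar>C'\<bar>" using C'[OF r] C(1) by linarith
    qed
  qed
  then obtain B where B: "\<And>R r j. 0 \<le> r \<Longrightarrow> r \<le> R \<Longrightarrow> \<bar>G j r\<bar> \<le> B R"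
      "\<And>R r j. 0 \<le> r \<Longrightarrow> r \<le> R \<Longrightarrow> \<bar>dG j r\<bar> \<le> B R" "\<And>R r. 0 \<le> r \<Longrightarrow> r \<le> R \<Longrightarrow> \<bar>dGl r\<bar> \<le> B R"
    by metis
  have "radial_approx G dG Gl dGl B"
    by unfold_locales (use V_cont V_deriv Gl_lim dGl_integral B in auto)
  then show ?thesis by blast
qed

text \<open>The Lipschitz limit has some integrand \<open>h\<close>, known only up to null sets. The
  bounds \<open>- \<xi>2 \<le> dV j \<le> 0\<close> and the pointwise limit \<open>0\<close> on
  \<open>{G < 1}\<close> pass to \<open>h\<close> almost everywhere, and \<open>h\<close> is then
  corrected so that they hold at every radius.\<close>

lemma radial_approx_V:
  obtains dVl where "radial_approx V dV Vl dVl (\<lambda>_. max \<xi>1 \<xi>2)"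
    "\<And>r. dVl r \<le> 0" "\<And>r. - \<xi>2 \<le> dVl r" "\<And>r. dVl r * Gl r = dVl r"
proof -
  obtain h where [measurable]: "h \<in> borel_measurable borel"
    and hi: "\<And>a b. a \<le> b \<Longrightarrow> set_integrable lborel {a..b} h"
    and he: "\<And>a b. a \<le> b \<Longrightarrow> Vl b - Vl a = (LBINT t:{a..b}. h t)"
    using lipschitz_indefinite_integral[OF Vl_lipschitz] by blast
  have Vi: "set_integrable lborel {a..b} (dV j)" for a b j
    by (rule set_integrable_bounded[where C=\<xi>2]) (use V_bounds(3) in auto)
  have FTC: "V j b - V j a = (LBINT t:{a..b}. dV j t)" if "0 \<le> a" "a \<le> b" for a b j
    by (rule set_integral_derivative[where C=\<xi>2, symmetric])
       (use that V_deriv(1) V_bounds(3) in \<open>auto intro: continuous_on_subset[OF V_cont(1)]\<close>)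
  \<comment> \<open>The integrals over \<open>[0,r]\<close> converge because they are increments of
    \<open>V j\<close>. Extending this to Borel sets permits testing on the very sets where
    \<open>h\<close> might misbehave.\<close>
  have conv: "(\<lambda>j. LBINT x:A \<inter> {0..R}. dV j x) \<longlonglongrightarrow> (LBINT x:A \<inter> {0..R}. h x)"
    if A: "A \<in> sets borel" and R: "0 \<le> R" for A R
  proof -
    define k where "k f x = indicator {0..R} x * f x" for f :: "real \<Rightarrow> real" and x
    have km: "k f \<in> borel_measurable borel" if [measurable]: "f \<in> borel_measurable borel" for f
      unfolding k_def by measurable
    have kA: "(LBINT x:A. k f x) = (LBINT x:A \<inter> {0..R}. f x)" for f A
      unfolding set_lebesgue_integral_def k_def
      by (rule Bochner_Integration.integral_cong) (auto simp: indicator_def)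
    have full: "integral\<^sup>L lborel (k f) = (LBINT x:{0..R}. f x)" for f
      unfolding set_lebesgue_integral_def k_def by simp
    have Rlim: "(\<lambda>j. LBINT x:{0..r}. dV j x) \<longlonglongrightarrow> (LBINT x:{0..r}. h x)" if "0 \<le> r" for r
      unfolding he[OF that, symmetric] FTC[OF order_refl that, symmetric] by (intro tendsto_diff Vl_lim)
    have "(\<lambda>j. LBINT x:A. k (dV j) x) \<longlonglongrightarrow> (LBINT x:A. k h x)"
    proof (rule tendsto_set_integral_borel[OF _ _ _ _ _ _ A, where b="\<lambda>x. indicator {0..R} x * \<xi>2"])
      show "k (dV j) \<in> borel_measurable borel" for j by (rule km) measurable
      show "integrable lborel (k h)" using hi[OF R] unfolding set_integrable_def k_def by simp
      show "integrable lborel (\<lambda>x. indicator {0..R} x * \<xi>2)" by (rule integrable_Icc_bounded) auto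
      show "\<bar>k (dV j) x\<bar> \<le> indicator {0..R} x * \<xi>2" for j x
        using V_bounds(3)[of j x] by (auto simp: k_def indicator_def)
      show "(\<lambda>j. integral\<^sup>L lborel (k (dV j))) \<longlonglongrightarrow> integral\<^sup>L lborel (k h)"
        unfolding full by (rule Rlim[OF R])
      show "(\<lambda>j. LBINT x:{..r}. k (dV j) x) \<longlonglongrightarrow> (LBINT x:{..r}. k h x)" for r
      proof (cases "0 \<le> r")
        case True
        have "{..r} \<inter> {0..R} = {0..min r R}" using True by auto
        then show ?thesis unfolding kA using Rlim[of "min r R"] True R by simp
      next
        case False
        then have "{..r} \<inter> {0..R} = {}" by auto
        then show ?thesis unfolding kA by (simp add: set_lebesgue_integral_def)
      qed
    qed
    then show ?thesis unfolding kA .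
  qed
  have sub: "set_integrable lborel (A \<inter> {0..R}) h" if "A \<in> sets borel" "0 \<le> R" for A R
    by (rule set_integrable_subset[OF hi[OF that(2)]]) (use that in auto)
  have subV: "set_integrable lborel (A \<inter> {0..R}) (dV j)" if "A \<in> sets borel" "0 \<le> R" for A R j
    by (rule set_integrable_subset[OF Vi]) (use that in auto)
  have dV0: "dV j r \<le> 0" for j r by (simp add: V_bounds(7))
  define A1 where "A1 = {r. 0 < h r}"
  define A2 where "A2 = {r. h r < - \<xi>2}"
  define A3 where "A3 = {r. Gl r < 1 \<and> h r < 0}"
  have [measurable]: "A1 \<in> sets borel" "A2 \<in> sets borel" "A3 \<in> sets borel"
    unfolding A1_def A2_def A3_def by measurable
  have n1: "AE x in lborel. x \<notin> A1 \<inter> {0..R}" if R: "0 \<le> R" for R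
  proof (rule AE_set_integral_nonneg_imp[OF _ sub])
    show "(LBINT x:A1 \<inter> {0..R}. h x) \<le> 0"
    proof (rule LIMSEQ_le_const2[OF conv[OF _ R]])
      have "(LBINT x:A1 \<inter> {0..R}. dV j x) \<le> 0" for j
      proof -
        have "(LBINT x:A1 \<inter> {0..R}. dV j x) \<le> (LBINT x:A1 \<inter> {0..R}. 0)"
          by (rule set_integral_mono[OF subV[OF _ R]]) (use dV0 in \<open>auto simp: set_integrable_def\<close>)
        then show ?thesis by (simp add: set_lebesgue_integral_def)
      qed
      then show "\<exists>N. \<forall>j\<ge>N. (LBINT x:A1 \<inter> {0..R}. dV j x) \<le> 0" by blast
    qed measurable
  qed (use R in \<open>auto simp: A1_def\<close>)
  have n2: "AE x in lborel. x \<notin> A2 \<inter> {0..R}" if R: "0 \<le> R" for R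
  proof (rule AE_set_integral_nonneg_imp)
    have ci: "set_integrable lborel (A2 \<inter> {0..R}) (\<lambda>_. - \<xi>2)"
      by (rule set_integrable_bounded[where C=\<xi>2]) (use pos in auto)
    show "set_integrable lborel (A2 \<inter> {0..R}) (\<lambda>x. - \<xi>2 - h x)" by (intro set_integral_diff ci sub R) measurable
    have "(LBINT x:A2 \<inter> {0..R}. - \<xi>2) \<le> (LBINT x:A2 \<inter> {0..R}. h x)"
    proof (rule LIMSEQ_le_const[OF conv[OF _ R]])
      have "(LBINT x:A2 \<inter> {0..R}. - \<xi>2) \<le> (LBINT x:A2 \<inter> {0..R}. dV j x)" for j
      proof (rule set_integral_mono[OF ci subV])
        show "- \<xi>2 \<le> dV j x" for x using V_bounds(3)[of j x] by linarith
      qed (use R in auto)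
      then show "\<exists>N. \<forall>j\<ge>N. (LBINT x:A2 \<inter> {0..R}. - \<xi>2) \<le> (LBINT x:A2 \<inter> {0..R}. dV j x)" by blast
    qed measurable
    then show "(LBINT x:A2 \<inter> {0..R}. - \<xi>2 - h x) \<le> 0"
      using set_integral_diff(2)[OF ci sub[OF _ R]] by simp
  qed (auto simp: A2_def)
  \<comment> \<open>On \<open>A3\<close> the derivatives tend to \<open>0\<close> pointwise and
    boundedly, so the integral of \<open>h\<close> over it is \<open>0\<close>, although
    \<open>h\<close> is negative there.\<close>
  have n3: "AE x in lborel. x \<notin> A3 \<inter> {0..R}" if R: "0 \<le> R" for R
  proof (rule AE_set_integral_nonneg_imp)
    have s3: "set_integrable lborel (A3 \<inter> {0..R}) h" by (rule sub[OF _ R]) measurable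
    show "set_integrable lborel (A3 \<inter> {0..R}) (\<lambda>x. - h x)" using s3 by (simp add: set_integrable_def)
    have "(\<lambda>j. LBINT x:A3 \<inter> {0..R}. dV j x) \<longlonglongrightarrow> integral\<^sup>L lborel (\<lambda>x::real. 0)"
      unfolding set_lebesgue_integral_def
    proof (rule integral_dominated_convergence[where w="\<lambda>x. indicator {0..R} x * \<xi>2"])
      show "integrable lborel (\<lambda>x. indicator {0..R} x * \<xi>2)" by (rule integrable_Icc_bounded) auto
      show "AE x in lborel. norm (indicator (A3 \<inter> {0..R}) x *\<^sub>R dV j x) \<le> indicator {0..R} x * \<xi>2" for j
      proof (rule AE_I2)
        fix x show "norm (indicator (A3 \<inter> {0..R}) x *\<^sub>R dV j x) \<le> indicator {0..R} x * \<xi>2"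
          using V_bounds(3)[of j x] pos by (auto simp: indicator_def)
      qed
      show "AE x in lborel. (\<lambda>j. indicator (A3 \<inter> {0..R}) x *\<^sub>R dV j x) \<longlonglongrightarrow> 0"
      proof (rule AE_I2)
        fix x show "(\<lambda>j. indicator (A3 \<inter> {0..R}) x *\<^sub>R dV j x) \<longlonglongrightarrow> 0"
          using dV_lim[of x] by (cases "x \<in> A3 \<inter> {0..R}") (auto simp: A3_def)
      qed
    qed measurable
    then have "(LBINT x:A3 \<inter> {0..R}. h x) = 0"
      using LIMSEQ_unique[OF conv[OF _ R, of A3]] by simp
    then show "(LBINT x:A3 \<inter> {0..R}. - h x) \<le> 0" by (simp add: set_lebesgue_integral_def)
  qed (auto simp: A3_def)
  \<comment> \<open>Setting the integrand to \<open>0\<close> on the three bad sets alters it only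
    on a null subset of the half line. What survives is nonzero only where \<open>Gl r = 1\<close>,
    whence \<open>dVl r * Gl r = dVl r\<close>.\<close>
  define dVl where "dVl r = (if - \<xi>2 \<le> h r \<and> h r \<le> 0 \<and> \<not> Gl r < 1 then h r else 0)" for r
  have [measurable]: "dVl \<in> borel_measurable borel" unfolding dVl_def by measurable
  have eq: "AE x in lborel. x \<in> {0..R} \<longrightarrow> h x = dVl x" if R: "0 \<le> R" for R
    using n1[OF R] n2[OF R] n3[OF R]
  proof eventually_elim
    case (elim x)
    then show ?case by (auto simp: A1_def A2_def A3_def dVl_def not_less)
  qed
  have dVl_range: "dVl r \<le> 0" "- \<xi>2 \<le> dVl r" for r using pos by (auto simp: dVl_def)
  show thesis
  proof
    show "dVl r \<le> 0" "- \<xi>2 \<le> dVl r" for r by (fact dVl_range)+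
    show "dVl r * Gl r = dVl r" for r using Gl_range(2)[of r] by (auto simp: dVl_def)
    show "radial_approx V dV Vl dVl (\<lambda>_. max \<xi>1 \<xi>2)"
    proof
      show "\<bar>V j r\<bar> \<le> max \<xi>1 \<xi>2" for j r using V_bounds(1,2)[of j r] by linarith
      show "\<bar>dV j r\<bar> \<le> max \<xi>1 \<xi>2" for j r using V_bounds(3)[of j r] by linarith
      show "\<bar>dVl r\<bar> \<le> max \<xi>1 \<xi>2" for r using dVl_range[of r] by linarith
      show "Vl r - Vl 0 = (LBINT t:{0..r}. dVl t)" if r: "0 \<le> r" for r
      proof -
        have "(LBINT t:{0..r}. h t) = (LBINT t:{0..r}. dVl t)"
          unfolding set_lebesgue_integral_def
        proof (rule integral_cong_AE)
          show "AE x in lborel. indicator {0..r} x *\<^sub>R h x = indicator {0..r} x *\<^sub>R dVl x"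
            using eq[OF r] by eventually_elim (auto simp: indicator_def)
        qed measurable
        then show ?thesis using he[OF r] by simp
      qed
    qed (use V_cont V_deriv Vl_lim in auto)
  qed
qed

end

section \<open>Convergence in the space and behaviour near the origin\<close>

context p_laplace_limit
begin

lemma loc_uniform_V:
  "loc_uniform_limit UNIV (\<lambda>j (x::'a::euclidean_space). vp (p j) (norm x)) (\<lambda>x. Vl (norm x)) sequentially"
  unfolding loc_uniform_limit_def
proof (intro allI impI uniform_limitI)
  fix A :: "'a set" and e :: real assume A: "compact A \<and> A \<subseteq> UNIV" and e: "0 < e"
  then obtain R where R: "\<And>x. x \<in> A \<Longrightarrow> norm x \<le> R" using compact_imp_bounded bounded_iff by metis
  show "\<forall>\<^sub>F j in sequentially. \<forall>x\<in>A. dist (vp (p j) (norm x)) (Vl (norm x)) < e"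
    using uniform_limitD[OF v0_lim[of R] e]
  proof eventually_elim
    case (elim j)
    show ?case
    proof
      fix x assume "x \<in> A"
      then have "dist (V j (norm x)) (v0 (norm x)) < e" using elim R by simp
      then show "dist (vp (p j) (norm x)) (Vl (norm x)) < e" by (simp add: V_def Vl_def)
    qed
  qed
qed

lemma loc_uniform_G:
  "loc_uniform_limit {0..} (\<lambda>j. flux N (source (F (p j)) (\<beta> (p j)) (vp (p j)))) Gl sequentially"
  unfolding loc_uniform_limit_def
proof (intro allI impI uniform_limitI)
  fix A :: "real set" and e :: real assume A: "compact A \<and> A \<subseteq> {0..}" and e: "0 < e"
  then obtain R where R: "\<And>x. x \<in> A \<Longrightarrow> norm x \<le> R" using compact_imp_bounded bounded_iff by metis
  show "\<forall>\<^sub>F j in sequentially. \<forall>x\<in>A. dist (flux N (source (F (p j)) (\<beta> (p j)) (vp (p j))) x) (Gl x) < e"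
    using uniform_limitD[OF G0_lim[of R] e]
  proof eventually_elim
    case (elim j)
    show ?case
    proof
      fix x assume x: "x \<in> A"
      then have x0: "0 \<le> x" "x \<le> R" using A R[OF x] by auto
      then have "dist (G j x) (G0 x) < e" using elim by simp
      then show "dist (flux N (source (F (p j)) (\<beta> (p j)) (vp (p j))) x) (Gl x) < e"
        using x0 by (simp add: G_def Gl_def)
    qed
  qed
qed

lemma grad_V: "grad (\<lambda>x::'a::euclidean_space. vp (p j) (norm x)) x = dV j (norm x) *\<^sub>R sgn x"
  by (simp add: S.grad_radial dV_def)

lemma weak_star_grad_V:
  assumes "radial_approx V dV Vl dVl B" and bd: "\<And>r. \<bar>dVl r\<bar> \<le> \<xi>2"
  shows "weak_star_Linf_loc UNIV (\<lambda>j. grad (\<lambda>x::'a::euclidean_space. vp (p j) (norm x))) (\<lambda>x. dVl (norm x) *\<^sub>R sgn x)"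
proof -
  interpret A: radial_approx V dV Vl dVl B by fact
  have g: "grad (\<lambda>x::'a. vp (p j) (norm x)) = (\<lambda>x. dV j (norm x) *\<^sub>R sgn x)" for j
    by (rule ext) (rule grad_V)
  have le: "norm (a *\<^sub>R sgn x) \<le> \<xi>2" if "\<bar>a\<bar> \<le> \<xi>2" for a and x :: 'a
    using that pos by (auto simp: norm_sgn)
  show ?thesis unfolding weak_star_Linf_loc_def g
  proof (intro conjI allI impI)
    show "Linf_loc UNIV (\<lambda>x::'a. dV j (norm x) *\<^sub>R sgn x)" for j
      by (rule Linf_loc_bounded) (use le[OF V_bounds(3)] in auto)
    show "Linf_loc UNIV (\<lambda>x::'a. dVl (norm x) *\<^sub>R sgn x)"
      by (rule Linf_loc_bounded) (use le[OF bd] in auto)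
    fix U and \<psi> :: "'a \<Rightarrow> 'a" assume U: "compactly_inside U UNIV \<and> set_integrable lebesgue U \<psi>"
    then have "bounded U" unfolding compactly_inside_def
      by (meson bounded_subset closure_subset compact_imp_bounded)
    then obtain R where R: "0 < R" "\<And>x. x \<in> U \<Longrightarrow> norm x \<le> R" unfolding bounded_pos by blast
    \<comment> \<open>The radial direction is absorbed into the scalar weight, so the vector
      statement becomes weak convergence of radial scalars.\<close>
    define k where "k x = sgn x \<bullet> (indicator U x *\<^sub>R \<psi> x)" for x
    have i: "integrable lebesgue (\<lambda>x. indicator U x *\<^sub>R \<psi> x)" using U by (simp add: set_integrable_def)
    have ki: "integrable lebesgue k"
    proof (rule Bochner_Integration.integrable_bound[OF i])
      have s: "(sgn :: 'a \<Rightarrow> 'a) \<in> borel_measurable lebesgue" by (rule measurable_completion) simp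
      show "k \<in> borel_measurable lebesgue" unfolding k_def
        by (intro borel_measurable_inner s borel_measurable_integrable[OF i])
      have "norm (k x) \<le> norm (indicator U x *\<^sub>R \<psi> x)" for x
      proof -
        have "norm (k x) \<le> norm (sgn x) * norm (indicator U x *\<^sub>R \<psi> x)"
          unfolding k_def real_norm_def by (rule Cauchy_Schwarz_ineq2)
        also have "\<dots> \<le> 1 * norm (indicator U x *\<^sub>R \<psi> x)" by (intro mult_right_mono norm_sgn_le_1) simp
        finally show ?thesis by simp
      qed
      then show "AE x in lebesgue. norm (k x) \<le> norm (indicator U x *\<^sub>R \<psi> x)" by simp
    qed
    have "(\<lambda>j. \<integral>x. dV j (norm x) * k x \<partial>lebesgue) \<longlonglongrightarrow> (LINT x|lebesgue. dVl (norm x) * k x)"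
      by (rule A.weak_radial[OF ki, of R]) (use R in \<open>force simp: k_def indicator_def\<close>)+
    moreover have "(LINT x:U|lebesgue. (d (norm x) *\<^sub>R sgn x) \<bullet> \<psi> x) = (LINT x|lebesgue. d (norm x) * k x)" for d
      unfolding set_lebesgue_integral_def k_def
      by (rule Bochner_Integration.integral_cong) (auto simp: indicator_def)
    ultimately show "(\<lambda>j. LINT x:U|lebesgue. (dV j (norm x) *\<^sub>R sgn x) \<bullet> \<psi> x) \<longlonglongrightarrow> (LINT x:U|lebesgue. (dVl (norm x) *\<^sub>R sgn x) \<bullet> \<psi> x)"
      by simp
  qed
qed

lemma AE_isCont_norm: "AE x::'a::euclidean_space in lebesgue. x \<noteq> 0 \<and> isCont W0 (norm x)"
proof -
  have "AE x::'a in lebesgue. x \<noteq> 0 \<longrightarrow> isCont W0 (norm x)"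
    by (rule AE_lebesgue_norm) (use AE_completion[OF AE_isCont] in auto)
  with AE_completion[OF AE_lborel_singleton[of "0::'a"]] show ?thesis by eventually_elim auto
qed

lemma powr_lim_AE: "AE x::'a::euclidean_space in lebesgue. (\<lambda>j. vp (p j) (norm x) powr (p j - 1)) \<longlonglongrightarrow> w (norm x)"
  using AE_isCont_norm
proof eventually_elim
  case (elim x)
  then show ?case using w_lim[of "norm x"] by (simp add: V_def)
qed

lemma w_eq_1_AE: "AE x::'a::euclidean_space in lebesgue. 0 < Vl (norm x) \<longrightarrow> w (norm x) = 1"
  using AE_isCont_norm by eventually_elim (use w_eq_1 in auto)

text \<open>Dominated convergence: the powers lie between \<open>0\<close> and
  \<open>max 1 \<xi>1\<close> for every \<open>j\<close>, and so does \<open>w\<close>.\<close>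

lemma Lq_loc_powr:
  assumes q: "1 \<le> q"
  shows "Lq_loc_limit q (\<lambda>j (x::'a::euclidean_space). vp (p j) (norm x) powr (p j - 1)) (\<lambda>x. w (norm x))"
proof -
  define M where "M = max 1 \<xi>1"
  have fm: "(\<lambda>x::'a. vp (p j) (norm x) powr (p j - 1)) \<in> borel_measurable borel" for j
  proof -
    have "(\<lambda>x::'a. V j (norm x) powr (p j - 1)) \<in> borel_measurable borel" by measurable
    then show ?thesis by (simp add: V_def)
  qed
  have fb: "0 < vp (p j) (norm x) powr (p j - 1)" "vp (p j) (norm x) powr (p j - 1) \<le> M" for j and x :: 'a
    using V_powr_bounds[of j "norm x"] by (auto simp: V_def M_def)
  have wm: "(\<lambda>x::'a. w (norm x)) \<in> borel_measurable borel" by measurable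
  have wb: "\<bar>w r\<bar> \<le> M" for r using w_bounds[of r] by (simp add: M_def)
  have fin: "(\<integral>\<^sup>+x\<in>A. ennreal C \<partial>lebesgue) < \<infinity>" if A: "compact A" for A :: "'a set" and C
  proof -
    have "A \<in> sets lebesgue" "emeasure lebesgue A < \<infinity>"
      using A emeasure_bounded_finite[OF compact_imp_bounded[OF A]] by (auto simp: compact_imp_closed borel_closed)
    then show ?thesis by (simp add: nn_integral_cmult_indicator ennreal_mult_less_top)
  qed
  have Lq: "Lq_loc q f" if [measurable]: "f \<in> borel_measurable borel" and f: "\<And>x. \<bar>f x\<bar> \<le> M" for f :: "'a \<Rightarrow> real"
    unfolding Lq_loc_def
  proof (intro conjI allI impI)
    show "f \<in> borel_measurable lebesgue" by (rule measurable_completion) simp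
    fix A :: "'a set" assume A: "compact A"
    have "(\<integral>\<^sup>+x\<in>A. ennreal (\<bar>f x\<bar> powr q) \<partial>lebesgue) \<le> (\<integral>\<^sup>+x\<in>A. ennreal (M powr q) \<partial>lebesgue)"
      using q f by (intro nn_integral_mono mult_right_mono ennreal_leI powr_mono2) auto
    also have "\<dots> < \<infinity>" by (rule fin[OF A])
    finally show "(\<integral>\<^sup>+x\<in>A. ennreal (\<bar>f x\<bar> powr q) \<partial>lebesgue) < \<infinity>" .
  qed
  show ?thesis unfolding Lq_loc_limit_def
  proof (intro conjI allI impI)
    show "Lq_loc q (\<lambda>x::'a. vp (p j) (norm x) powr (p j - 1))" for j
      by (rule Lq[OF fm]) (use fb in \<open>auto simp: less_imp_le\<close>)
    show "Lq_loc q (\<lambda>x::'a. w (norm x))" by (rule Lq[OF wm wb])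
    fix A :: "'a set" assume A: "compact A"
    then have Ab: "A \<in> sets borel" by (simp add: compact_imp_closed borel_closed)
    define k where "k j x = \<bar>vp (p j) (norm x) powr (p j - 1) - w (norm x)\<bar>" for j and x :: 'a
    have kM: "k j x \<le> 2 * M" for j x
      unfolding k_def using fb[of j x] wb[of "norm x"] by linarith
    have km: "k j \<in> borel_measurable borel" for j
      unfolding k_def using fm[of j] wm by measurable
    have "(\<lambda>j. \<integral>\<^sup>+x. ennreal (k j x powr q) * indicator A x \<partial>lebesgue) \<longlonglongrightarrow> (\<integral>\<^sup>+x. 0 \<partial>(lebesgue :: 'a measure))"
    proof (rule nn_integral_dominated_convergence[where w="\<lambda>x. ennreal ((2 * M) powr q) * indicator A x"])
      show "(\<lambda>x. ennreal (k j x powr q) * indicator A x) \<in> borel_measurable lebesgue" for j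
        by (rule measurable_completion) (use km[of j] Ab in measurable)
      show "(\<lambda>x. ennreal ((2 * M) powr q) * indicator A x) \<in> borel_measurable lebesgue"
        by (rule measurable_completion) (use Ab in measurable)
      show "AE x in lebesgue. ennreal (k j x powr q) * indicator A x \<le> ennreal ((2 * M) powr q) * indicator A x" for j
        using kM q by (intro AE_I2 mult_right_mono ennreal_leI powr_mono2) (auto simp: k_def)
      show "(\<integral>\<^sup>+x. ennreal ((2 * M) powr q) * indicator A x \<partial>lebesgue) < \<infinity>" by (rule fin[OF A])
      show "AE x in lebesgue. (\<lambda>j. ennreal (k j x powr q) * indicator A x) \<longlonglongrightarrow> 0"
        using powr_lim_AE
      proof eventually_elim
        case (elim x)
        have "(\<lambda>j. k j x) \<longlonglongrightarrow> \<bar>w (norm x) - w (norm x)\<bar>" unfolding k_def by (intro tendsto_intros elim)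
        then have "(\<lambda>j. k j x) \<longlonglongrightarrow> 0" by simp
        then have "(\<lambda>j. k j x powr q) \<longlonglongrightarrow> 0"
          by (rule tendsto_zero_powrI[OF _ tendsto_const]) (use q in \<open>auto simp: k_def intro!: always_eventually\<close>)
        then have "(\<lambda>j. ennreal (k j x powr q)) \<longlonglongrightarrow> ennreal 0" by (rule tendsto_ennrealI)
        then show ?case by (cases "x \<in> A") auto
      qed
    qed auto
    then show "(\<lambda>j. \<integral>\<^sup>+x\<in>A. ennreal (\<bar>vp (p j) (norm x) powr (p j - 1) - w (norm x)\<bar> powr q) \<partial>lebesgue) \<longlonglongrightarrow> 0"
      by (simp add: k_def)
  qed
qed

text \<open>On \<open>[0,1]\<close> all sources share a bound \<open>C\<close>, so the linear bound
  for the flux holds with one slope for all \<open>j\<close> and for the limit. A single radius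
  therefore keeps all of them below \<open>1 / 2\<close>, which becomes the constant
  \<open>\<delta>\<close> of the theorem.\<close>

lemma near_origin:
  obtains r0 where "0 < r0" "\<And>j r. 0 \<le> r \<Longrightarrow> r \<le> r0 \<Longrightarrow> G j r \<le> 1 / 2" "\<And>r. 0 \<le> r \<Longrightarrow> r \<le> r0 \<Longrightarrow> Gl r \<le> 1 / 2"
proof -
  obtain C where C: "0 \<le> C" "\<And>j r. 0 \<le> r \<Longrightarrow> r \<le> 1 \<Longrightarrow> K j r \<le> C" using K_bound[of 1] by blast
  define r0 where "r0 = min 1 (1 / (2 * (C + 1)))"
  have half: "C * r / real N \<le> 1 / 2" if "0 \<le> r" "r \<le> r0" for r
  proof -
    have "r \<le> 1 / (2 * (C + 1))" using that by (simp add: r0_def)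
    then have "C * r \<le> C * (1 / (2 * (C + 1)))" using C(1) by (intro mult_left_mono) auto
    also have "\<dots> \<le> 1 / 2" using C(1) by (simp add: field_simps)
    finally have "C * r \<le> 1 / 2" .
    moreover have "C * r / real N \<le> C * r / 1" using N C(1) that by (intro divide_left_mono) auto
    ultimately show ?thesis by linarith
  qed
  have r1: "r0 \<le> 1" by (simp add: r0_def)
  show thesis
  proof
    show "0 < r0" using C(1) by (simp add: r0_def)
    show "G j r \<le> 1 / 2" if "0 \<le> r" "r \<le> r0" for j r
      by (rule order_trans[OF G_le_linear[of r 1 C j] half[OF that]]) (use that r1 C in auto)
    show "Gl r \<le> 1 / 2" if "0 \<le> r" "r \<le> r0" for r
      by (rule order_trans[OF Gl_linear[of r 1 C] half[OF that]]) (use that r1 C in auto)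
  qed
qed

end

section \<open>Assembly of the limit objects\<close>

theorem theorem1p1:
  fixes \<alpha> l \<xi>1 \<xi>2 c :: real
    and F :: "real \<Rightarrow> real \<times> real \<times> real \<Rightarrow> real"
    and \<phi> :: "real \<Rightarrow> real \<times> real \<Rightarrow> real"
    and \<beta> :: "real \<Rightarrow> real"
    and v\<^sub>p :: "real \<Rightarrow> real \<Rightarrow> real"
    and F1 :: "real \<times> real \<times> real \<Rightarrow> real"
    and p :: "nat \<Rightarrow> real"
  assumes n: "CARD('n::finite) \<ge> 2"
    and \<alpha>: "0 < \<alpha>" "\<alpha> \<le> 1"
    and pos: "0 < l" "0 < \<xi>1" "0 < \<xi>2"
    and p_range: "\<And>j. 1 < p j \<and> p j < min 2 (sqrt (real CARD('n)))"
    and p_lim: "decseq p" "p \<longlonglongrightarrow> 1"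
    and adm: "\<And>j. admissible CARD('n) \<alpha> l \<xi>1 \<xi>2 (p j) (F (p j)) (\<phi> (p j)) (\<beta> (p j))"
    and F1: "holder_loc \<alpha> ({0..} \<times> {0..} \<times> {0..}) F1"
    and F_lim: "loc_uniform_limit ({0..} \<times> {0..} \<times> {0..}) F F1 (at_right 1)"
    and \<beta>_lim: "((\<lambda>q. \<beta> q / (q - 1)) \<longlongrightarrow> c) (at_right 1)"
    and c: "0 \<le> c" "c \<le> 1"
    and sol: "\<And>j. radial_solution CARD('n) l \<xi>1 \<xi>2 (p j) (F (p j)) (\<beta> (p j)) (v\<^sub>p (p j))"
  shows
    "\<exists>(\<sigma> :: nat \<Rightarrow> nat) (u :: real ^ 'n \<Rightarrow> real) (Du :: real ^ 'n \<Rightarrow> real ^ 'n)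
       (v :: real \<Rightarrow> real) (w :: real ^ 'n \<Rightarrow> real).
      strict_mono \<sigma> \<and>
      loc_uniform_limit UNIV (\<lambda>j x. v\<^sub>p (p (\<sigma> j)) (norm x)) u sequentially \<and>
      has_weak_grad UNIV u Du \<and>
      weak_star_Linf_loc UNIV (\<lambda>j. grad (\<lambda>x. v\<^sub>p (p (\<sigma> j)) (norm x))) Du \<and>
      (\<forall>x. u x = v (norm x)) \<and>
      W1inf UNIV u \<and>
      (\<forall>x. 0 \<le> u x \<and> u x \<le> \<xi>1) \<and>
      Linf_norm UNIV Du \<le> ereal \<xi>2 \<and>
      radial w \<and> (\<forall>x. 0 < w x \<and> w x \<le> 1) \<and>
      (AE x in lebesgue. (\<lambda>j. v\<^sub>p (p (\<sigma> j)) (norm x) powr (p (\<sigma> j) - 1)) \<longlonglongrightarrow> w x) \<and>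
      (\<forall>q\<ge>1. Lq_loc_limit q (\<lambda>j x. v\<^sub>p (p (\<sigma> j)) (norm x) powr (p (\<sigma> j) - 1)) w) \<and>
      (AE x in lebesgue. max l (norm x) powr (- (real CARD('n) - 1)) \<le> w x \<and> w x \<le> 1) \<and>
      (AE x in lebesgue. u x > 0 \<longrightarrow> w x = 1) \<and>
      (\<exists>(G :: real \<Rightarrow> real) (DG :: real \<Rightarrow> real) (K :: real \<Rightarrow> real)
         (z :: real ^ 'n \<Rightarrow> real ^ 'n) (Dv :: real \<Rightarrow> real).
        W1inf_loc_halfline G \<and> has_weak_grad {0<..} G DG \<and>
        Linf_loc_halfline K \<and>
        W1inf_loc_vec UNIV z \<and>
        loc_uniform_limit {0..}
          (\<lambda>j. flux CARD('n) (source (F (p (\<sigma> j))) (\<beta> (p (\<sigma> j))) (v\<^sub>p (p (\<sigma> j))))) G sequentially \<and>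
        (\<forall>r\<ge>0. 0 \<le> G r \<and> G r \<le> 1) \<and> G 0 = 0 \<and>
        (\<forall>x. x \<noteq> 0 \<longrightarrow> z x = - (G (norm x) *\<^sub>R (x /\<^sub>R norm x))) \<and>
        (\<forall>x. norm (z x) \<le> 1) \<and>
        has_weak_div UNIV z (\<lambda>x. - K (norm x)) \<and>
        (AE r in lebesgue. r > 0 \<longrightarrow> K r = DG r + (real CARD('n) - 1) / r * G r) \<and>
        pairing_eq_total_variation z u \<and>
        (AE x in lebesgue. z x \<bullet> Du x = norm (Du x)) \<and>
        has_weak_grad {0<..} v Dv \<and>
        (AE r in lebesgue. r > 0 \<longrightarrow> (1 - G r) * \<bar>Dv r\<bar> = 0) \<and>
        (let C1 = {r. r > 0 \<and> G r = 1}; C_less = {r. r > 0 \<and> G r < 1} in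
          (AE x in lebesgue. norm x \<in> C_less \<longrightarrow>
             K (norm x) = w x powr (- c) * F1 (norm x, u x, 0)) \<and>
          (emeasure lebesgue C1 > 0 \<longrightarrow>
             (AE x :: real ^ 'n in lebesgue. norm x \<in> C1 \<longrightarrow>
                K (norm x) = (real CARD('n) - 1) / norm x))) \<and>
        (\<exists>r0 \<delta>. r0 > 0 \<and> 0 < \<delta> \<and> \<delta> < 1 \<and>
          (\<forall>\<^sub>F j in sequentially. \<forall>x :: real ^ 'n. norm x \<le> r0 \<longrightarrow>
             norm (grad (\<lambda>y. v\<^sub>p (p (\<sigma> j)) (norm y)) x) \<le> \<delta> powr (1 / (p (\<sigma> j) - 1))) \<and>
          (\<forall>r. 0 \<le> r \<and> r \<le> r0 \<longrightarrow> G r \<le> \<delta>) \<and>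
          (AE x in lebesgue. x \<in> ball 0 r0 \<longrightarrow> Du x = 0)))"
proof -
  have seq0: "p_laplace_seq CARD('n) \<alpha> l \<xi>1 \<xi>2 c F \<phi> \<beta> v\<^sub>p F1 p"
    by unfold_locales (fact assms)+
  interpret P: p_laplace_seq "CARD('n)" \<alpha> l \<xi>1 \<xi>2 c F \<phi> \<beta> v\<^sub>p F1 p by (rule seq0)
  obtain \<sigma> v0 G0 W0 where \<sigma>: "strict_mono \<sigma>"
    and L: "\<And>R. uniform_limit {0..R} (\<lambda>j. P.V (\<sigma> j)) v0 sequentially"
    "\<And>R. uniform_limit {0..R} (\<lambda>j. P.G (\<sigma> j)) G0 sequentially"
    "mono W0" "\<And>r. isCont W0 r \<Longrightarrow> (\<lambda>j. P.V (\<sigma> j) r powr (p (\<sigma> j) - 1)) \<longlonglongrightarrow> - W0 r"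
    by (rule P.extraction) (rule that)
  \<comment> \<open>The setting is reinterpreted along the subsequence, so the limit analysis deals
    with a sequence that already converges.\<close>
  interpret Q: p_laplace_seq "CARD('n)" \<alpha> l \<xi>1 \<xi>2 c F \<phi> \<beta> v\<^sub>p F1 "\<lambda>j. p (\<sigma> j)"
    by (rule P.subsequence[OF \<sigma>])
  have QV: "Q.V = (\<lambda>j. P.V (\<sigma> j))" "Q.G = (\<lambda>j. P.G (\<sigma> j))"
    by (auto simp: fun_eq_iff Q.V_def P.V_def Q.G_def P.G_def)
  interpret Q: p_laplace_limit "CARD('n)" \<alpha> l \<xi>1 \<xi>2 c F \<phi> \<beta> v\<^sub>p F1 "\<lambda>j. p (\<sigma> j)" v0 G0 W0
    by unfold_locales (use L in \<open>auto simp: QV\<close>)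
  obtain dVl where dVl: "radial_approx Q.V Q.dV Q.Vl dVl (\<lambda>_. max \<xi>1 \<xi>2)"
    "\<And>r. dVl r \<le> 0" "\<And>r. - \<xi>2 \<le> dVl r" "\<And>r. dVl r * Q.Gl r = dVl r"
    by (rule Q.radial_approx_V) (rule that)
  obtain B where B: "radial_approx Q.G Q.dG Q.Gl Q.dGl B" using Q.radial_approx_G by blast
  interpret V: radial_approx Q.V Q.dV Q.Vl dVl "\<lambda>_. max \<xi>1 \<xi>2" by (rule dVl(1))
  interpret G: radial_approx Q.G Q.dG Q.Gl Q.dGl B by (rule B)
  \<comment> \<open>\<open>z\<close> is the radial field with profile \<open>- G\<close>; the
    instance for the negated flux supplies its regularity and its divergence.\<close>
  interpret M: radial_approx "\<lambda>j r. - Q.G j r" "\<lambda>j r. - Q.dG j r" "\<lambda>r. - Q.Gl r" "\<lambda>r. - Q.dGl r" B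
    by (rule G.radial_approx_uminus)
  have dVl_abs: "\<bar>dVl r\<bar> \<le> \<xi>2" for r using dVl(2,3)[of r] by linarith
  obtain r0 where r0: "0 < r0" "\<And>j r. 0 \<le> r \<Longrightarrow> r \<le> r0 \<Longrightarrow> Q.G j r \<le> 1 / 2" "\<And>r. 0 \<le> r \<Longrightarrow> r \<le> r0 \<Longrightarrow> Q.Gl r \<le> 1 / 2"
    by (rule Q.near_origin) (rule that)
  define u where "u x = Q.Vl (norm x)" for x :: "real ^ 'n"
  define Du where "Du x = dVl (norm x) *\<^sub>R sgn x" for x :: "real ^ 'n"
  define z where "z x = - (Q.Gl (norm x) *\<^sub>R sgn x)" for x :: "real ^ 'n"
  have z_eq: "z = (\<lambda>x. (- Q.Gl (norm x)) *\<^sub>R sgn x)" by (simp add: z_def fun_eq_iff)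
  have Du_le: "norm (Du x) \<le> \<xi>2" for x
    using dVl_abs[of "norm x"] pos(3) by (auto simp: Du_def norm_sgn)
  have Kl_bounded: "Linf_loc_halfline Q.Kl"
    unfolding Linf_loc_halfline_def
  proof (intro allI impI)
    fix R :: real
    obtain C where "\<And>r. 0 \<le> r \<Longrightarrow> r \<le> R \<Longrightarrow> \<bar>Q.Kl r\<bar> \<le> C" using Q.Kl_bounds[of R] by blast
    then show "Linf {0<..<R} Q.Kl" by (intro Linf_bounded(1)[where C=C]) auto
  qed
  have z_div: "has_weak_div UNIV z (\<lambda>x. - Q.Kl (norm x))"
  proof -
    have "has_weak_div UNIV z (\<lambda>x. - Q.dGl (norm x) + (real DIM(real ^ 'n) - 1) / norm x * - Q.Gl (norm x))"
      unfolding z_eq by (rule M.radial_field_weak_div) (simp add: Q.G_zero)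
    then show ?thesis by (simp add: Q.Kl_eq)
  qed
  \<comment> \<open>The two minus signs, of \<open>z\<close> and of the nonincreasing
    \<open>v\<close>, cancel. At the origin both sides are \<open>0\<close> since
    \<open>sgn 0 = 0\<close>.\<close>
  have z_Du: "z x \<bullet> Du x = norm (Du x)" for x
  proof -
    have "z x \<bullet> Du x = - (dVl (norm x) * Q.Gl (norm x)) * (norm (sgn x))\<^sup>2"
      by (simp add: z_def Du_def power2_norm_eq_inner)
    also have "\<dots> = - dVl (norm x) * norm (sgn x)" unfolding dVl(4) by (simp add: norm_sgn)
    also have "\<dots> = norm (Du x)" using dVl(2)[of "norm x"] by (simp add: Du_def)
    finally show ?thesis .
  qed
  have dVl_0: "dVl r = 0" if "Q.Gl r < 1" for r using dVl(4)[of r] that by auto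
  have grad_le: "norm (grad (\<lambda>y. v\<^sub>p (p (\<sigma> j)) (norm y)) x) \<le> (1 / 2) powr (1 / (p (\<sigma> j) - 1))"
    if "norm x \<le> r0" for j and x :: "real ^ 'n"
  proof -
    have "norm (grad (\<lambda>y. v\<^sub>p (p (\<sigma> j)) (norm y)) x) \<le> \<bar>Q.dV j (norm x)\<bar>"
      unfolding Q.grad_V using norm_sgn_le_1[of x] by (simp add: mult_left_le)
    also have "\<dots> = Q.G j (norm x) powr (1 / (p (\<sigma> j) - 1))" by (simp add: Q.V_bounds(7))
    also have "\<dots> \<le> (1 / 2) powr (1 / (p (\<sigma> j) - 1))"
      using Q.V_bounds(5)[of j "norm x"] Q.p_gt[of j] r0(2)[OF norm_ge_zero that] by (intro powr_mono2) auto
    finally show ?thesis .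
  qed
  show ?thesis
  proof (rule exI[of _ \<sigma>], rule exI[of _ u], rule exI[of _ Du], rule exI[of _ Q.Vl],
      rule exI[of _ "\<lambda>x. Q.w (norm x)"], intro conjI exI)
    show "strict_mono \<sigma>" by (rule \<sigma>)
    show "loc_uniform_limit UNIV (\<lambda>j x. v\<^sub>p (p (\<sigma> j)) (norm x)) u sequentially"
      unfolding u_def by (rule Q.loc_uniform_V)
    show "has_weak_grad UNIV u Du" unfolding u_def Du_def by (rule V.radial_weak_grad)
    show "weak_star_Linf_loc UNIV (\<lambda>j. grad (\<lambda>x. v\<^sub>p (p (\<sigma> j)) (norm x))) Du"
      unfolding Du_def by (rule Q.weak_star_grad_V[OF dVl(1) dVl_abs])
    show "\<forall>x. u x = Q.Vl (norm x)" by (simp add: u_def)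
    show "W1inf UNIV u" unfolding u_def
      by (rule V.radial_W1inf[where C="max \<xi>1 \<xi>2"])
         (use Q.Vl_range dVl_abs in \<open>auto simp: le_max_iff_disj\<close>)
    show "\<forall>x. 0 \<le> u x \<and> u x \<le> \<xi>1" unfolding u_def using Q.Vl_range by blast
    show "Linf_norm UNIV Du \<le> ereal \<xi>2"
      by (rule Linf_bounded(2)) (use Du_le in \<open>auto simp: Du_def[abs_def]\<close>)
    show "radial (\<lambda>x::real^'n. Q.w (norm x))" by (simp add: radial_def)
    show "\<forall>x::real^'n. 0 < Q.w (norm x) \<and> Q.w (norm x) \<le> 1" using Q.w_bounds by blast
    show "AE x::real^'n in lebesgue. (\<lambda>j. v\<^sub>p (p (\<sigma> j)) (norm x) powr (p (\<sigma> j) - 1)) \<longlonglongrightarrow> Q.w (norm x)"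
      by (rule Q.powr_lim_AE)
    show "\<forall>q\<ge>1. Lq_loc_limit q (\<lambda>j (x::real^'n). v\<^sub>p (p (\<sigma> j)) (norm x) powr (p (\<sigma> j) - 1)) (\<lambda>x. Q.w (norm x))"
      using Q.Lq_loc_powr by blast
    show "AE x::real^'n in lebesgue. max l (norm x) powr (- (real CARD('n) - 1)) \<le> Q.w (norm x) \<and> Q.w (norm x) \<le> 1"
      using Q.w_bounds by blast
    show "AE x in lebesgue. 0 < u x \<longrightarrow> Q.w (norm x) = 1" unfolding u_def by (rule Q.w_eq_1_AE)
    show "W1inf_loc_halfline Q.Gl" unfolding W1inf_loc_halfline_def by (simp add: G.half_line_W1inf)
    show "has_weak_grad {0<..} Q.Gl Q.dGl" by (rule G.half_line_weak_grad)
    show "Linf_loc_halfline Q.Kl" by (rule Kl_bounded)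
    show "W1inf_loc_vec UNIV z" unfolding z_eq by (rule M.radial_field_W1inf_loc) (simp add: Q.G_zero)
    show "loc_uniform_limit {0..}
          (\<lambda>j. flux CARD('n) (source (F (p (\<sigma> j))) (\<beta> (p (\<sigma> j))) (v\<^sub>p (p (\<sigma> j))))) Q.Gl sequentially"
      by (rule Q.loc_uniform_G)
    show "\<forall>r\<ge>0. 0 \<le> Q.Gl r \<and> Q.Gl r \<le> 1" using Q.Gl_range by blast
    show "Q.Gl 0 = 0" by (rule Q.Gl_zero)
    show "\<forall>x. x \<noteq> 0 \<longrightarrow> z x = - (Q.Gl (norm x) *\<^sub>R (x /\<^sub>R norm x))" by (simp add: z_def sgn_div_norm)
    show "\<forall>x. norm (z x) \<le> 1" using Q.Gl_range by (auto simp: z_def norm_sgn)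
    show "has_weak_div UNIV z (\<lambda>x. - Q.Kl (norm x))" by (rule z_div)
    show "AE r in lebesgue. 0 < r \<longrightarrow> Q.Kl r = Q.dGl r + (real CARD('n) - 1) / r * Q.Gl r"
      by (intro AE_I2 impI Q.Kl_eq) simp
    show "pairing_eq_total_variation z u"
      unfolding z_def u_def
      by (rule pairing_eq_total_variation_radial[OF dVl(1) B Q.G_zero dVl(2,3,4)])
    show "AE x in lebesgue. z x \<bullet> Du x = norm (Du x)" by (simp add: z_Du)
    show "has_weak_grad {0<..} Q.Vl dVl" by (rule V.half_line_weak_grad)
    show "AE r in lebesgue. 0 < r \<longrightarrow> (1 - Q.Gl r) * \<bar>dVl r\<bar> = 0"
    proof (intro AE_I2 impI)
      fix r show "(1 - Q.Gl r) * \<bar>dVl r\<bar> = 0"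
        using dVl_0[of r] Q.Gl_range(2)[of r] by (cases "Q.Gl r < 1") auto
    qed
    \<comment> \<open>\<open>Q.Kl\<close> is defined by this case distinction, so both identities
      hold at every point concerned, whatever the measure of the set where the flux is
      \<open>1\<close>.\<close>
    show "let C1 = {r. 0 < r \<and> Q.Gl r = 1}; C_less = {r. 0 < r \<and> Q.Gl r < 1} in
          (AE x in lebesgue. norm x \<in> C_less \<longrightarrow> Q.Kl (norm x) = Q.w (norm x) powr (- c) * F1 (norm x, u x, 0)) \<and>
          (emeasure lebesgue C1 > 0 \<longrightarrow>
             (AE x :: real ^ 'n in lebesgue. norm x \<in> C1 \<longrightarrow> Q.Kl (norm x) = (real CARD('n) - 1) / norm x))"
      unfolding Let_def by (auto simp: Q.Kl_def u_def intro!: AE_I2)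
    show "0 < r0" by (rule r0(1))
    show "0 < (1 / 2 :: real)" "(1 / 2 :: real) < 1" by simp_all
    show "\<forall>\<^sub>F j in sequentially. \<forall>x :: real ^ 'n. norm x \<le> r0 \<longrightarrow>
        norm (grad (\<lambda>y. v\<^sub>p (p (\<sigma> j)) (norm y)) x) \<le> (1 / 2) powr (1 / (p (\<sigma> j) - 1))"
      using grad_le by (intro always_eventually) auto
    show "\<forall>r. 0 \<le> r \<and> r \<le> r0 \<longrightarrow> Q.Gl r \<le> 1 / 2" using r0(3) by blast
    \<comment> \<open>The flux is at most \<open>1 / 2\<close> on the ball, and \<open>dVl\<close>
      vanishes wherever the flux is below \<open>1\<close>.\<close>
    show "AE x in lebesgue. x \<in> ball 0 r0 \<longrightarrow> Du x = 0"
    proof (intro AE_I2 impI)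
      fix x :: "real ^ 'n" assume "x \<in> ball 0 r0"
      then have "Q.Gl (norm x) < 1" using r0(3)[of "norm x"] by simp
      then show "Du x = 0" by (simp add: Du_def dVl_0)
    qed
  qed
qed

end
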